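(* Let $g_\delta$, $\delta=(h,\tau)$, be the step functions generated by the truncated explicit scheme (defined in the context). Then, as $\delta\to0$ under the scaling condition $\tau=h^{2-\alpha}$, $h^{1-(\alpha+\beta)}\le\frac27$ (with fixed $\alpha>0$, $\beta>\frac12$, $\alpha+\beta<1$), the sequence $\{g_\delta\}$ is bounded in $L^p([0,T];L^p(\mathbb{R}^3))$ for all $1\le p<\infty$, with $$\limsup_{\delta\to0}\|g_\delta\|_{L^p([0,T];L^p(\mathbb{R}^3))}\le T^{\frac1p}\|\tilde f^0\|_{L^p(\mathbb{R}^3)}=T^{\frac1p}\|f^0\|_{L^p(\Omega)} .$$
   Context: Setting. $T>0$; $\Omega\subset\mathbb{R}^3$ is a bounded connected open set; $v\in L^2([0,T];H^1_0(\Omega)^3)\cap L^\infty([0,T];L^2(\Omega)^3)$ with $\nabla\cdot v=0$ and $\mathrm{supp}(v)\subset[0,T]\times\Omega$ (so $v$ vanishes for $x$ near $\partial\Omega$); $f^0\in L^\infty(\Omega)$ with $f^0\equiv0$ in a neighborhood of $\partial\Omega$. $\tilde v,\tilde f^0$ are the extensions of $v,f^0$ by $0$ to $x\in\mathbb{R}^3\setminus\Omega$. Grid. $h,\tau>0$ are the space and time mesh sizes, $t_n=n\tau$, and $T_\tau\in\mathbb{N}$ is such that $T\in[\tau T_\tau,\tau T_\tau+\tau)$. $e^1,e^2,e^3$ is the standard basis of $\mathbb{R}^3$; $B=\{\pm e^1,\pm e^2,\pm e^3,0\}$; $C_h(x)=\prod_{i=1}^3[x_i-\frac h2,x_i+\frac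 h2)$; $D_j\phi(x)=\frac{\phi(x+he^j)-\phi(x-he^j)}{2h}$ for $\phi:h\mathbb{Z}^3\to\mathbb{R}$. Discrete data. $g^0(x)=\frac1{h^3}\int_{C_h(x)}\tilde f^0(y)\,dy$, $u^n_i(x)=\frac{1}{\tau h^3}\int_{\tau n}^{\tau(n+1)}\int_{C_h(x)}\tilde v_i(s,y)\,dy\,ds$ for $x\in h\mathbb{Z}^3$, $0\le n\le T_\tau-1$. Truncation: $\tilde u^n_j(x)=u^n_j(x)$ if $|u^n_j(x)|\le h^{-\beta}$, and $\tilde u^n_j(x)=\mathrm{sign}(u^n_j(x))h^{-\beta}$ otherwise. Only sufficiently small $h$ are considered (so that $g^0,u^n$ vanish at and outside the boundary of $\{x\in\Omega\cap h\mathbb{Z}^3:C_{2h}(x)\subset\Omega\}$). Truncated explicit scheme. For $n=0,\dots,T_\tau-1$ and $x\in h\mathbb{Z}^3$, $$\Big(g^{n+1}(x)-\frac17\sum_{\omega\in B}g^n(x+h\omega)\Big)\frac1\tau+\sum_{j=1}^3\tilde u^n_j(x)D_jg^n(x)=0 .$$ Step function: $g_\delta:[0,\tau T_\tau+\tau)\times\mathbb{R}^3\to\mathbb{R}$, $g_\delta(s,y)=g^n(x)$ if $s\in[t_n,t_{n+1})$, $y\in C_h(x)$, $x\in h\mathbb{Z}^3$. *)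

theory Defs
  imports "HOL-Analysis.Analysis"
begin

type_synonym R3 = "real ^ 3"

section \<open>Function spaces\<close>

text \<open>Elements of Lebesgue and Bochner spaces are given by representatives; all membership
  predicates below are invariant under modification on a null set that preserves measurability.\<close>

definition pderiv3 :: "3 \<Rightarrow> (R3 \<Rightarrow> real) \<Rightarrow> R3 \<Rightarrow> real" where
  "pderiv3 i \<phi> x = frechet_derivative \<phi> (at x) (axis i 1)"

definition grad :: "(R3 \<Rightarrow> real) \<Rightarrow> R3 \<Rightarrow> R3" where
  "grad \<phi> x = (\<chi> i. pderiv3 i \<phi> x)"

fun C_k :: "nat \<Rightarrow> (R3 \<Rightarrow> real) \<Rightarrow> bool" where
  "C_k 0 \<phi> \<longleftrightarrow> continuous_on UNIV \<phi>"
| "C_k (Suc k) \<phi> \<longleftrightarrow> (\<forall>x. \<phi> differentiable (at x)) \<and> (\<forall>i. C_k k (pderiv3 i \<phi>))"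

definition test_function :: "R3 set \<Rightarrow> (R3 \<Rightarrow> real) \<Rightarrow> bool" where
  "test_function \<Omega> \<phi> \<longleftrightarrow>
     (\<forall>k. C_k k \<phi>) \<and> compact (closure {x. \<phi> x \<noteq> 0}) \<and> closure {x. \<phi> x \<noteq> 0} \<subseteq> \<Omega>"

definition Lp_space :: "real \<Rightarrow> R3 set \<Rightarrow> (R3 \<Rightarrow> real) \<Rightarrow> bool" where
  "Lp_space p S u \<longleftrightarrow>
     u \<in> borel_measurable (lebesgue_on S) \<and> set_integrable lebesgue S (\<lambda>x. \<bar>u x\<bar> powr p)"

definition Lp_norm :: "real \<Rightarrow> R3 set \<Rightarrow> (R3 \<Rightarrow> real) \<Rightarrow> real" where
  "Lp_norm p S u = (LINT x:S|lebesgue. \<bar>u x\<bar> powr p) powr (1 / p)"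

definition Linf_space :: "R3 set \<Rightarrow> (R3 \<Rightarrow> real) \<Rightarrow> bool" where
  "Linf_space S u \<longleftrightarrow>
     u \<in> borel_measurable (lebesgue_on S) \<and> (\<exists>M. AE x in lebesgue_on S. \<bar>u x\<bar> \<le> M)"

definition has_weak_grad :: "R3 set \<Rightarrow> (R3 \<Rightarrow> real) \<Rightarrow> (R3 \<Rightarrow> R3) \<Rightarrow> bool" where
  "has_weak_grad \<Omega> u G \<longleftrightarrow> (\<forall>\<phi> i. test_function \<Omega> \<phi> \<longrightarrow>
     (LINT x:\<Omega>|lebesgue. u x * pderiv3 i \<phi> x) = - (LINT x:\<Omega>|lebesgue. G x $ i * \<phi> x))"

definition weak_div_free :: "R3 set \<Rightarrow> (R3 \<Rightarrow> R3) \<Rightarrow> bool" where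
  "weak_div_free \<Omega> w \<longleftrightarrow>
     (\<forall>\<phi>. test_function \<Omega> \<phi> \<longrightarrow> (LINT x:\<Omega>|lebesgue. w x \<bullet> grad \<phi> x) = 0)"

definition H1 :: "R3 set \<Rightarrow> (R3 \<Rightarrow> real) \<Rightarrow> (R3 \<Rightarrow> R3) \<Rightarrow> bool" where
  "H1 \<Omega> u G \<longleftrightarrow> Lp_space 2 \<Omega> u \<and> (\<forall>i. Lp_space 2 \<Omega> (\<lambda>x. G x $ i)) \<and> has_weak_grad \<Omega> u G"

text \<open>\<open>H10 \<Omega> u G\<close>: the function \<open>u\<close>, with weak gradient \<open>G\<close>, lies in the closure of the test
  functions on \<open>\<Omega>\<close> with respect to the \<open>H\<^sup>1\<close> norm. The gradient is carried along because it is
  needed as a jointly measurable function of time and space below.\<close>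

definition H10 :: "R3 set \<Rightarrow> (R3 \<Rightarrow> real) \<Rightarrow> (R3 \<Rightarrow> R3) \<Rightarrow> bool" where
  "H10 \<Omega> u G \<longleftrightarrow> H1 \<Omega> u G \<and>
     (\<exists>\<phi> :: nat \<Rightarrow> R3 \<Rightarrow> real. (\<forall>k. test_function \<Omega> (\<phi> k)) \<and>
        (\<lambda>k. \<integral>\<^sup>+x\<in>\<Omega>. ennreal ((\<phi> k x - u x)\<^sup>2 + (norm (grad (\<phi> k) x - G x))\<^sup>2) \<partial>lebesgue)
          \<longlonglongrightarrow> 0)"

text \<open>\<open>L\<^sup>2([0,T]; H\<^sup>1\<^sub>0(\<Omega>)\<^sup>3)\<close> and \<open>L\<^sup>\<infinity>([0,T]; L\<^sup>2(\<Omega>)\<^sup>3)\<close>: since these target spaces are separable,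
  the elements of the Bochner spaces are exactly the classes of jointly measurable functions
  for which the norm of the time slices is square integrable, respectively essentially bounded.
  Row \<open>i\<close> of \<open>G t x\<close> is the weak gradient of component \<open>i\<close> of \<open>v t\<close>.\<close>

definition L2_H10 :: "real \<Rightarrow> R3 set \<Rightarrow> (real \<Rightarrow> R3 \<Rightarrow> R3) \<Rightarrow> bool" where
  "L2_H10 T \<Omega> v \<longleftrightarrow>
     (\<lambda>(t, x). v t x) \<in> borel_measurable (lebesgue_on ({0..T} \<times> \<Omega>)) \<and>
     (\<exists>G :: real \<Rightarrow> R3 \<Rightarrow> real ^ 3 ^ 3.
        (\<lambda>(t, x). G t x) \<in> borel_measurable (lebesgue_on ({0..T} \<times> \<Omega>)) \<and>
        (AE t in lebesgue_on {0..T}. \<forall>i. H10 \<Omega> (\<lambda>x. v t x $ i) (\<lambda>x. G t x $ i)) \<and>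
        (\<integral>\<^sup>+t\<in>{0..T}. (\<integral>\<^sup>+x\<in>\<Omega>. ennreal ((norm (v t x))\<^sup>2 + (norm (G t x))\<^sup>2) \<partial>lebesgue) \<partial>lebesgue)
          < \<infinity>)"

definition Linf_L2 :: "real \<Rightarrow> R3 set \<Rightarrow> (real \<Rightarrow> R3 \<Rightarrow> R3) \<Rightarrow> bool" where
  "Linf_L2 T \<Omega> v \<longleftrightarrow>
     (\<lambda>(t, x). v t x) \<in> borel_measurable (lebesgue_on ({0..T} \<times> \<Omega>)) \<and>
     (\<exists>M :: real. AE t in lebesgue_on {0..T}.
        (\<integral>\<^sup>+x\<in>\<Omega>. ennreal ((norm (v t x))\<^sup>2) \<partial>lebesgue) \<le> ennreal M)"

definition ext0 :: "'a set \<Rightarrow> ('a \<Rightarrow> 'b::zero) \<Rightarrow> 'a \<Rightarrow> 'b" where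
  "ext0 S u x = (if x \<in> S then u x else 0)"

text \<open>The (closed) support of an almost-everywhere class on the whole space.\<close>

definition ess_support :: "('a::euclidean_space \<Rightarrow> 'b::zero) \<Rightarrow> 'a set" where
  "ess_support F = {z. \<forall>U. open U \<longrightarrow> z \<in> U \<longrightarrow> \<not> (AE w in lebesgue. w \<in> U \<longrightarrow> F w = 0)}"

definition LpLp_space :: "real \<Rightarrow> real \<Rightarrow> (real \<Rightarrow> R3 \<Rightarrow> real) \<Rightarrow> bool" where
  "LpLp_space p T F \<longleftrightarrow>
     (\<lambda>(t, x). F t x) \<in> borel_measurable (lebesgue_on ({0..T} \<times> UNIV)) \<and>
     (AE t in lebesgue_on {0..T}. Lp_space p UNIV (F t)) \<and>
     set_integrable lebesgue {0..T} (\<lambda>t. Lp_norm p UNIV (F t) powr p)"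

definition LpLp_norm :: "real \<Rightarrow> real \<Rightarrow> (real \<Rightarrow> R3 \<Rightarrow> real) \<Rightarrow> real" where
  "LpLp_norm p T F = (LINT t:{0..T}|lebesgue. Lp_norm p UNIV (F t) powr p) powr (1 / p)"

section \<open>The truncated explicit scheme\<close>

definition grid :: "real \<Rightarrow> R3 set" where
  "grid h = {x. \<forall>i. \<exists>k::int. x $ i = h * of_int k}"

definition cell :: "real \<Rightarrow> R3 \<Rightarrow> R3 set" where
  "cell h x = {y. \<forall>i. x $ i - h / 2 \<le> y $ i \<and> y $ i < x $ i + h / 2}"

definition stencil :: "R3 set" where
  "stencil = range (\<lambda>i. axis i 1) \<union> range (\<lambda>i. - axis i 1) \<union> {0}"

definition cdiff :: "real \<Rightarrow> 3 \<Rightarrow> (R3 \<Rightarrow> real) \<Rightarrow> R3 \<Rightarrow> real" where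
  "cdiff h j \<phi> x = (\<phi> (x + h *\<^sub>R axis j 1) - \<phi> (x - h *\<^sub>R axis j 1)) / (2 * h)"

definition g_init :: "real \<Rightarrow> R3 set \<Rightarrow> (R3 \<Rightarrow> real) \<Rightarrow> R3 \<Rightarrow> real" where
  "g_init h \<Omega> f0 x = 1 / h ^ 3 * (LINT y:cell h x|lebesgue. ext0 \<Omega> f0 y)"

definition u_disc ::
  "real \<Rightarrow> real \<Rightarrow> R3 set \<Rightarrow> (real \<Rightarrow> R3 \<Rightarrow> R3) \<Rightarrow> nat \<Rightarrow> 3 \<Rightarrow> R3 \<Rightarrow> real" where
  "u_disc h \<tau> \<Omega> v n i x = 1 / (\<tau> * h ^ 3) *
     (LINT s:{\<tau> * real n..\<tau> * real (n + 1)}|lebesgue.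
        (LINT y:cell h x|lebesgue. ext0 \<Omega> (v s) y $ i))"

definition u_trunc ::
  "real \<Rightarrow> real \<Rightarrow> real \<Rightarrow> R3 set \<Rightarrow> (real \<Rightarrow> R3 \<Rightarrow> R3) \<Rightarrow> nat \<Rightarrow> 3 \<Rightarrow> R3 \<Rightarrow> real" where
  "u_trunc \<beta> h \<tau> \<Omega> v n j x =
     (if \<bar>u_disc h \<tau> \<Omega> v n j x\<bar> \<le> h powr (- \<beta>) then u_disc h \<tau> \<Omega> v n j x
      else sgn (u_disc h \<tau> \<Omega> v n j x) * h powr (- \<beta>))"

definition num_steps :: "real \<Rightarrow> real \<Rightarrow> nat" where
  "num_steps T \<tau> = nat \<lfloor>T / \<tau>\<rfloor>"

lemma num_steps_iff:
  assumes "0 < \<tau>" "0 \<le> T"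
  shows "T \<in> {\<tau> * real N..<\<tau> * real N + \<tau>} \<longleftrightarrow> N = num_steps T \<tau>"
proof -
  have "T \<in> {\<tau> * real N..<\<tau> * real N + \<tau>} \<longleftrightarrow> real N \<le> T / \<tau> \<and> T / \<tau> < real N + 1"
    using assms by (auto simp: field_simps)
  also have "\<dots> \<longleftrightarrow> \<lfloor>T / \<tau>\<rfloor> = int N"
    by (simp add: floor_eq_iff)
  also have "\<dots> \<longleftrightarrow> N = num_steps T \<tau>"
    using assms by (auto simp: num_steps_def nat_eq_iff)
  finally show ?thesis .
qed

text \<open>A solution is a function \<open>g\<close> of which only the values \<open>g n x\<close> with \<open>n \<le> num_steps T \<tau>\<close> and
  \<open>x \<in> grid h\<close> are constrained (and relevant).\<close>

definition truncated_scheme ::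
  "real \<Rightarrow> real \<Rightarrow> R3 set \<Rightarrow> (real \<Rightarrow> R3 \<Rightarrow> R3) \<Rightarrow> (R3 \<Rightarrow> real) \<Rightarrow> real \<Rightarrow> real
     \<Rightarrow> (nat \<Rightarrow> R3 \<Rightarrow> real) \<Rightarrow> bool" where
  "truncated_scheme \<beta> T \<Omega> v f0 h \<tau> g \<longleftrightarrow>
     (\<forall>x\<in>grid h. g 0 x = g_init h \<Omega> f0 x) \<and>
     (\<forall>n<num_steps T \<tau>. \<forall>x\<in>grid h.
        (g (n + 1) x - 1 / 7 * (\<Sum>\<omega>\<in>stencil. g n (x + h *\<^sub>R \<omega>))) * (1 / \<tau>)
          + (\<Sum>j\<in>UNIV. u_trunc \<beta> h \<tau> \<Omega> v n j x * cdiff h j (g n) x) = 0)"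

lemma truncated_scheme_solvable:
  assumes "\<tau> > 0"
  shows "\<exists>g. truncated_scheme \<beta> T \<Omega> v f0 h \<tau> g"
proof -
  define g where "g = rec_nat (g_init h \<Omega> f0) (\<lambda>n gn x.
    1 / 7 * (\<Sum>\<omega>\<in>stencil. gn (x + h *\<^sub>R \<omega>))
      - \<tau> * (\<Sum>j\<in>UNIV. u_trunc \<beta> h \<tau> \<Omega> v n j x * cdiff h j gn x))"
  have "truncated_scheme \<beta> T \<Omega> v f0 h \<tau> g"
    using assms by (simp add: truncated_scheme_def g_def)
  then show ?thesis by (rule exI[where x = g])
qed

text \<open>The step function of a grid function; \<open>nearest h y\<close> is the grid point whose cell contains
  \<open>y\<close>.\<close>

definition nearest :: "real \<Rightarrow> R3 \<Rightarrow> R3" where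
  "nearest h y = (\<chi> i. h * of_int \<lfloor>y $ i / h + 1 / 2\<rfloor>)"

definition step_fun :: "real \<Rightarrow> real \<Rightarrow> (nat \<Rightarrow> R3 \<Rightarrow> real) \<Rightarrow> real \<Rightarrow> R3 \<Rightarrow> real" where
  "step_fun h \<tau> g s y = g (nat \<lfloor>s / \<tau>\<rfloor>) (nearest h y)"

lemma nearest_iff:
  assumes "0 < h"
  shows "x \<in> grid h \<and> y \<in> cell h x \<longleftrightarrow> x = nearest h y"
proof -
  have *: "(x $ i - h / 2 \<le> y $ i \<and> y $ i < x $ i + h / 2) \<longleftrightarrow> \<lfloor>y $ i / h + 1 / 2\<rfloor> = k"
    if "x $ i = h * of_int k" for i k
    unfolding floor_eq_iff that using assms by (auto simp: field_simps)
  show ?thesis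
  proof
    assume A: "x \<in> grid h \<and> y \<in> cell h x"
    show "x = nearest h y"
    proof (subst vec_eq_iff, rule allI)
      fix i
      obtain k :: int where k: "x $ i = h * of_int k"
        using A by (auto simp: grid_def)
      have "x $ i - h / 2 \<le> y $ i \<and> y $ i < x $ i + h / 2"
        using A by (auto simp: cell_def)
      then show "x $ i = nearest h y $ i"
        using *[OF k] k by (simp add: nearest_def)
    qed
  next
    assume A: "x = nearest h y"
    have k: "x $ i = h * of_int \<lfloor>y $ i / h + 1 / 2\<rfloor>" for i
      by (simp add: A nearest_def)
    show "x \<in> grid h \<and> y \<in> cell h x"
      using k *[OF k] unfolding grid_def cell_def by blast
  qed
qed

lemma step_fun_eq:
  assumes "0 < h" "0 < \<tau>" "x \<in> grid h" "y \<in> cell h x" "s \<in> {real n * \<tau>..<real (n + 1) * \<tau>}"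
  shows "step_fun h \<tau> g s y = g n x"
proof -
  have "\<lfloor>s / \<tau>\<rfloor> = int n"
    unfolding floor_eq_iff using assms by (auto simp: field_simps)
  moreover have "nearest h y = x"
    using nearest_iff[OF assms(1), of x y] assms(3,4) by simp
  ultimately show ?thesis
    by (simp add: step_fun_def)
qed

definition scaling :: "real \<Rightarrow> real \<Rightarrow> (real \<times> real) set" where
  "scaling \<alpha> \<beta> =
     {(h, \<tau>). 0 < h \<and> 0 < \<tau> \<and> \<tau> = h powr (2 - \<alpha>) \<and> h powr (1 - (\<alpha> + \<beta>)) \<le> 2 / 7}"

end

theory Submission
  imports Defs "HOL-Probability.Probability_Measure"
begin

text \<open>Under the scaling condition the scheme writes \<open>g\<^sup>n\<^sup>+\<^sup>1(x)\<close> as a convex combination of the values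
  of \<open>g\<^sup>n\<close> on the stencil of \<open>x\<close>. This gives the maximum principle and, by convexity of \<open>\<bar>\<cdot>\<bar>\<^sup>p\<close> and
  translation invariance, the bound
  \<open>\<integral>\<bar>g\<^sup>n\<^sup>+\<^sup>1\<bar>\<^sup>p \<le> \<integral>\<bar>g\<^sup>n\<bar>\<^sup>p (1 + \<tau> D\<cdot>u)\<close>, where \<open>D\<cdot>u\<close> is the discrete divergence of the truncated
  averaged velocity. As \<open>g\<close> is bounded by \<open>\<parallel>f\<^sup>0\<parallel>\<^sub>\<infinity>\<close>, it suffices that \<open>D\<cdot>u\<close> tends to \<open>0\<close> in \<open>L\<^sup>1\<close>.
  Without truncation, \<open>D\<cdot>u\<close> is the cell average of the sum of the central difference quotients
  of \<open>v\<close>; these converge in \<open>L\<^sup>2\<close> to the weak derivatives because \<open>v\<close> is a limit of test functions,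
  and the weak derivatives sum to the divergence \<open>0\<close>. The truncation is 1-Lipschitz
  and equals the identity on \<open>[-h\<^sup>-\<^sup>\<beta>, h\<^sup>-\<^sup>\<beta>]\<close>, so it changes \<open>D\<^sub>j u\<^sub>j\<close> by at most
  \<open>h\<^sup>\<beta> \<bar>D\<^sub>j u\<^sub>j\<bar> (\<bar>u\<^sub>j(x + h e\<^sup>j)\<bar> + \<bar>u\<^sub>j(x - h e\<^sup>j)\<bar>)\<close>, which is \<open>O(h\<^sup>\<beta>)\<close> in \<open>L\<^sup>1\<close>.\<close>

section \<open>Jensen's inequality and square integrals\<close>

text \<open>The constant 2/7 comes from the weights of the convex combination. Averaging gives every
  stencil point the weight 1/7, and the transport term changes it by at most \<tau> h^(-\<beta>) /
  (2h) = h^(1 - \<alpha> - \<beta>) / 2, which must not exceed 1/7. The truncation supplies the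
  uniform bound on the velocity that this requires. Sums over the grid never appear. A grid function
  is composed with \<open>nearest h\<close> and integrated over R^3; since \<open>nearest h\<close>
  commutes with shifts by grid vectors, summation by parts becomes a translation of
  \<open>lborel\<close>. Most estimates compare extended nonnegative integrals, so no summability of
  g^n has to be known beforehand. The difference quotients converge in L^2, whereas the growth
  estimate asks for L^1 in space-time. Boundedness of \<Omega> bridges the gap: for h <= 1 the
  quotients vanish outside one bounded set. The velocity is only Lebesgue measurable and is
  therefore first replaced by a Borel function \<open>V\<close> on space-time.\<close>

lemma convex_on_abs_powr:
  fixes p :: real assumes "1 \<le> p"
  shows "convex_on UNIV (\<lambda>x::real. \<bar>x\<bar> powr p)"
proof (rule convex_onI)
  fix t x y :: real assume t: "0 < t" "t < 1"
  have P: "((1-t) * a + t * b) powr p \<le> (1-t) * a powr p + t * b powr p"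
    if "a \<ge> 0" "b \<ge> 0" for a b
  proof -
    \<comment> \<open>Convexity of the power is applied only to two positive arguments. If one of
      them is 0, the claim reduces to this inequality, which is s^p <= s on [0,1].\<close>
    have scale: "(s * c) powr p \<le> s * c powr p" if "0 \<le> s" "s \<le> 1" "0 \<le> c" for s c
    proof -
      have "s powr p \<le> s"
        using that assms powr_mono'[of 1 p s] by (cases "s = 0") auto
      with that show ?thesis
        by (simp add: powr_mult mult_right_mono)
    qed
    show ?thesis
    proof (cases "a = 0 \<or> b = 0")
      case True
      then show ?thesis using scale[of t b] scale[of "1-t" a] t that by auto
    next
      case False
      then show ?thesis
        using convex_onD[OF powr_convex[OF assms] , of t a b] that t by simp
    qed
  qed
  have "\<bar>(1 - t) *\<^sub>R x + t *\<^sub>R y\<bar> powr p \<le> ((1 - t) * \<bar>x\<bar> + t * \<bar>y\<bar>) powr p"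
    using t assms abs_triangle_ineq[of "(1-t) * x" "t * y"]
    by (intro powr_mono2) (auto simp: abs_mult)
  also have "\<dots> \<le> (1-t) * \<bar>x\<bar> powr p + t * \<bar>y\<bar> powr p"
    by (rule P) auto
  finally show "\<bar>(1 - t) *\<^sub>R x + t *\<^sub>R y\<bar> powr p \<le> (1 - t) * \<bar>x\<bar> powr p + t * \<bar>y\<bar> powr p" .
qed simp

text \<open>Jensen's inequality for the probability measure \<open>uniform_measure M A\<close>. With
  both sides in ennreal, integrability of |f|^p need not be assumed: if the right side is infinite
  there is nothing to prove, and otherwise that integrability follows.\<close>

lemma Jensen_powr:
  fixes f :: "'a \<Rightarrow> real"
  assumes p: "1 \<le> p" and A[measurable]: "A \<in> sets M" and m: "emeasure M A = ennreal m" "0 < m"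
    and f[measurable]: "f \<in> borel_measurable M" and fi: "set_integrable M A f"
  shows "ennreal (\<bar>1 / m * (LINT x:A|M. f x)\<bar> powr p)
    \<le> ennreal (1 / m) * (\<integral>\<^sup>+x. indicator A x * ennreal (\<bar>f x\<bar> powr p) \<partial>M)"
proof (cases "(\<integral>\<^sup>+x. indicator A x * ennreal (\<bar>f x\<bar> powr p) \<partial>M) = \<infinity>")
  case True
  with m show ?thesis by (simp add: ennreal_mult_top)
next
  case False
  have int: "set_integrable M A (\<lambda>x. \<bar>f x\<bar> powr p)"
    unfolding set_integrable_def
  proof (rule integrableI_bounded)
    have "(\<integral>\<^sup>+ x. ennreal (norm (indicator A x *\<^sub>R \<bar>f x\<bar> powr p)) \<partial>M)
        = (\<integral>\<^sup>+x. indicator A x * ennreal (\<bar>f x\<bar> powr p) \<partial>M)"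
      by (intro nn_integral_cong) (auto split: split_indicator)
    with False show "(\<integral>\<^sup>+ x. ennreal (norm (indicator A x *\<^sub>R \<bar>f x\<bar> powr p)) \<partial>M) < \<infinity>"
      by (simp add: top.not_eq_extremum)
  qed measurable
  have eq: "(\<integral>\<^sup>+x. indicator A x * ennreal (\<bar>f x\<bar> powr p) \<partial>M) = ennreal (LINT x:A|M. \<bar>f x\<bar> powr p)"
    unfolding set_lebesgue_integral_def
    by (subst nn_integral_eq_integral[symmetric])
      (use int in \<open>auto simp: set_integrable_def split: split_indicator intro!: nn_integral_cong\<close>)
  let ?U = "uniform_measure M A"
  interpret U: prob_space ?U
    by (rule prob_space_uniform_measure) (use m in auto)
  have dens: "?U = density M (\<lambda>x. ennreal (indicator A x / m))"
    unfolding uniform_measure_def using m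
    by (intro density_cong) (auto split: split_indicator simp: divide_ennreal[symmetric])
  have U: "integral\<^sup>L ?U F = 1 / m * (LINT x:A|M. F x)"
    if [measurable]: "F \<in> borel_measurable M" for F :: "'a \<Rightarrow> real"
    unfolding dens using m
    by (subst integral_real_density) (auto simp: set_lebesgue_integral_def)
  have Ui: "integrable ?U F"
    if "set_integrable M A F" "F \<in> borel_measurable M" for F :: "'a \<Rightarrow> real"
    using that m unfolding dens
    by (subst integrable_real_density) (auto simp: set_integrable_def)
  have "\<bar>U.expectation f\<bar> powr p \<le> U.expectation (\<lambda>x. \<bar>f x\<bar> powr p)"
    by (rule U.jensens_inequality[OF _ _ _ _ convex_on_abs_powr[OF p]])
      (use int fi in \<open>auto intro!: Ui\<close>)
  then show ?thesis
    using m by (subst eq) (auto simp: U ennreal_mult'[symmetric] intro!: ennreal_leI)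
qed

lemma ennreal_tendsto_0I:
  fixes f :: "'a \<Rightarrow> ennreal"
  assumes "\<And>e. 0 < e \<Longrightarrow> \<forall>\<^sub>F x in F. f x \<le> ennreal e"
  shows "(f \<longlongrightarrow> 0) F"
proof (rule order_tendstoI)
  fix a :: ennreal assume "0 < a"
  then obtain b where b: "0 < b" "b < a" using dense by blast
  then have "b < top" using top.not_eq_extremum by fastforce
  with b have "0 < enn2real b" "ennreal (enn2real b) < a"
    by (auto simp: enn2real_positive_iff)
  then show "\<forall>\<^sub>F x in F. f x < a"
    using assms[of "enn2real b"] by (auto elim: eventually_mono)
qed simp

lemma ennreal_tendsto_0D:
  fixes f :: "'a \<Rightarrow> ennreal"
  assumes "(f \<longlongrightarrow> 0) F" "0 < e"
  shows "\<forall>\<^sub>F x in F. f x \<le> ennreal e"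
  using order_tendstoD(2)[OF assms(1), of "ennreal e"] assms(2)
  by (auto elim: eventually_mono)

text \<open>An extended nonnegative value is meaningful before finiteness is known. Without the
  square root the triangle inequality is replaced by (a + b)^2 <= 2 a^2 + 2 b^2, the source of most
  numerical constants below.\<close>

definition L2sq :: "'a measure \<Rightarrow> ('a \<Rightarrow> real) \<Rightarrow> ennreal" where
  "L2sq M f = (\<integral>\<^sup>+x. ennreal ((f x)\<^sup>2) \<partial>M)"

lemma L2sq_mono: "(AE x in M. \<bar>f x\<bar> \<le> \<bar>g x\<bar>) \<Longrightarrow> L2sq M f \<le> L2sq M g"
  unfolding L2sq_def
  by (intro nn_integral_mono_AE) (auto elim!: eventually_mono simp: abs_le_square_iff intro: ennreal_leI)

lemma L2sq_cong_AE: "(AE x in M. f x = g x) \<Longrightarrow> L2sq M f = L2sq M g"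
  unfolding L2sq_def by (intro nn_integral_cong_AE) auto

lemma L2sq_add:
  assumes [measurable]: "f \<in> borel_measurable M" "g \<in> borel_measurable M"
  shows "L2sq M (\<lambda>x. f x + g x) \<le> 2 * L2sq M f + 2 * L2sq M g"
proof -
  have "L2sq M (\<lambda>x. f x + g x) \<le> (\<integral>\<^sup>+x. 2 * ennreal ((f x)\<^sup>2) + 2 * ennreal ((g x)\<^sup>2) \<partial>M)"
    unfolding L2sq_def
  proof (rule nn_integral_mono)
    fix x
    have "(f x + g x)\<^sup>2 \<le> 2 * (f x)\<^sup>2 + 2 * (g x)\<^sup>2"
      using sum_squares_bound[of "f x" "g x"] by (simp add: power2_sum)
    then show "ennreal ((f x + g x)\<^sup>2) \<le> 2 * ennreal ((f x)\<^sup>2) + 2 * ennreal ((g x)\<^sup>2)"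
      by (drule_tac ennreal_leI) (simp add: ennreal_plus ennreal_mult)
  qed
  also have "\<dots> = 2 * L2sq M f + 2 * L2sq M g"
    by (simp add: L2sq_def nn_integral_add nn_integral_cmult)
  finally show ?thesis .
qed

lemma L2sq_minus_commute: "L2sq M (\<lambda>x. f x - g x) = L2sq M (\<lambda>x. g x - f x)"
  by (simp add: L2sq_def power2_commute)

lemma L2sq_sum:
  assumes [measurable]: "\<And>i. i \<in> I \<Longrightarrow> f i \<in> borel_measurable M"
  shows "L2sq M (\<lambda>x. \<Sum>i\<in>I. f i x) \<le> of_nat (card I) * (\<Sum>i\<in>I. L2sq M (f i))"
proof -
  have "L2sq M (\<lambda>x. \<Sum>i\<in>I. f i x) \<le> (\<integral>\<^sup>+x. of_nat (card I) * (\<Sum>i\<in>I. ennreal ((f i x)\<^sup>2)) \<partial>M)"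
    unfolding L2sq_def
  proof (rule nn_integral_mono)
    fix x
    have "ennreal ((\<Sum>i\<in>I. f i x)\<^sup>2) \<le> ennreal (real (card I) * (\<Sum>i\<in>I. (f i x)\<^sup>2))"
      using sum_squared_le_sum_of_squares[of "\<lambda>i. f i x" I] by (intro ennreal_leI) (simp add: mult.commute)
    then show "ennreal ((\<Sum>i\<in>I. f i x)\<^sup>2) \<le> of_nat (card I) * (\<Sum>i\<in>I. ennreal ((f i x)\<^sup>2))"
      by (simp add: ennreal_mult sum_nonneg sum_ennreal ennreal_of_nat_eq_real_of_nat)
  qed
  also have "\<dots> = of_nat (card I) * (\<Sum>i\<in>I. L2sq M (f i))"
    by (simp add: L2sq_def nn_integral_cmult nn_integral_sum del: sum_ennreal)
  finally show ?thesis .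
qed

lemma nn_integral_lborel_shift:
  fixes c :: "'a::euclidean_space"
  assumes [measurable]: "f \<in> borel_measurable borel"
  shows "(\<integral>\<^sup>+x. f (x + c) \<partial>lborel) = (\<integral>\<^sup>+x. f x \<partial>lborel)"
proof -
  have "(\<integral>\<^sup>+x. f x \<partial>lborel) = (\<integral>\<^sup>+x. f x \<partial>distr lborel borel ((+) c))"
    by (simp add: lborel_distr_plus)
  also have "\<dots> = (\<integral>\<^sup>+x. f (x + c) \<partial>lborel)"
    by (subst nn_integral_distr) (auto simp: add.commute)
  finally show ?thesis by simp
qed

lemma L2sq_shift:
  fixes c :: "'a::euclidean_space"
  assumes [measurable]: "f \<in> borel_measurable borel"
  shows "L2sq lborel (\<lambda>x. f (x + c)) = L2sq lborel f"
  unfolding L2sq_def by (rule nn_integral_lborel_shift) measurable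

lemma cdiff_measurable [measurable]:
  assumes [measurable]: "f \<in> borel_measurable borel"
  shows "cdiff h j f \<in> borel_measurable borel"
  unfolding cdiff_def[abs_def] by measurable

lemma cdiff_add: "cdiff h j (\<lambda>x. f x + g x) y = cdiff h j f y + cdiff h j g y"
  and cdiff_diff: "cdiff h j (\<lambda>x. f x - g x) y = cdiff h j f y - cdiff h j g y"
  by (auto simp: cdiff_def field_simps add_divide_distrib diff_divide_distrib)

text \<open>The factor blows up as h tends to 0, so this serves only at fixed h: it lets L^2
  convergence of approximants pass through \<open>cdiff\<close>. The bound uniform in h comes from
  \<open>L2sq_cdiff_le_pderiv3\<close>.\<close>

lemma L2sq_cdiff_le:
  assumes [measurable]: "f \<in> borel_measurable borel" and "0 < h"
  shows "L2sq lborel (cdiff h j f) \<le> ennreal (1 / h\<^sup>2) * L2sq lborel f"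
proof -
  let ?e = "h *\<^sub>R axis j 1 :: R3"
  have sc: "L2sq lborel (\<lambda>x. c * f (x + d)) = ennreal (c\<^sup>2) * L2sq lborel f" for c d
    unfolding L2sq_def
    by (subst nn_integral_lborel_shift[where c=d, symmetric])
      (auto simp: power_mult_distrib ennreal_mult nn_integral_cmult)
  have two: "2 * ennreal a + 2 * ennreal b = ennreal (2 * a + 2 * b)" if "0 \<le> a" "0 \<le> b" for a b
    using that by (simp add: ennreal_plus ennreal_mult)
  have "cdiff h j f = (\<lambda>x. (1/(2*h)) * f (x + ?e) + (-1/(2*h)) * f (x + - ?e))"
    using \<open>0 < h\<close> by (auto simp: cdiff_def field_simps)
  then have "L2sq lborel (cdiff h j f)
    \<le> 2 * L2sq lborel (\<lambda>x. (1/(2*h)) * f (x + ?e)) + 2 * L2sq lborel (\<lambda>x. (-1/(2*h)) * f (x + - ?e))"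
    by (simp only:) (rule L2sq_add; measurable)
  also have "\<dots> = (2 * ennreal ((1/(2*h))\<^sup>2) + 2 * ennreal ((-1/(2*h))\<^sup>2)) * L2sq lborel f"
    unfolding sc by (simp add: distrib_right mult.assoc)
  also have "2 * ennreal ((1/(2*h))\<^sup>2) + 2 * ennreal ((-1/(2*h))\<^sup>2)
      = ennreal (2 * (1/(2*h))\<^sup>2 + 2 * (-1/(2*h))\<^sup>2)"
    by (rule two) auto
  also have "2 * (1/(2*h))\<^sup>2 + 2 * (-1/(2*h))\<^sup>2 = 1 / h\<^sup>2"
    using \<open>0 < h\<close> by (simp add: power2_eq_square field_simps)
  finally show ?thesis .
qed

section \<open>Difference quotients and weak derivatives\<close>

lemma has_field_derivative_line:
  assumes "\<forall>x. \<phi> differentiable (at x)"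
  shows "((\<lambda>s. \<phi> (y + s *\<^sub>R axis j 1)) has_field_derivative pderiv3 j \<phi> (y + s *\<^sub>R axis j 1)) (at s within A)"
proof -
  let ?e = "axis j 1 :: R3"
  have "(\<phi> has_derivative frechet_derivative \<phi> (at (y + s *\<^sub>R ?e))) (at (y + s *\<^sub>R ?e))"
    using assms frechet_derivative_works by blast
  moreover have "((\<lambda>s. y + s *\<^sub>R ?e) has_derivative (\<lambda>d. d *\<^sub>R ?e)) (at s within A)"
    by (auto intro!: derivative_eq_intros)
  ultimately have *: "((\<lambda>s. \<phi> (y + s *\<^sub>R ?e)) has_derivative
      (\<lambda>d. frechet_derivative \<phi> (at (y + s *\<^sub>R ?e)) (d *\<^sub>R ?e))) (at s within A)"
    using has_derivative_compose by blast
  have "linear (frechet_derivative \<phi> (at (y + s *\<^sub>R ?e)))"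
    using assms linear_frechet_derivative by blast
  then have "(\<lambda>d. frechet_derivative \<phi> (at (y + s *\<^sub>R ?e)) (d *\<^sub>R ?e))
      = (*) (pderiv3 j \<phi> (y + s *\<^sub>R ?e))"
    by (auto simp: pderiv3_def linear_cmul mult.commute)
  with * show ?thesis
    by (simp add: has_field_derivative_def)
qed

lemma pderiv3_diff:
  assumes "\<forall>x. \<phi> differentiable (at x)" "\<forall>x. \<psi> differentiable (at x)"
  shows "pderiv3 j (\<lambda>x. \<phi> x - \<psi> x) = (\<lambda>x. pderiv3 j \<phi> x - pderiv3 j \<psi> x)"
  unfolding pderiv3_def using assms
  by (intro ext, subst frechet_derivative_at[symmetric])
    (auto intro!: has_derivative_diff simp: frechet_derivative_works[symmetric])

lemma borel_measurable_pderiv3: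
  "continuous_on UNIV (pderiv3 j \<phi>) \<Longrightarrow> pderiv3 j \<phi> \<in> borel_measurable borel"
  by (rule borel_measurable_continuous_onI)

lemma differentiable_imp_borel:
  fixes \<phi> :: "R3 \<Rightarrow> real"
  assumes "\<forall>x. \<phi> differentiable (at x)"
  shows "\<phi> \<in> borel_measurable borel"
  using assms differentiable_imp_continuous_within
  by (intro borel_measurable_continuous_onI) (auto simp: continuous_on_eq_continuous_within)

text \<open>The fundamental theorem of calculus along the line through y in direction j. An average
  is the form to which \<open>Jensen_powr\<close> applies.\<close>

lemma cdiff_eq_average:
  assumes d: "\<forall>x. \<phi> differentiable (at x)" and c: "continuous_on UNIV (pderiv3 j \<phi>)" and h: "0 < h"
  shows "cdiff h j \<phi> y = 1 / (2 * h) * (LINT s:{-h..h}|lborel. pderiv3 j \<phi> (y + s *\<^sub>R axis j 1))"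
    and "set_integrable lborel {-h..h} (\<lambda>s. pderiv3 j \<phi> (y + s *\<^sub>R axis j 1))"
proof -
  let ?e = "axis j 1 :: R3"
  have cont: "continuous_on {-h..h} (\<lambda>s. pderiv3 j \<phi> (y + s *\<^sub>R ?e))"
    by (intro continuous_on_compose2[OF c]) (auto intro!: continuous_intros)
  have "(LINT s:{-h..h}|lborel. pderiv3 j \<phi> (y + s *\<^sub>R ?e)) = \<phi> (y + h *\<^sub>R ?e) - \<phi> (y + (-h) *\<^sub>R ?e)"
    unfolding set_lebesgue_integral_def
  proof (rule integral_FTC_atLeastAtMost[where F="\<lambda>s. \<phi> (y + s *\<^sub>R ?e)"])
    show "((\<lambda>s. \<phi> (y + s *\<^sub>R ?e)) has_vector_derivative pderiv3 j \<phi> (y + s *\<^sub>R ?e)) (at s within {- h..h})" for s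
      using has_field_derivative_line[OF d] by (simp add: has_real_derivative_iff_has_vector_derivative[symmetric])
  qed (use h cont in auto)
  then show "cdiff h j \<phi> y = 1 / (2 * h) * (LINT s:{-h..h}|lborel. pderiv3 j \<phi> (y + s *\<^sub>R ?e))"
    using h by (simp add: cdiff_def)
  show "set_integrable lborel {-h..h} (\<lambda>s. pderiv3 j \<phi> (y + s *\<^sub>R ?e))"
    using borel_integrable_atLeastAtMost'[OF cont] .
qed

lemma abs_powr_2: "\<bar>a::real\<bar> powr 2 = a\<^sup>2"
  by simp

text \<open>Jensen bounds the square of the average by the average of the squares. After exchanging
  the integrals, the integral over y does not depend on s by translation invariance, so averaging
  over [-h, h] drops out and the constant is 1 for every h.\<close>

lemma L2sq_cdiff_le_pderiv3:
  assumes d: "\<forall>x. \<phi> differentiable (at x)" and c: "continuous_on UNIV (pderiv3 j \<phi>)" and h: "0 < h"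
  shows "L2sq lborel (cdiff h j \<phi>) \<le> L2sq lborel (pderiv3 j \<phi>)"
proof -
  let ?e = "axis j 1 :: R3" and ?D = "pderiv3 j \<phi>"
  note [measurable] = borel_measurable_pderiv3[OF c]
  have "L2sq lborel (cdiff h j \<phi>)
      \<le> (\<integral>\<^sup>+y. ennreal (1 / (2 * h)) * (\<integral>\<^sup>+s. indicator {-h..h} s * ennreal ((?D (y + s *\<^sub>R ?e))\<^sup>2) \<partial>lborel) \<partial>lborel)"
    unfolding L2sq_def
  proof (rule nn_integral_mono)
    fix y
    have "ennreal (\<bar>1 / (2 * h) * (LINT s:{-h..h}|lborel. ?D (y + s *\<^sub>R ?e))\<bar> powr 2)
      \<le> ennreal (1 / (2 * h)) * (\<integral>\<^sup>+s. indicator {-h..h} s * ennreal (\<bar>?D (y + s *\<^sub>R ?e)\<bar> powr 2) \<partial>lborel)"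
      using h by (intro Jensen_powr cdiff_eq_average(2)[OF d c h]) auto
    then show "ennreal ((cdiff h j \<phi> y)\<^sup>2)
      \<le> ennreal (1 / (2 * h)) * (\<integral>\<^sup>+s. indicator {-h..h} s * ennreal ((?D (y + s *\<^sub>R ?e))\<^sup>2) \<partial>lborel)"
      by (simp only: abs_powr_2 cdiff_eq_average(1)[OF d c h])
  qed
  also have "\<dots> = ennreal (1 / (2 * h)) *
      (\<integral>\<^sup>+y. (\<integral>\<^sup>+s. indicator {-h..h} s * ennreal ((?D (y + s *\<^sub>R ?e))\<^sup>2) \<partial>lborel) \<partial>lborel)"
    by (rule nn_integral_cmult) measurable
  also have "(\<integral>\<^sup>+y. (\<integral>\<^sup>+s. indicator {-h..h} s * ennreal ((?D (y + s *\<^sub>R ?e))\<^sup>2) \<partial>lborel) \<partial>lborel)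
      = (\<integral>\<^sup>+s. (\<integral>\<^sup>+y. indicator {-h..h} s * ennreal ((?D (y + s *\<^sub>R ?e))\<^sup>2) \<partial>lborel) \<partial>lborel)"
    by (rule lborel_pair.Fubini') measurable
  also have "\<dots> = (\<integral>\<^sup>+s. indicator {-h..h} s * L2sq lborel ?D \<partial>lborel)"
  proof (rule nn_integral_cong)
    fix s :: real
    have "(\<integral>\<^sup>+y. indicator {-h..h} s * ennreal ((?D (y + s *\<^sub>R ?e))\<^sup>2) \<partial>lborel)
        = indicator {-h..h} s * L2sq lborel (\<lambda>y. ?D (y + s *\<^sub>R ?e))"
      unfolding L2sq_def by (rule nn_integral_cmult) measurable
    then show "(\<integral>\<^sup>+y. indicator {-h..h} s * ennreal ((?D (y + s *\<^sub>R ?e))\<^sup>2) \<partial>lborel)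
        = indicator {-h..h} s * L2sq lborel ?D"
      by (simp add: L2sq_shift)
  qed
  also have "\<dots> = ennreal (2 * h) * L2sq lborel ?D"
    using h by (simp add: nn_integral_multc)
  also have "ennreal (1 / (2 * h)) * (ennreal (2 * h) * L2sq lborel ?D) = L2sq lborel ?D"
    using h by (simp add: mult.assoc[symmetric] ennreal_mult''[symmetric])
  finally show ?thesis .
qed

definition C1c :: "3 \<Rightarrow> (R3 \<Rightarrow> real) \<Rightarrow> bool" where
  "C1c j \<phi> \<longleftrightarrow> (\<forall>x. \<phi> differentiable (at x)) \<and> continuous_on UNIV (pderiv3 j \<phi>) \<and>
     (\<exists>r>0. \<forall>x. r < norm x \<longrightarrow> \<phi> x = 0)"

lemma pderiv3_eq_0:
  assumes z: "\<forall>x\<in>A. \<phi> x = 0" and A: "open A" "x \<in> A"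
  shows "pderiv3 j \<phi> x = 0"
proof -
  have "(\<phi> has_derivative (\<lambda>_. 0)) (at x)"
    by (rule has_derivative_transform_within_open[OF has_derivative_const[of 0]]) (use z A in auto)
  then have "frechet_derivative \<phi> (at x) = (\<lambda>_. 0)"
    using frechet_derivative_at by metis
  then show ?thesis by (simp add: pderiv3_def)
qed

text \<open>By the mean value theorem the difference quotient is a value of the derivative at a
  point closer than h, so uniform continuity on a compact ball makes the error uniformly small.
  Bounded support turns this into an L^2 bound.\<close>

lemma cdiff_tendsto_pderiv3:
  assumes "C1c j \<phi>"
  shows "((\<lambda>h. L2sq lborel (\<lambda>y. cdiff h j \<phi> y - pderiv3 j \<phi> y)) \<longlongrightarrow> 0) (at_right 0)"
proof (rule ennreal_tendsto_0I)
  fix e :: real assume e: "0 < e"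
  let ?e = "axis j 1 :: R3" and ?D = "pderiv3 j \<phi>"
  obtain r where d: "\<forall>x. \<phi> differentiable (at x)" and c: "continuous_on UNIV ?D"
    and r: "0 < r" "\<And>x. r < norm x \<Longrightarrow> \<phi> x = 0"
    using assms by (auto simp: C1c_def)
  have D0: "?D x = 0" if "r < norm x" for x
  proof (rule pderiv3_eq_0[of "- cball 0 r"])
    show "open (- cball (0::R3) r)" by (rule open_Compl) simp
  qed (use r that in auto)
  \<comment> \<open>For h < 1 both the quotient and the derivative vanish outside this ball. From
    inside it, the mean value point reaches at most radius r + 2, which is where uniform continuity
    is taken.\<close>
  let ?B = "cball (0::R3) (r + 1)"
  define m where "m = measure lborel ?B"
  have m: "emeasure lborel ?B = ennreal m" "0 \<le> m"
    unfolding m_def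
    by (metis emeasure_eq_ennreal_measure emeasure_lborel_cball_finite infinity_ennreal_def less_irrefl)
      simp
  \<comment> \<open>Chosen so that the squared error times the volume is at most e; the + 1 spares a
    proof that the volume is positive.\<close>
  define \<epsilon> where "\<epsilon> = sqrt (e / (m + 1))"
  have \<epsilon>: "0 < \<epsilon>" "\<epsilon>\<^sup>2 * m \<le> e"
    using e m by (auto simp: \<epsilon>_def field_simps)
  have "uniformly_continuous_on (cball (0::R3) (r + 2)) ?D"
    by (rule compact_uniformly_continuous) (use c continuous_on_subset in auto)
  then obtain \<delta> where \<delta>: "0 < \<delta>"
      "\<And>x x'. x \<in> cball 0 (r+2) \<Longrightarrow> x' \<in> cball 0 (r+2) \<Longrightarrow> dist x' x < \<delta> \<Longrightarrow> dist (?D x') (?D x) < \<epsilon>"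
    using \<epsilon>(1) unfolding uniformly_continuous_on_def by metis
  have key: "\<bar>cdiff h j \<phi> y - ?D y\<bar> \<le> \<epsilon> * indicator ?B y" if h: "0 < h" "h < min 1 \<delta>" for h y
  proof (cases "y \<in> ?B")
    case False
    have "r < norm (y + h *\<^sub>R ?e)" "r < norm (y - h *\<^sub>R ?e)" "r < norm y"
      using False norm_triangle_ineq2[of y "h *\<^sub>R ?e"] norm_triangle_ineq4[of "y + h *\<^sub>R ?e" "h *\<^sub>R ?e"] norm_diff_ineq[of y "h *\<^sub>R ?e"] h
      by auto
    then show ?thesis using r D0 False by (simp add: cdiff_def)
  next
    case True
    have "\<exists>s. -h < s \<and> s < h \<and> \<phi> (y + h *\<^sub>R ?e) - \<phi> (y + (-h) *\<^sub>R ?e) = (h - (-h)) * ?D (y + s *\<^sub>R ?e)"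
      by (rule MVT2) (use h has_field_derivative_line[OF d] in auto)
    then obtain s where s: "-h < s" "s < h" "cdiff h j \<phi> y = ?D (y + s *\<^sub>R ?e)"
      using h by (auto simp: cdiff_def)
    have "y + s *\<^sub>R ?e \<in> cball 0 (r + 2)" "y \<in> cball 0 (r + 2)" "dist (y + s *\<^sub>R ?e) y < \<delta>"
      using True s h norm_triangle_ineq[of y "s *\<^sub>R ?e"] by (auto simp: dist_norm[of "y + s *\<^sub>R ?e" y])
    then have "dist (?D (y + s *\<^sub>R ?e)) (?D y) < \<epsilon>"
      by (intro \<delta>(2))
    then show ?thesis using True s by (simp add: dist_real_def)
  qed
  have "L2sq lborel (\<lambda>y. cdiff h j \<phi> y - ?D y) \<le> ennreal e" if h: "0 < h" "h < min 1 \<delta>" for h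
  proof -
    have "L2sq lborel (\<lambda>y. cdiff h j \<phi> y - ?D y) \<le> L2sq lborel (\<lambda>y. \<epsilon> * indicator ?B y)"
      using key[OF h] \<epsilon> by (intro L2sq_mono) (auto simp: abs_mult)
    also have "\<dots> = (\<integral>\<^sup>+y. ennreal (\<epsilon>\<^sup>2) * indicator ?B y \<partial>lborel)"
      unfolding L2sq_def by (intro nn_integral_cong) (auto split: split_indicator)
    also have "\<dots> = ennreal (\<epsilon>\<^sup>2 * m)"
      using m by (subst nn_integral_cmult_indicator) (auto simp: ennreal_mult)
    also have "\<dots> \<le> ennreal e" using \<epsilon>(2) by (rule ennreal_leI)
    finally show ?thesis .
  qed
  then show "\<forall>\<^sub>F h in at_right 0. L2sq lborel (\<lambda>y. cdiff h j \<phi> y - ?D y) \<le> ennreal e"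
    unfolding eventually_at_right_field using \<delta>(1) by (intro exI[of _ "min 1 \<delta>"]) auto
qed

text \<open>A bound uniform in h for a mere L^2 limit w. Write w as (w - \<phi>_k) + \<phi>_k: the
  first part costs 1/h^2 but tends to 0 as k grows with h fixed, and the second is controlled by its
  derivative. The 4 stems from splitting twice; what matters is that it does not depend on
  h.\<close>

lemma L2sq_cdiff_closure:
  assumes [measurable]: "w \<in> borel_measurable borel" "\<gamma> \<in> borel_measurable borel"
    and d: "\<And>k x. \<phi> k differentiable (at x)" and c: "\<And>k. continuous_on UNIV (pderiv3 j (\<phi> k))"
    and lw: "(\<lambda>k. L2sq lborel (\<lambda>x. \<phi> k x - w x)) \<longlonglongrightarrow> 0"
    and l\<gamma>: "(\<lambda>k. L2sq lborel (\<lambda>x. pderiv3 j (\<phi> k) x - \<gamma> x)) \<longlonglongrightarrow> 0"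
    and h: "0 < h"
  shows "L2sq lborel (cdiff h j w) \<le> 4 * L2sq lborel \<gamma>"
proof -
  note [measurable] = borel_measurable_pderiv3[OF c] differentiable_imp_borel[OF allI, OF d]
  let ?a = "\<lambda>k. L2sq lborel (\<lambda>x. \<phi> k x - w x)" and ?b = "\<lambda>k. L2sq lborel (\<lambda>x. pderiv3 j (\<phi> k) x - \<gamma> x)"
  have le: "L2sq lborel (cdiff h j w)
      \<le> 2 * (ennreal (1 / h\<^sup>2) * ?a k) + 2 * (2 * ?b k + 2 * L2sq lborel \<gamma>)" for k
  proof -
    have "cdiff h j w = (\<lambda>y. cdiff h j (\<lambda>x. w x - \<phi> k x) y + cdiff h j (\<phi> k) y)"
      by (auto simp: cdiff_diff)
    then have "L2sq lborel (cdiff h j w)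
        \<le> 2 * L2sq lborel (cdiff h j (\<lambda>x. w x - \<phi> k x)) + 2 * L2sq lborel (cdiff h j (\<phi> k))"
      by (simp only:) (rule L2sq_add; measurable)
    also have "L2sq lborel (cdiff h j (\<lambda>x. w x - \<phi> k x)) \<le> ennreal (1 / h\<^sup>2) * ?a k"
      by (subst L2sq_minus_commute) (use h in \<open>auto intro: L2sq_cdiff_le\<close>)
    also have "L2sq lborel (cdiff h j (\<phi> k)) \<le> L2sq lborel (pderiv3 j (\<phi> k))"
      by (rule L2sq_cdiff_le_pderiv3) (use d c h in auto)
    also have "L2sq lborel (pderiv3 j (\<phi> k)) = L2sq lborel (\<lambda>x. (pderiv3 j (\<phi> k) x - \<gamma> x) + \<gamma> x)"
      by simp
    also have "\<dots> \<le> 2 * ?b k + 2 * L2sq lborel \<gamma>"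
      by (rule L2sq_add; measurable)
    finally show ?thesis
      by (simp add: add_mono mult_left_mono)
  qed
  have "(\<lambda>k. 2 * (ennreal (1 / h\<^sup>2) * ?a k) + 2 * (2 * ?b k + 2 * L2sq lborel \<gamma>))
      \<longlonglongrightarrow> 2 * (ennreal (1 / h\<^sup>2) * 0) + 2 * (2 * 0 + 2 * L2sq lborel \<gamma>)"
    by (intro tendsto_add ennreal_tendsto_cmult lw l\<gamma> tendsto_const) auto
  then have "L2sq lborel (cdiff h j w) \<le> 2 * (ennreal (1 / h\<^sup>2) * 0) + 2 * (2 * 0 + 2 * L2sq lborel \<gamma>)"
    by (rule tendsto_lowerbound) (use le in auto)
  then show ?thesis by (simp add: mult.assoc[symmetric])
qed

text \<open>A split into three terms around a fixed approximant: the quotient of w - \<phi>_k, the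
  error of the quotient of \<phi>_k, and the derivative of \<phi>_k minus \<gamma>. The first is
  small uniformly in h, so k can be fixed before h tends to 0.\<close>

lemma cdiff_tendsto_weak_derivative:
  assumes [measurable]: "w \<in> borel_measurable borel" "\<gamma> \<in> borel_measurable borel"
    and C: "\<And>k. C1c j (\<phi> k)"
    and lw: "(\<lambda>k. L2sq lborel (\<lambda>x. \<phi> k x - w x)) \<longlonglongrightarrow> 0"
    and l\<gamma>: "(\<lambda>k. L2sq lborel (\<lambda>x. pderiv3 j (\<phi> k) x - \<gamma> x)) \<longlonglongrightarrow> 0"
  shows "((\<lambda>h. L2sq lborel (\<lambda>y. cdiff h j w y - \<gamma> y)) \<longlongrightarrow> 0) (at_right 0)"
proof (rule ennreal_tendsto_0I)
  fix e :: real assume e: "0 < e"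
  have d: "\<And>k x. \<phi> k differentiable (at x)" and c: "\<And>k. continuous_on UNIV (pderiv3 j (\<phi> k))"
    using C by (auto simp: C1c_def)
  note [measurable] = borel_measurable_pderiv3[OF c] differentiable_imp_borel[OF allI, OF d]
  let ?b = "\<lambda>k. L2sq lborel (\<lambda>x. pderiv3 j (\<phi> k) x - \<gamma> x)"
  \<comment> \<open>The split below costs 18 times this quantity and 4 times the error of \<phi>_k;
    with the bounds e/36 and e/8 each contributes e/2.\<close>
  obtain k where k: "?b k \<le> ennreal (e / 36)"
    using ennreal_tendsto_0D[OF l\<gamma>, of "e / 36"] e by (auto simp: eventually_sequentially)
  let ?f = "\<lambda>x. w x - \<phi> k x" and ?g = "\<lambda>x. \<gamma> x - pderiv3 j (\<phi> k) x"
  have main: "L2sq lborel (\<lambda>y. cdiff h j w y - \<gamma> y)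
      \<le> 18 * ?b k + 4 * L2sq lborel (\<lambda>y. cdiff h j (\<phi> k) y - pderiv3 j (\<phi> k) y)" if h: "0 < h" for h
  proof -
    let ?A = "L2sq lborel (cdiff h j ?f)"
      and ?B = "L2sq lborel (\<lambda>y. cdiff h j (\<phi> k) y - pderiv3 j (\<phi> k) y)"
    \<comment> \<open>The closure bound is used for w - \<phi>_k, which is the L^2 limit of \<phi>_l
      - \<phi>_k as l grows while k stays fixed.\<close>
    have "L2sq lborel (cdiff h j ?f) \<le> 4 * L2sq lborel ?g"
    proof (rule L2sq_cdiff_closure[where \<phi> = "\<lambda>l x. \<phi> l x - \<phi> k x"])
      show "(\<lambda>x. \<phi> l x - \<phi> k x) differentiable (at x)" for l x
        using d by (intro differentiable_diff)
      have p: "pderiv3 j (\<lambda>x. \<phi> l x - \<phi> k x) = (\<lambda>x. pderiv3 j (\<phi> l) x - pderiv3 j (\<phi> k) x)" for l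
        using d by (intro pderiv3_diff) auto
      show "continuous_on UNIV (pderiv3 j (\<lambda>x. \<phi> l x - \<phi> k x))" for l
        unfolding p using c by (intro continuous_on_diff)
      show "(\<lambda>l. L2sq lborel (\<lambda>x. \<phi> l x - \<phi> k x - (w x - \<phi> k x))) \<longlonglongrightarrow> 0"
        using lw by simp
      show "(\<lambda>l. L2sq lborel (\<lambda>x. pderiv3 j (\<lambda>x. \<phi> l x - \<phi> k x) x - (\<gamma> x - pderiv3 j (\<phi> k) x))) \<longlonglongrightarrow> 0"
        unfolding p using l\<gamma> by simp
    qed (use h in measurable)
    then have A: "?A \<le> 4 * ?b k"
      by (simp add: L2sq_minus_commute[of _ \<gamma>])
    have "L2sq lborel (\<lambda>y. cdiff h j w y - \<gamma> y) = L2sq lborel (\<lambda>y. (cdiff h j ?f y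
        + (cdiff h j (\<phi> k) y - pderiv3 j (\<phi> k) y)) + (pderiv3 j (\<phi> k) y - \<gamma> y))"
      by (simp add: cdiff_diff)
    also have "\<dots> \<le> 2 * L2sq lborel (\<lambda>y. cdiff h j ?f y + (cdiff h j (\<phi> k) y - pderiv3 j (\<phi> k) y)) + 2 * ?b k"
      by (rule L2sq_add; measurable)
    also have "L2sq lborel (\<lambda>y. cdiff h j ?f y + (cdiff h j (\<phi> k) y - pderiv3 j (\<phi> k) y)) \<le> 2 * ?A + 2 * ?B"
      by (rule L2sq_add; measurable)
    also note A
    finally have "L2sq lborel (\<lambda>y. cdiff h j w y - \<gamma> y) \<le> 2 * (2 * (4 * ?b k) + 2 * ?B) + 2 * ?b k"
      by (simp add: add_mono mult_left_mono)
    also have "\<dots> = 18 * ?b k + 4 * ?B"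
      by (simp add: distrib_left mult.assoc[symmetric] add.commute add.left_commute distrib_right[symmetric])
    finally show ?thesis .
  qed
  have "\<forall>\<^sub>F h in at_right 0. L2sq lborel (\<lambda>y. cdiff h j (\<phi> k) y - pderiv3 j (\<phi> k) y) \<le> ennreal (e / 8)"
    using e by (intro ennreal_tendsto_0D[OF cdiff_tendsto_pderiv3[OF C]]) auto
  moreover have "\<forall>\<^sub>F h in at_right (0::real). 0 < h"
    by (rule eventually_at_right_less)
  ultimately show "\<forall>\<^sub>F h in at_right 0. L2sq lborel (\<lambda>y. cdiff h j w y - \<gamma> y) \<le> ennreal e"
  proof eventually_elim
    case (elim h)
    have "L2sq lborel (\<lambda>y. cdiff h j w y - \<gamma> y) \<le> 18 * ennreal (e / 36) + 4 * ennreal (e / 8)"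
      using main[OF elim(2)] elim(1) k by (meson add_mono mult_left_mono order_trans zero_le)
    also have "\<dots> = ennreal (18 * (e / 36)) + ennreal (4 * (e / 8))"
      using e by (subst (1 2) ennreal_mult) auto
    also have "\<dots> = ennreal e"
      using e by (subst ennreal_plus[symmetric]) auto
    finally show ?case .
  qed
qed

section \<open>Divergence-free velocity fields\<close>

lemma integrable_mult_L2:
  fixes f g :: "'a \<Rightarrow> real"
  assumes [measurable]: "f \<in> borel_measurable M" "g \<in> borel_measurable M"
    and fin: "L2sq M f < \<infinity>" "L2sq M g < \<infinity>"
  shows "integrable M (\<lambda>x. f x * g x)"
proof (rule integrableI_bounded)
  have "(\<integral>\<^sup>+x. ennreal (norm (f x * g x)) \<partial>M) \<le> (\<integral>\<^sup>+x. ennreal ((f x)\<^sup>2) + ennreal ((g x)\<^sup>2) \<partial>M)"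
  proof (rule nn_integral_mono)
    fix x
    have "norm (f x * g x) \<le> (f x)\<^sup>2 + (g x)\<^sup>2"
      using sum_squares_bound[of "\<bar>f x\<bar>" "\<bar>g x\<bar>"] mult_nonneg_nonneg[of "\<bar>f x\<bar>" "\<bar>g x\<bar>", OF abs_ge_zero abs_ge_zero]
      unfolding real_norm_def abs_mult power2_abs by linarith
    then show "ennreal (norm (f x * g x)) \<le> ennreal ((f x)\<^sup>2) + ennreal ((g x)\<^sup>2)"
      by (drule_tac ennreal_leI) (simp add: ennreal_plus)
  qed
  also have "\<dots> = L2sq M f + L2sq M g"
    by (simp add: L2sq_def nn_integral_add)
  also have "\<dots> < \<infinity>" using fin by simp
  finally show "(\<integral>\<^sup>+x. ennreal (norm (f x * g x)) \<partial>M) < \<infinity>" .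
qed measurable

lemma L2sq_eq_integral:
  assumes [measurable]: "f \<in> borel_measurable M" and fin: "L2sq M f < \<infinity>"
  shows "L2sq M f = ennreal (\<integral>x. (f x)\<^sup>2 \<partial>M)"
  unfolding L2sq_def
  by (rule nn_integral_eq_integral)
    (use integrable_mult_L2[OF assms(1,1) fin fin] in \<open>auto simp: power2_eq_square\<close>)

text \<open>Pythagoras. An f that is orthogonal to functions approximating it must vanish, which is
  how the lemma is used.\<close>

lemma L2sq_le_orthogonal:
  assumes [measurable]: "f \<in> borel_measurable M" "g \<in> borel_measurable M"
    and fin: "L2sq M f < \<infinity>" "L2sq M g < \<infinity>" and orth: "(\<integral>x. f x * g x \<partial>M) = 0"
  shows "L2sq M f \<le> L2sq M (\<lambda>x. f x - g x)"
proof -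
  note ff = integrable_mult_L2[OF assms(1,1) fin(1,1)] and gg = integrable_mult_L2[OF assms(2,2) fin(2,2)]
    and fg = integrable_mult_L2[OF assms(1,2) fin]
  have gf: "L2sq M (\<lambda>x. f x - g x) < \<infinity>"
  proof -
    have m: "(\<lambda>x. - g x) \<in> borel_measurable M" by measurable
    have "2 * L2sq M f + 2 * L2sq M (\<lambda>x. - g x) < \<infinity>"
      using fin by (simp add: L2sq_def ennreal_mult_less_top)
    from le_less_trans[OF L2sq_add[OF assms(1) m] this] show ?thesis by simp
  qed
  have "(\<integral>x. (f x)\<^sup>2 \<partial>M) \<le> (\<integral>x. (f x)\<^sup>2 \<partial>M) + (\<integral>x. (g x)\<^sup>2 \<partial>M)"
    by simp
  also have "\<dots> = (\<integral>x. (f x * f x + g x * g x) - 2 * (f x * g x) \<partial>M)"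
    using ff gg fg orth by (simp add: power2_eq_square)
  also have "\<dots> = (\<integral>x. (f x - g x)\<^sup>2 \<partial>M)"
    by (intro Bochner_Integration.integral_cong) (auto simp: power2_eq_square algebra_simps)
  finally show ?thesis
    by (subst (1 2) L2sq_eq_integral) (use fin gf in \<open>auto intro: ennreal_leI\<close>)
qed

lemma test_function_C1c:
  assumes "test_function \<Omega> \<phi>" shows "C1c j \<phi>"
proof -
  have C: "C_k (Suc (Suc 0)) \<phi>" "compact (closure {x. \<phi> x \<noteq> 0})"
    using assms unfolding test_function_def by blast+
  obtain r where r: "\<And>x. \<phi> x \<noteq> 0 \<Longrightarrow> norm x \<le> r"
    using compact_imp_bounded[OF C(2)] closure_subset[of "{x. \<phi> x \<noteq> 0}"] unfolding bounded_iff by blast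
  show ?thesis
    unfolding C1c_def
  proof (intro conjI exI[of _ "max r 1"] allI impI)
    have "C_k 1 \<phi>" using assms unfolding test_function_def by blast
    then show "continuous_on UNIV (pderiv3 j \<phi>)" by simp
    show "\<phi> differentiable (at x)" for x using C(1) by simp
  qed (use r in force)+
qed

text \<open>Makes the partial derivatives of smooth approximants available as test functions,
  against which the weak divergence can be tested.\<close>

lemma test_function_pderiv3:
  assumes "test_function \<Omega> \<phi>"
  shows "test_function \<Omega> (pderiv3 j \<phi>)"
proof -
  have sub: "closure {x. pderiv3 j \<phi> x \<noteq> 0} \<subseteq> closure {x. \<phi> x \<noteq> 0}"
  proof (intro closure_minimal closed_closure subsetI CollectI)
    fix x assume "x \<in> {x. pderiv3 j \<phi> x \<noteq> 0}"
    then have x: "pderiv3 j \<phi> x \<noteq> 0" by simp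
    show "x \<in> closure {x. \<phi> x \<noteq> 0}"
    proof (rule ccontr)
      assume n: "x \<notin> closure {x. \<phi> x \<noteq> 0}"
      have "pderiv3 j \<phi> x = 0"
        by (rule pderiv3_eq_0[of "- closure {x. \<phi> x \<noteq> 0}"])
          (use n closure_subset[of "{x. \<phi> x \<noteq> 0}"] in auto)
      with x show False by simp
    qed
  qed
  moreover have "C_k k (pderiv3 j \<phi>)" for k
  proof -
    have "C_k (Suc k) \<phi>" using assms unfolding test_function_def by blast
    then show ?thesis by simp
  qed
  moreover have "compact (closure {x. pderiv3 j \<phi> x \<noteq> 0})"
  proof -
    have "compact (closure {x. \<phi> x \<noteq> 0} \<inter> closure {x. pderiv3 j \<phi> x \<noteq> 0})"
      using assms by (intro compact_Int_closed) (auto simp: test_function_def)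
    then show ?thesis using sub by (simp add: inf.absorb2)
  qed
  ultimately show ?thesis
    using assms unfolding test_function_def by blast
qed

lemma test_function_measurable:
  "test_function \<Omega> \<phi> \<Longrightarrow> \<phi> \<in> borel_measurable borel"
  using test_function_C1c[of \<Omega> \<phi> undefined] by (intro differentiable_imp_borel) (auto simp: C1c_def)

lemma test_function_eq_0: "test_function \<Omega> \<phi> \<Longrightarrow> x \<notin> \<Omega> \<Longrightarrow> \<phi> x = 0"
  using closure_subset[of "{x. \<phi> x \<noteq> 0}"] unfolding test_function_def by blast

lemma test_function_L2:
  assumes "test_function \<Omega> \<phi>"
  shows "L2sq lborel \<phi> < \<infinity>"
proof -
  obtain r where r: "\<And>x. r < norm x \<Longrightarrow> \<phi> x = 0"
    using test_function_C1c[OF assms] unfolding C1c_def by blast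
  have "C_k 0 \<phi>" using assms unfolding test_function_def by blast
  then have "continuous_on (cball 0 r) \<phi>" by (auto intro: continuous_on_subset)
  then have "bounded (\<phi> ` cball 0 r)"
    by (intro compact_imp_bounded compact_continuous_image) auto
  then obtain B where B: "\<forall>x\<in>cball 0 r. \<bar>\<phi> x\<bar> \<le> B"
    unfolding bounded_iff by auto
  have "L2sq lborel \<phi> \<le> (\<integral>\<^sup>+x. ennreal (B\<^sup>2) * indicator (cball (0::R3) r) x \<partial>lborel)"
    unfolding L2sq_def
  proof (rule nn_integral_mono)
    fix x
    show "ennreal ((\<phi> x)\<^sup>2) \<le> ennreal (B\<^sup>2) * indicator (cball 0 r) x"
      using r[of x] B by (cases "x \<in> cball 0 r") (auto intro!: ennreal_leI power2_le_iff_abs_le[THEN iffD2] intro: order_trans[OF abs_ge_zero])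
  qed
  also have "\<dots> = ennreal (B\<^sup>2) * emeasure lborel (cball (0::R3) r)"
    by (subst nn_integral_cmult_indicator) auto
  also have "\<dots> < \<infinity>"
    using emeasure_lborel_cball_finite[of "0::R3" r] by (simp add: ennreal_mult_less_top)
  finally show ?thesis .
qed

text \<open>The data are only Lebesgue measurable. A Borel version can be composed with shifts and,
  on a product, has measurable sections at every point, so the estimates are made for it.\<close>

lemma lebesgue_borel_version:
  fixes f :: "'a::euclidean_space \<Rightarrow> real"
  assumes f: "f \<in> borel_measurable (lebesgue_on S)" and S: "S \<in> sets lebesgue"
  obtains f' where "f' \<in> borel_measurable borel" "AE x in lborel. ext0 S f x = f' x"
proof -
  have "(\<lambda>x. if x \<in> S then f x else 0) \<in> borel_measurable lebesgue"
    using f S by (simp add: borel_measurable_if)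
  then have "ext0 S f \<in> borel_measurable lebesgue"
    by (simp add: ext0_def[abs_def])
  from completion_ex_borel_measurable_real[OF this] that show thesis by auto
qed

lemma set_lebesgue_integral_borel_version:
  fixes F :: "'a::euclidean_space \<Rightarrow> real"
  assumes [measurable]: "F \<in> borel_measurable borel" and e: "AE x in lborel. indicator S x * f x = F x"
  shows "(LINT x:S|lebesgue. f x) = (\<integral>x. F x \<partial>lborel)"
proof -
  have "AE x in lebesgue. F x = indicator S x * f x"
    using AE_completion[OF e] by (auto elim: eventually_mono)
  moreover have "F \<in> borel_measurable lebesgue" by (simp add: measurable_completion)
  ultimately have "(\<lambda>x. indicator S x * f x) \<in> borel_measurable lebesgue"
    by (rule borel_measurable_AE[rotated])
  then have "(LINT x:S|lebesgue. f x) = (\<integral>x. F x \<partial>lebesgue)"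
    unfolding set_lebesgue_integral_def using AE_completion[OF e]
    by (intro integral_cong_AE) (auto simp: measurable_completion)
  also have "\<dots> = (\<integral>x. F x \<partial>lborel)"
    by (rule integral_completion) simp
  finally show ?thesis .
qed

lemma Lp_space_2_imp_L2sq:
  assumes u: "Lp_space 2 S u" and w: "AE x in lborel. ext0 S u x = w x"
  shows "L2sq lborel w < \<infinity>"
proof -
  have "L2sq lborel w = (\<integral>\<^sup>+x. ennreal (norm (indicator S x *\<^sub>R \<bar>u x\<bar> powr 2)) \<partial>lborel)"
    unfolding L2sq_def
  proof (rule nn_integral_cong_AE)
    show "AE x in lborel. ennreal ((w x)\<^sup>2) = ennreal (norm (indicator S x *\<^sub>R \<bar>u x\<bar> powr 2))"
      using w by eventually_elim (auto simp: ext0_def split: if_splits)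
  qed
  also have "\<dots> < \<infinity>"
    using u unfolding Lp_space_def set_integrable_def integrable_iff_bounded nn_integral_completion by blast
  finally show ?thesis .
qed

text \<open>The estimates at one fixed time, where \<open>E\<close> is the squared H^1 norm of the
  slice. Difference quotients may cross the boundary of \<Omega> without a boundary term because the
  test functions approximating v vanish outside \<Omega> too, so that they approximate the zero
  extension on all of R^3.\<close>

lemma slice_estimates:
  fixes v :: "R3 \<Rightarrow> R3" and G :: "R3 \<Rightarrow> real ^ 3 ^ 3" and w :: "3 \<Rightarrow> R3 \<Rightarrow> real"
  assumes \<Omega>: "open \<Omega>" and H: "\<And>i. H10 \<Omega> (\<lambda>x. v x $ i) (\<lambda>x. G x $ i)"
    and div: "weak_div_free \<Omega> v"
    and wm[measurable]: "\<And>j. w j \<in> borel_measurable borel"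
    and w: "\<And>j. AE x in lborel. ext0 \<Omega> (\<lambda>x. v x $ j) x = w j x"
  defines "E \<equiv> (\<integral>\<^sup>+x\<in>\<Omega>. ennreal ((norm (v x))\<^sup>2 + (norm (G x))\<^sup>2) \<partial>lebesgue)"
  shows "L2sq lborel (w j) \<le> E"
    and "0 < h \<Longrightarrow> L2sq lborel (cdiff h j (w j)) \<le> 4 * E"
    and "((\<lambda>h. L2sq lborel (\<lambda>y. \<Sum>j\<in>UNIV. cdiff h j (w j) y)) \<longlongrightarrow> 0) (at_right 0)"
proof -
  \<comment> \<open>The function \<open>\<gamma> i\<close> will represent the diagonal entry of the
    gradient, that is, the weak derivative of v_i in direction i, extended by 0.\<close>
  have "\<forall>i. \<exists>\<gamma>. \<gamma> \<in> borel_measurable borel \<and> (AE x in lborel. ext0 \<Omega> (\<lambda>x. G x $ i $ i) x = \<gamma> x)"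
  proof
    fix i
    have "(\<lambda>x. G x $ i $ i) \<in> borel_measurable (lebesgue_on \<Omega>)"
      using H[of i] by (auto simp: H10_def H1_def Lp_space_def)
    moreover have "\<Omega> \<in> sets lebesgue" using \<Omega> by (simp add: borel_open)
    ultimately show "\<exists>\<gamma>. \<gamma> \<in> borel_measurable borel \<and> (AE x in lborel. ext0 \<Omega> (\<lambda>x. G x $ i $ i) x = \<gamma> x)"
      using lebesgue_borel_version by blast
  qed
  from choice[OF this] obtain \<gamma> :: "3 \<Rightarrow> R3 \<Rightarrow> real" where \<gamma>m[measurable]: "\<And>i. \<gamma> i \<in> borel_measurable borel"
    and \<gamma>: "\<And>i. AE x in lborel. ext0 \<Omega> (\<lambda>x. G x $ i $ i) x = \<gamma> i x"
    by blast
  have "\<forall>i. \<exists>\<phi> :: nat \<Rightarrow> R3 \<Rightarrow> real. (\<forall>k. test_function \<Omega> (\<phi> k)) \<and>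
        (\<lambda>k. \<integral>\<^sup>+x\<in>\<Omega>. ennreal ((\<phi> k x - v x $ i)\<^sup>2 + (norm (grad (\<phi> k) x - G x $ i))\<^sup>2) \<partial>lebesgue) \<longlonglongrightarrow> 0"
    using H by (auto simp: H10_def)
  from choice[OF this] obtain \<phi> :: "3 \<Rightarrow> nat \<Rightarrow> R3 \<Rightarrow> real" where t: "\<And>i k. test_function \<Omega> (\<phi> i k)"
    and lim: "\<And>i. (\<lambda>k. \<integral>\<^sup>+x\<in>\<Omega>. ennreal ((\<phi> i k x - v x $ i)\<^sup>2 + (norm (grad (\<phi> i k) x - G x $ i))\<^sup>2) \<partial>lebesgue) \<longlonglongrightarrow> 0"
    by blast
  note tp = test_function_pderiv3[OF t]
  note [measurable] = test_function_measurable[OF t] test_function_measurable[OF tp]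
  have le: "L2sq lborel f \<le> (\<integral>\<^sup>+x\<in>\<Omega>. ennreal (F x) \<partial>lebesgue)"
    if "AE x in lborel. (x \<notin> \<Omega> \<longrightarrow> f x = 0) \<and> (x \<in> \<Omega> \<longrightarrow> (f x)\<^sup>2 \<le> F x)" for f F
    unfolding L2sq_def nn_integral_completion
  proof (rule nn_integral_mono_AE)
    show "AE x in lborel. ennreal ((f x)\<^sup>2) \<le> ennreal (F x) * indicator \<Omega> x"
      using that by eventually_elim (auto intro!: ennreal_leI split: split_indicator)
  qed
  have comp_le: "(G x $ i $ i)\<^sup>2 \<le> (norm (G x))\<^sup>2" for x i
  proof -
    have "\<bar>G x $ i $ i\<bar> \<le> norm (G x $ i)" by (rule component_le_norm_cart)
    also have "\<dots> \<le> norm (G x)" by (rule Finite_Cartesian_Product.norm_nth_le)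
    finally show ?thesis by (simp add: abs_le_square_iff[symmetric])
  qed
  have comp_le': "(z $ i)\<^sup>2 \<le> (norm z)\<^sup>2" for z :: R3 and i
    using component_le_norm_cart[of z i] by (simp add: abs_le_square_iff[symmetric])
  show w_le: "L2sq lborel (w j) \<le> E" for j
    unfolding E_def
  proof (rule le)
    show "AE x in lborel. (x \<notin> \<Omega> \<longrightarrow> w j x = 0) \<and> (x \<in> \<Omega> \<longrightarrow> (w j x)\<^sup>2 \<le> (norm (v x))\<^sup>2 + (norm (G x))\<^sup>2)"
      using w[of j]
    proof eventually_elim
      case (elim x)
      then show ?case using comp_le'[of "v x" j] by (auto simp: ext0_def intro: add_increasing2)
    qed
  qed
  have \<gamma>_le: "L2sq lborel (\<gamma> j) \<le> E" for j
    unfolding E_def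
  proof (rule le)
    show "AE x in lborel. (x \<notin> \<Omega> \<longrightarrow> \<gamma> j x = 0) \<and> (x \<in> \<Omega> \<longrightarrow> (\<gamma> j x)\<^sup>2 \<le> (norm (v x))\<^sup>2 + (norm (G x))\<^sup>2)"
      using \<gamma>[of j]
    proof eventually_elim
      case (elim x)
      then show ?case using comp_le[of x j] by (auto simp: ext0_def intro: add_increasing)
    qed
  qed
  have lw: "(\<lambda>k. L2sq lborel (\<lambda>x. \<phi> i k x - w i x)) \<longlonglongrightarrow> 0" for i
  proof (rule tendsto_sandwich[OF _ _ tendsto_const lim[of i]])
    show "\<forall>\<^sub>F k in sequentially. L2sq lborel (\<lambda>x. \<phi> i k x - w i x)
      \<le> (\<integral>\<^sup>+x\<in>\<Omega>. ennreal ((\<phi> i k x - v x $ i)\<^sup>2 + (norm (grad (\<phi> i k) x - G x $ i))\<^sup>2) \<partial>lebesgue)"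
    proof (rule always_eventually, rule allI, rule le)
      fix k
      show "AE x in lborel. (x \<notin> \<Omega> \<longrightarrow> \<phi> i k x - w i x = 0) \<and>
        (x \<in> \<Omega> \<longrightarrow> (\<phi> i k x - w i x)\<^sup>2
          \<le> (\<phi> i k x - v x $ i)\<^sup>2 + (norm (grad (\<phi> i k) x - G x $ i))\<^sup>2)"
        using w[of i] by eventually_elim (auto simp: ext0_def test_function_eq_0[OF t])
    qed
  qed simp
  have l\<gamma>: "(\<lambda>k. L2sq lborel (\<lambda>x. pderiv3 i (\<phi> i k) x - \<gamma> i x)) \<longlonglongrightarrow> 0" for i
  proof (rule tendsto_sandwich[OF _ _ tendsto_const lim[of i]])
    show "\<forall>\<^sub>F k in sequentially. L2sq lborel (\<lambda>x. pderiv3 i (\<phi> i k) x - \<gamma> i x)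
      \<le> (\<integral>\<^sup>+x\<in>\<Omega>. ennreal ((\<phi> i k x - v x $ i)\<^sup>2 + (norm (grad (\<phi> i k) x - G x $ i))\<^sup>2) \<partial>lebesgue)"
    proof (rule always_eventually, rule allI, rule le)
      fix k
      show "AE x in lborel. (x \<notin> \<Omega> \<longrightarrow> pderiv3 i (\<phi> i k) x - \<gamma> i x = 0) \<and>
        (x \<in> \<Omega> \<longrightarrow> (pderiv3 i (\<phi> i k) x - \<gamma> i x)\<^sup>2
          \<le> (\<phi> i k x - v x $ i)\<^sup>2 + (norm (grad (\<phi> i k) x - G x $ i))\<^sup>2)"
        using \<gamma>[of i]
      proof eventually_elim
        case (elim x)
        then show ?case
          using comp_le'[of "grad (\<phi> i k) x - G x $ i" i] test_function_eq_0[OF tp, of x]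
          by (auto simp: ext0_def grad_def intro: add_increasing)
      qed
    qed
  qed simp
  have C: "C1c j (\<phi> i k)" for i j k by (rule test_function_C1c[OF t])
  show "0 < h \<Longrightarrow> L2sq lborel (cdiff h j (w j)) \<le> 4 * E"
  proof -
    assume "0 < h"
    have "L2sq lborel (cdiff h j (w j)) \<le> 4 * L2sq lborel (\<gamma> j)"
      by (rule L2sq_cdiff_closure[OF wm \<gamma>m _ _ lw l\<gamma> \<open>0 < h\<close>]) (use C in \<open>auto simp: C1c_def\<close>)
    also have "\<dots> \<le> 4 * E" by (intro mult_left_mono \<gamma>_le) simp
    finally show ?thesis .
  qed
  have wf: "L2sq lborel (w i) < \<infinity>" and \<gamma>f: "L2sq lborel (\<gamma> i) < \<infinity>" for i
    using Lp_space_2_imp_L2sq[OF _ w] Lp_space_2_imp_L2sq[OF _ \<gamma>] H[of i] by (auto simp: H10_def H1_def)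
  \<comment> \<open>A version of the divergence of v. Against a test function \<psi>, the weak
    gradients turn its integral into minus the pairing of v with the gradient of \<psi>, which is 0
    by hypothesis.\<close>
  let ?S = "\<lambda>x. \<Sum>i\<in>UNIV. \<gamma> i x"
  have orth: "(\<integral>x. ?S x * \<psi> x \<partial>lborel) = 0" if \<psi>: "test_function \<Omega> \<psi>" for \<psi>
  proof -
    note [measurable] = test_function_measurable[OF \<psi>] test_function_measurable[OF test_function_pderiv3[OF \<psi>]]
    note \<psi>p = test_function_pderiv3[OF \<psi>]
    have I: "integrable lborel (\<lambda>x. \<gamma> i x * \<psi> x)" "integrable lborel (\<lambda>x. w i x * pderiv3 i \<psi> x)" for i
      by (auto intro!: integrable_mult_L2 \<gamma>f wf test_function_L2[OF \<psi>] test_function_L2[OF \<psi>p])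
    have "(\<integral>x. w i x * pderiv3 i \<psi> x \<partial>lborel) = - (\<integral>x. \<gamma> i x * \<psi> x \<partial>lborel)" for i
    proof -
      have "(\<integral>x. w i x * pderiv3 i \<psi> x \<partial>lborel) = (LINT x:\<Omega>|lebesgue. v x $ i * pderiv3 i \<psi> x)"
      proof (rule set_lebesgue_integral_borel_version[symmetric])
        show "AE x in lborel. indicator \<Omega> x * (v x $ i * pderiv3 i \<psi> x) = w i x * pderiv3 i \<psi> x"
          using w[of i] by eventually_elim (auto simp: ext0_def split: split_indicator)
      qed measurable
      also have "\<dots> = - (LINT x:\<Omega>|lebesgue. G x $ i $ i * \<psi> x)"
        using H[of i] \<psi> unfolding H10_def H1_def has_weak_grad_def by blast
      also have "(LINT x:\<Omega>|lebesgue. G x $ i $ i * \<psi> x) = (\<integral>x. \<gamma> i x * \<psi> x \<partial>lborel)"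
      proof (rule set_lebesgue_integral_borel_version)
        show "AE x in lborel. indicator \<Omega> x * (G x $ i $ i * \<psi> x) = \<gamma> i x * \<psi> x"
          using \<gamma>[of i] by eventually_elim (auto simp: ext0_def split: split_indicator)
      qed measurable
      finally show ?thesis .
    qed
    then have "- (\<integral>x. ?S x * \<psi> x \<partial>lborel) = (\<Sum>i\<in>UNIV. (\<integral>x. w i x * pderiv3 i \<psi> x \<partial>lborel))"
      using I by (simp add: sum_distrib_right sum_negf)
    also have "\<dots> = (\<integral>x. (\<Sum>i\<in>UNIV. w i x * pderiv3 i \<psi> x) \<partial>lborel)"
      using I by simp
    also have "\<dots> = (LINT x:\<Omega>|lebesgue. v x \<bullet> grad \<psi> x)"
    proof (rule set_lebesgue_integral_borel_version[symmetric])
      have "AE x in lborel. \<forall>i\<in>UNIV. ext0 \<Omega> (\<lambda>x. v x $ i) x = w i x"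
        using w by (intro AE_finite_allI) auto
      then show "AE x in lborel. indicator \<Omega> x * (v x \<bullet> grad \<psi> x) = (\<Sum>i\<in>UNIV. w i x * pderiv3 i \<psi> x)"
      proof eventually_elim
        case (elim x)
        then have "w i x = (if x \<in> \<Omega> then v x $ i else 0)" for i by (simp add: ext0_def)
        then show ?case by (cases "x \<in> \<Omega>") (simp_all add: inner_vec_def grad_def)
      qed
    qed measurable
    also have "\<dots> = 0"
      using div \<psi> by (simp add: weak_div_free_def)
    finally show ?thesis by simp
  qed
  have Sf: "L2sq lborel ?S < \<infinity>"
    by (rule le_less_trans[OF L2sq_sum]) (use \<gamma>f in \<open>auto simp: ennreal_mult_less_top\<close>)
  \<comment> \<open>The divergence of the approximants is itself a test function, hence orthogonal to \<open>?S\<close>; this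
    replaces the density of test functions in \<open>L\<^sup>2\<close>.\<close>
  have "L2sq lborel ?S \<le> 0"
  proof (rule tendsto_lowerbound)
    show "(\<lambda>k. 3 * (\<Sum>i\<in>UNIV. L2sq lborel (\<lambda>x. pderiv3 i (\<phi> i k) x - \<gamma> i x))) \<longlonglongrightarrow> 0"
      using ennreal_tendsto_cmult[of 3, OF _ tendsto_sum[of UNIV, OF l\<gamma>]] by simp
    show "\<forall>\<^sub>F k in sequentially. L2sq lborel ?S \<le> 3 * (\<Sum>i\<in>UNIV. L2sq lborel (\<lambda>x. pderiv3 i (\<phi> i k) x - \<gamma> i x))"
    proof (intro always_eventually allI)
      fix k
      let ?d = "\<lambda>x. \<Sum>i\<in>UNIV. pderiv3 i (\<phi> i k) x"
      have df: "L2sq lborel ?d < \<infinity>"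
        by (rule le_less_trans[OF L2sq_sum]) (use test_function_L2[OF tp] in \<open>auto simp: ennreal_mult_less_top\<close>)
      have I: "integrable lborel (\<lambda>x. ?S x * pderiv3 i (\<phi> i k) x)" for i
        by (rule integrable_mult_L2) (use Sf test_function_L2[OF tp] in auto)
      have "(\<integral>x. ?S x * ?d x \<partial>lborel) = (\<Sum>i\<in>UNIV. (\<integral>x. ?S x * pderiv3 i (\<phi> i k) x \<partial>lborel))"
        unfolding sum_distrib_left[where f="\<lambda>i. pderiv3 i (\<phi> i k) x" for x] using I by (rule Bochner_Integration.integral_sum)
      also have "\<dots> = 0" by (simp only: orth[OF tp]) simp
      finally have "L2sq lborel ?S \<le> L2sq lborel (\<lambda>x. ?S x - ?d x)"
        by (intro L2sq_le_orthogonal Sf df) auto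
      also have "\<dots> = L2sq lborel (\<lambda>x. \<Sum>i\<in>UNIV. pderiv3 i (\<phi> i k) x - \<gamma> i x)"
        by (subst L2sq_minus_commute) (simp add: sum_subtractf)
      also have "\<dots> \<le> of_nat (card (UNIV :: 3 set)) * (\<Sum>i\<in>UNIV. L2sq lborel (\<lambda>x. pderiv3 i (\<phi> i k) x - \<gamma> i x))"
        by (rule L2sq_sum) measurable
      finally show "L2sq lborel ?S \<le> 3 * (\<Sum>i\<in>UNIV. L2sq lborel (\<lambda>x. pderiv3 i (\<phi> i k) x - \<gamma> i x))"
        by simp
    qed
  qed simp
  then have S0: "AE x in lborel. ?S x = 0"
    by (simp add: L2sq_def nn_integral_0_iff_AE)
  show "((\<lambda>h. L2sq lborel (\<lambda>y. \<Sum>j\<in>UNIV. cdiff h j (w j) y)) \<longlongrightarrow> 0) (at_right 0)"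
  proof (rule tendsto_sandwich[OF _ _ tendsto_const])
    show "((\<lambda>h. 3 * (\<Sum>i\<in>UNIV. L2sq lborel (\<lambda>y. cdiff h i (w i) y - \<gamma> i y))) \<longlongrightarrow> 0) (at_right 0)"
      using ennreal_tendsto_cmult[of 3, OF _ tendsto_sum[of UNIV, OF cdiff_tendsto_weak_derivative[OF wm \<gamma>m C lw l\<gamma>]]]
      by simp
    have "L2sq lborel (\<lambda>y. \<Sum>j\<in>UNIV. cdiff h j (w j) y) \<le> 3 * (\<Sum>i\<in>UNIV. L2sq lborel (\<lambda>y. cdiff h i (w i) y - \<gamma> i y))" for h
    proof -
      \<comment> \<open>Subtracting the divergence, which is 0 almost everywhere, pairs every
        quotient with its own limit, so that the three convergences can be added.\<close>
      have "L2sq lborel (\<lambda>y. \<Sum>j\<in>UNIV. cdiff h j (w j) y) = L2sq lborel (\<lambda>y. \<Sum>j\<in>UNIV. cdiff h j (w j) y - \<gamma> j y)"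
      proof (rule L2sq_cong_AE)
        show "AE y in lborel. (\<Sum>j\<in>UNIV. cdiff h j (w j) y) = (\<Sum>j\<in>UNIV. cdiff h j (w j) y - \<gamma> j y)"
          using S0 by eventually_elim (simp add: sum_subtractf)
      qed
      also have "\<dots> \<le> of_nat (card (UNIV :: 3 set)) * (\<Sum>i\<in>UNIV. L2sq lborel (\<lambda>y. cdiff h i (w i) y - \<gamma> i y))"
        by (rule L2sq_sum) measurable
      finally show ?thesis by simp
    qed
    then show "\<forall>\<^sub>F h in at_right 0. L2sq lborel (\<lambda>y. \<Sum>j\<in>UNIV. cdiff h j (w j) y)
        \<le> 3 * (\<Sum>i\<in>UNIV. L2sq lborel (\<lambda>y. cdiff h i (w i) y - \<gamma> i y))"
      by (auto intro: always_eventually)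
  qed simp
qed

section \<open>Velocity fields on space-time\<close>

definition stdiff :: "real \<Rightarrow> 3 \<Rightarrow> (real \<times> R3 \<Rightarrow> real) \<Rightarrow> real \<times> R3 \<Rightarrow> real" where
  "stdiff h j F z = (F (z + (0, h *\<^sub>R axis j 1)) - F (z + - (0, h *\<^sub>R axis j 1))) / (2 * h)"

lemma stdiff_Pair: "stdiff h j F (t, x) = cdiff h j (\<lambda>y. F (t, y)) x"
  by (simp add: stdiff_def cdiff_def)

lemma stdiff_measurable [measurable]:
  assumes [measurable]: "F \<in> borel_measurable borel"
  shows "stdiff h j F \<in> borel_measurable borel"
  unfolding stdiff_def[abs_def] by measurable

lemma measurable_section:
  fixes F :: "'a::second_countable_topology \<times> 'b::second_countable_topology \<Rightarrow> real"
  assumes [measurable]: "F \<in> borel_measurable borel"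
  shows "(\<lambda>x. F (t, x)) \<in> borel_measurable borel"
  by (rule measurable_compose[OF _ assms]) (simp add: borel_prod[symmetric])

lemma
  fixes f :: "'a::euclidean_space \<times> 'b::euclidean_space \<Rightarrow> real"
  assumes [measurable]: "f \<in> borel_measurable borel"
  shows L2sq_pair: "L2sq lborel f = (\<integral>\<^sup>+t. L2sq lborel (\<lambda>x. f (t, x)) \<partial>lborel)"
    and L2sq_section_measurable: "(\<lambda>t. L2sq lborel (\<lambda>x. f (t, x))) \<in> borel_measurable borel"
proof -
  have m: "(\<lambda>z. ennreal ((f z)\<^sup>2)) \<in> borel_measurable (lborel \<Otimes>\<^sub>M lborel)"
    by (simp add: lborel_prod)
  show "L2sq lborel f = (\<integral>\<^sup>+t. L2sq lborel (\<lambda>x. f (t, x)) \<partial>lborel)"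
    using lborel.nn_integral_fst[OF m] by (simp add: L2sq_def lborel_prod)
  show "(\<lambda>t. L2sq lborel (\<lambda>x. f (t, x))) \<in> borel_measurable borel"
    using lborel.borel_measurable_nn_integral_fst[OF m] by (simp add: L2sq_def)
qed

text \<open>Integrates the pointwise inequality |a| <= \<epsilon> + a^2 / \<epsilon> over B. It
  stands in for the Cauchy-Schwarz inequality, and \<epsilon> is tuned later to make both terms
  small.\<close>

lemma L1_le_L2sq:
  assumes [measurable]: "f \<in> borel_measurable M" "B \<in> sets M"
    and B: "emeasure M B = ennreal m" "0 \<le> m"
    and z: "\<And>x. x \<notin> B \<Longrightarrow> f x = 0" and \<epsilon>: "0 < \<epsilon>"
  shows "(\<integral>\<^sup>+x. ennreal \<bar>f x\<bar> \<partial>M) \<le> ennreal (\<epsilon> * m) + ennreal (1 / \<epsilon>) * L2sq M f"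
proof -
  have "(\<integral>\<^sup>+x. ennreal \<bar>f x\<bar> \<partial>M) \<le> (\<integral>\<^sup>+x. ennreal \<epsilon> * indicator B x + ennreal (1 / \<epsilon>) * ennreal ((f x)\<^sup>2) \<partial>M)"
  proof (rule nn_integral_mono)
    fix x
    have "\<bar>f x\<bar> \<le> \<epsilon> * indicator B x + 1 / \<epsilon> * (f x)\<^sup>2"
    proof (cases "x \<in> B")
      case True
      have "\<epsilon> * \<bar>f x\<bar> \<le> \<epsilon> * \<epsilon> + (f x)\<^sup>2"
        using sum_squares_bound[of \<epsilon> "\<bar>f x\<bar>"] \<epsilon> mult_nonneg_nonneg[of \<epsilon> "\<bar>f x\<bar>"]
        unfolding power2_abs power2_eq_square[of \<epsilon>] by linarith
      with True \<epsilon> show ?thesis by (simp add: field_simps)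
    qed (use z in simp)
    then have "ennreal \<bar>f x\<bar> \<le> ennreal (\<epsilon> * indicator B x + 1 / \<epsilon> * (f x)\<^sup>2)" by (rule ennreal_leI)
    also have "\<dots> = ennreal \<epsilon> * indicator B x + ennreal (1 / \<epsilon>) * ennreal ((f x)\<^sup>2)"
      using \<epsilon> by (subst ennreal_plus) (auto simp: ennreal_mult split: split_indicator simp flip: ennreal_mult)
    finally show "ennreal \<bar>f x\<bar> \<le> ennreal \<epsilon> * indicator B x + ennreal (1 / \<epsilon>) * ennreal ((f x)\<^sup>2)" .
  qed
  also have "\<dots> = ennreal \<epsilon> * emeasure M B + ennreal (1 / \<epsilon>) * L2sq M f"
    unfolding L2sq_def by (subst nn_integral_add) (auto simp: nn_integral_cmult nn_integral_cmult_indicator)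
  finally show ?thesis
    using B \<epsilon> by (simp add: ennreal_mult)
qed

text \<open>A Borel version agrees with v almost everywhere in space-time; Fubini for null sets
  turns this into agreement almost everywhere on almost every time slice.\<close>

lemma velocity_borel_version:
  fixes v :: "real \<Rightarrow> R3 \<Rightarrow> R3"
  assumes \<Omega>: "open \<Omega>" and L2: "L2_H10 T \<Omega> v"
  obtains V :: "3 \<Rightarrow> real \<times> R3 \<Rightarrow> real" where
    "\<And>j. V j \<in> borel_measurable borel"
    "\<And>j t x. (t, x) \<notin> {0..T} \<times> \<Omega> \<Longrightarrow> V j (t, x) = 0"
    "AE t in lborel. t \<in> {0..T} \<longrightarrow> (\<forall>j. AE x in lborel. ext0 \<Omega> (\<lambda>x. v t x $ j) x = V j (t, x))"
proof -
  let ?S = "{0..T} \<times> \<Omega>"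
  have S: "?S \<in> sets borel" using \<Omega> by (simp add: borel_prod[symmetric])
  have "\<forall>j. \<exists>W. W \<in> borel_measurable borel \<and> (AE z in lborel. ext0 ?S (\<lambda>z. (case z of (t, x) \<Rightarrow> v t x) $ j) z = W z)"
  proof
    fix j
    have "(\<lambda>z. (case z of (t, x) \<Rightarrow> v t x)) \<in> borel_measurable (lebesgue_on ?S)"
      using L2 by (simp add: L2_H10_def)
    then have "(\<lambda>z. (case z of (t, x) \<Rightarrow> v t x) $ j) \<in> borel_measurable (lebesgue_on ?S)"
      by (rule measurable_compose) (intro borel_measurable_continuous_onI continuous_intros)
    moreover have "?S \<in> sets lebesgue" using S by simp
    ultimately show "\<exists>W. W \<in> borel_measurable borel \<and> (AE z in lborel. ext0 ?S (\<lambda>z. (case z of (t, x) \<Rightarrow> v t x) $ j) z = W z)"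
      using lebesgue_borel_version by blast
  qed
  from choice[OF this] obtain W :: "3 \<Rightarrow> real \<times> R3 \<Rightarrow> real" where Wm: "\<And>j. W j \<in> borel_measurable borel"
    and W: "\<And>j. AE z in lborel. ext0 ?S (\<lambda>z. (case z of (t, x) \<Rightarrow> v t x) $ j) z = W j z"
    by blast
  show thesis
  proof
    \<comment> \<open>The cut-off makes the function vanish at every point outside, not just almost
      everywhere; values at shifted arguments can then be discarded pointwise.\<close>
    show "(\<lambda>z. indicator ?S z * W j z) \<in> borel_measurable borel" for j
      using Wm S by measurable
    show "(t, x) \<notin> ?S \<Longrightarrow> indicator ?S (t, x) * W j (t, x) = 0" for j t x by simp
    have "AE t in lborel. AE x in lborel. ext0 ?S (\<lambda>z. (case z of (t, x) \<Rightarrow> v t x) $ j) (t, x) = W j (t, x)" for j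
      by (rule lborel_pair.AE_pair[OF W[of j, folded lborel_prod]])
    then have "AE t in lborel. \<forall>j\<in>UNIV. AE x in lborel. ext0 ?S (\<lambda>z. (case z of (t, x) \<Rightarrow> v t x) $ j) (t, x) = W j (t, x)"
      by (intro AE_finite_allI) auto
    then show "AE t in lborel. t \<in> {0..T} \<longrightarrow> (\<forall>j. AE x in lborel. ext0 \<Omega> (\<lambda>x. v t x $ j) x = indicator ?S (t, x) * W j (t, x))"
    proof eventually_elim
      case (elim t)
      show ?case
      proof (intro impI allI)
        fix j assume t: "t \<in> {0..T}"
        from elim have "AE x in lborel. ext0 ?S (\<lambda>z. (case z of (t, x) \<Rightarrow> v t x) $ j) (t, x) = W j (t, x)" by blast
        then show "AE x in lborel. ext0 \<Omega> (\<lambda>x. v t x $ j) x = indicator ?S (t, x) * W j (t, x)"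
          by eventually_elim (use t in \<open>auto simp: ext0_def split: if_splits\<close>)
      qed
    qed
  qed
qed

text \<open>The slice estimates integrated over time. The divergence quotients converge on almost
  every slice, and the bound by 36 \<open>E\<close> makes dominated convergence applicable.\<close>

lemma velocity_estimates:
  fixes v :: "real \<Rightarrow> R3 \<Rightarrow> R3" and V :: "3 \<Rightarrow> real \<times> R3 \<Rightarrow> real"
  assumes \<Omega>: "open \<Omega>" and L2: "L2_H10 T \<Omega> v"
    and div: "AE t in lebesgue_on {0..T}. weak_div_free \<Omega> (v t)"
    and Vm[measurable]: "\<And>j. V j \<in> borel_measurable borel"
    and V0: "\<And>j t x. (t, x) \<notin> {0..T} \<times> \<Omega> \<Longrightarrow> V j (t, x) = 0"
    and Veq: "AE t in lborel. t \<in> {0..T} \<longrightarrow> (\<forall>j. AE x in lborel. ext0 \<Omega> (\<lambda>x. v t x $ j) x = V j (t, x))"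
  obtains K where "0 \<le> K" "\<And>j. L2sq lborel (V j) \<le> ennreal K"
    "\<And>h j. 0 < h \<Longrightarrow> L2sq lborel (stdiff h j (V j)) \<le> ennreal K"
    "\<And>h. 0 < h \<Longrightarrow> L2sq lborel (\<lambda>z. \<Sum>j\<in>UNIV. stdiff h j (V j) z) \<le> ennreal K"
    "((\<lambda>h. L2sq lborel (\<lambda>z. \<Sum>j\<in>UNIV. stdiff h j (V j) z)) \<longlongrightarrow> 0) (at_right 0)"
proof -
  obtain G :: "real \<Rightarrow> R3 \<Rightarrow> real ^ 3 ^ 3" where
    H: "AE t in lebesgue_on {0..T}. \<forall>i. H10 \<Omega> (\<lambda>x. v t x $ i) (\<lambda>x. G t x $ i)" and
    fin: "(\<integral>\<^sup>+t\<in>{0..T}. (\<integral>\<^sup>+x\<in>\<Omega>. ennreal ((norm (v t x))\<^sup>2 + (norm (G t x))\<^sup>2) \<partial>lebesgue) \<partial>lebesgue) < \<infinity>"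
    using L2 unfolding L2_H10_def by blast
  define E where "E t = (\<integral>\<^sup>+x\<in>\<Omega>. ennreal ((norm (v t x))\<^sup>2 + (norm (G t x))\<^sup>2) \<partial>lebesgue) * indicator {0..T} t" for t
  let ?D = "\<lambda>h z. \<Sum>j\<in>UNIV. stdiff h j (V j) z"
  have Efin: "(\<integral>\<^sup>+t. E t \<partial>lborel) < \<infinity>"
    using fin by (simp add: E_def nn_integral_completion)
  have on_iff: "(AE t in lebesgue_on {0..T}. P t) \<longleftrightarrow> (AE t in lborel. t \<in> {0..T} \<longrightarrow> P t)" for P
    by (subst AE_restrict_space_iff) (auto simp: AE_completion_iff)
  have slice: "AE t in lborel. (\<forall>j. L2sq lborel (\<lambda>x. V j (t, x)) \<le> E t) \<and>
      (\<forall>h>0. \<forall>j. L2sq lborel (\<lambda>x. stdiff h j (V j) (t, x)) \<le> 4 * E t) \<and>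
      ((\<lambda>h. L2sq lborel (\<lambda>x. ?D h (t, x))) \<longlongrightarrow> 0) (at_right 0)"
    using H[unfolded on_iff] div[unfolded on_iff] Veq
  proof eventually_elim
    case (elim t)
    show ?case
    proof (cases "t \<in> {0..T}")
      case False
      then have "V j (t, x) = 0" for j x using V0 by blast
      then show ?thesis by (simp add: stdiff_Pair cdiff_def L2sq_def)
    next
      case True
      have E: "E t = (\<integral>\<^sup>+x\<in>\<Omega>. ennreal ((norm (v t x))\<^sup>2 + (norm (G t x))\<^sup>2) \<partial>lebesgue)"
        using True by (simp add: E_def)
      have H: "\<And>i. H10 \<Omega> (\<lambda>x. v t x $ i) (\<lambda>x. G t x $ i)" and d: "weak_div_free \<Omega> (v t)"
        and eq: "\<And>j. AE x in lborel. ext0 \<Omega> (\<lambda>x. v t x $ j) x = V j (t, x)"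
        using elim True by blast+
      note sl = slice_estimates[OF \<Omega> H d measurable_section[OF Vm] eq, folded E]
      have [simp]: "cdiff h j (\<lambda>y. V j (t, y)) = (\<lambda>x. stdiff h j (V j) (t, x))" for h j
        by (simp add: stdiff_Pair)
      show ?thesis
        using sl by simp
    qed
  qed
  have sm: "(\<lambda>t. L2sq lborel (\<lambda>x. V j (t, x))) \<in> borel_measurable borel"
    "(\<lambda>t. L2sq lborel (\<lambda>x. stdiff h j (V j) (t, x))) \<in> borel_measurable borel"
    "(\<lambda>t. L2sq lborel (\<lambda>x. ?D h (t, x))) \<in> borel_measurable borel" for h j
    by (rule L2sq_section_measurable; measurable)+
  \<comment> \<open>\<open>E\<close> is not known to be measurable, so constants are pulled out of the integral of \<open>F\<close> instead.\<close>
  have scale: "integral\<^sup>N lborel F \<le> ennreal c * integral\<^sup>N lborel E"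
    if [measurable]: "F \<in> borel_measurable borel" and le: "AE t in lborel. F t \<le> ennreal c * E t" and c: "0 < c"
    for F :: "real \<Rightarrow> ennreal" and c
  proof -
    have "ennreal (1/c) * integral\<^sup>N lborel F = (\<integral>\<^sup>+t. ennreal (1/c) * F t \<partial>lborel)"
      by (simp add: nn_integral_cmult)
    also have "\<dots> \<le> integral\<^sup>N lborel E"
    proof (rule nn_integral_mono_AE)
      show "AE t in lborel. ennreal (1/c) * F t \<le> E t"
        using le
      proof eventually_elim
        case (elim t)
        then have "ennreal (1/c) * F t \<le> ennreal (1/c) * (ennreal c * E t)" by (rule mult_left_mono) simp
        also have "\<dots> = E t" using c by (simp add: mult.assoc[symmetric] ennreal_mult[symmetric])
        finally show ?case .
      qed
    qed
    finally have "ennreal c * (ennreal (1/c) * integral\<^sup>N lborel F) \<le> ennreal c * integral\<^sup>N lborel E"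
      by (rule mult_left_mono) simp
    then show ?thesis using c by (simp add: mult.assoc[symmetric] ennreal_mult[symmetric])
  qed
  \<comment> \<open>36 = 3 * 3 * 4: the square of a sum of three terms costs a factor 3, and each of
    the three quotients is bounded by 4 \<open>E t\<close>.\<close>
  have D_le: "L2sq lborel (\<lambda>x. ?D h (t, x)) \<le> ennreal 36 * E t"
    if "\<forall>j. L2sq lborel (\<lambda>x. stdiff h j (V j) (t, x)) \<le> 4 * E t" for h t
  proof -
    have "L2sq lborel (\<lambda>x. ?D h (t, x)) \<le> of_nat (card (UNIV :: 3 set)) * (\<Sum>j\<in>UNIV. L2sq lborel (\<lambda>x. stdiff h j (V j) (t, x)))"
      by (rule L2sq_sum) (use measurable_section[OF stdiff_measurable[OF Vm]] in simp)
    also have "\<dots> \<le> of_nat (card (UNIV :: 3 set)) * (\<Sum>j\<in>(UNIV :: 3 set). 4 * E t)"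
      by (intro mult_left_mono sum_mono) (use that in auto)
    also have "\<dots> = ennreal 36 * E t" by (simp add: mult.assoc[symmetric])
    finally show ?thesis .
  qed
  define K where "K = 36 * enn2real (integral\<^sup>N lborel E)"
  have K: "ennreal c * integral\<^sup>N lborel E \<le> ennreal K" if "c \<le> 36" for c
  proof -
    have "ennreal c * integral\<^sup>N lborel E \<le> ennreal 36 * integral\<^sup>N lborel E"
      using that by (intro mult_right_mono ennreal_leI) auto
    also have "\<dots> = ennreal K"
      using Efin by (simp add: K_def ennreal_mult)
    finally show ?thesis .
  qed
  show thesis
  proof
    show "0 \<le> K" by (simp add: K_def)
    show "L2sq lborel (V j) \<le> ennreal K" for j
      unfolding L2sq_pair[OF Vm]
    proof (rule order_trans[OF scale[where c=1] K])
      show "AE t in lborel. L2sq lborel (\<lambda>x. V j (t, x)) \<le> ennreal 1 * E t"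
        using slice by eventually_elim simp
    qed (use sm in auto)
    show "L2sq lborel (stdiff h j (V j)) \<le> ennreal K" if "0 < h" for h j
      unfolding L2sq_pair[OF stdiff_measurable[OF Vm]]
    proof (rule order_trans[OF scale[where c=4] K])
      show "AE t in lborel. L2sq lborel (\<lambda>x. stdiff h j (V j) (t, x)) \<le> ennreal 4 * E t"
        using slice by eventually_elim (use that in simp)
    qed (use sm in auto)
    have Dm: "?D h \<in> borel_measurable borel" for h by measurable
    have D36: "AE t in lborel. L2sq lborel (\<lambda>x. ?D h (t, x)) \<le> ennreal 36 * E t" if "0 < h" for h
      using slice by eventually_elim (use that in \<open>auto intro!: D_le simp del: ennreal_numeral\<close>)
    show "L2sq lborel (?D h) \<le> ennreal K" if "0 < h" for h
      unfolding L2sq_pair[OF Dm]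
      by (rule order_trans[OF scale[where c=36] K, OF sm(3) D36]) (use that in auto)
    \<comment> \<open>Dominated convergence is a statement on sequences, so the limit is tested
      along every null sequence of positive h.\<close>
    show "((\<lambda>h. L2sq lborel (?D h)) \<longlongrightarrow> 0) (at_right 0)"
      unfolding tendsto_at_iff_sequentially
    proof (intro allI impI)
      fix X :: "nat \<Rightarrow> real" assume X: "\<forall>i. X i \<in> {0<..} - {0}" "X \<longlonglongrightarrow> 0"
      then have Xp: "0 < X i" for i by (auto simp: greaterThan_def)
      let ?F = "\<lambda>i t. L2sq lborel (\<lambda>x. ?D (X i) (t, x))"
      \<comment> \<open>The supremum over the sequence is taken as majorant: it is measurable, and
        it lies below 36 \<open>E\<close>.\<close>
      have W: "AE t in lborel. (SUP i. ?F i t) \<le> ennreal 36 * E t"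
      proof -
        have "AE t in lborel. \<forall>i. ?F i t \<le> ennreal 36 * E t"
          by (subst AE_all_countable) (use D36[OF Xp] in auto)
        then show ?thesis by eventually_elim (blast intro: SUP_least)
      qed
      have "(\<lambda>i. \<integral>\<^sup>+t. ?F i t \<partial>lborel) \<longlonglongrightarrow> (\<integral>\<^sup>+t. 0 \<partial>(lborel :: real measure))"
      proof (rule nn_integral_dominated_convergence[where w="\<lambda>t. SUP i. ?F i t"])
        show "(\<lambda>t. SUP i. ?F i t) \<in> borel_measurable lborel"
          using sm(3) by (intro borel_measurable_SUP) auto
        show "AE t in lborel. ?F i t \<le> (SUP i. ?F i t)" for i
          by (rule AE_I2) (rule SUP_upper, simp)
        have "(\<integral>\<^sup>+t. (SUP i. ?F i t) \<partial>lborel) \<le> ennreal 36 * integral\<^sup>N lborel E"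
          by (rule scale[OF _ W]) (use sm(3) in \<open>auto intro: borel_measurable_SUP\<close>)
        also have "\<dots> < \<infinity>" using Efin by (simp add: ennreal_mult_less_top)
        finally show "(\<integral>\<^sup>+t. (SUP i. ?F i t) \<partial>lborel) < \<infinity>" .
        show "AE t in lborel. (\<lambda>i. ?F i t) \<longlonglongrightarrow> 0"
          using slice
        proof eventually_elim
          case (elim t)
          then have "((\<lambda>h. L2sq lborel (\<lambda>x. ?D h (t, x))) \<longlongrightarrow> 0) (at_right 0)" by blast
          then have "((\<lambda>h. L2sq lborel (\<lambda>x. ?D h (t, x))) \<circ> X) \<longlonglongrightarrow> 0"
            using X unfolding tendsto_at_iff_sequentially by blast
          then show ?case by (simp add: o_def)
        qed
      qed (use sm(3) in simp_all)
      then show "((\<lambda>h. L2sq lborel (?D h)) \<circ> X) \<longlonglongrightarrow> 0"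
        by (simp add: o_def L2sq_pair[OF Dm])
    qed
  qed
qed

lemma velocity_divergence_L1:
  fixes V :: "3 \<Rightarrow> real \<times> R3 \<Rightarrow> real"
  assumes b: "bounded \<Omega>"
    and Vm[measurable]: "\<And>j. V j \<in> borel_measurable borel"
    and V0: "\<And>j t x. (t, x) \<notin> {0..T} \<times> \<Omega> \<Longrightarrow> V j (t, x) = 0"
    and K: "0 \<le> K" "\<And>h. 0 < h \<Longrightarrow> L2sq lborel (\<lambda>z. \<Sum>j\<in>UNIV. stdiff h j (V j) z) \<le> ennreal K"
    and lim: "((\<lambda>h. L2sq lborel (\<lambda>z. \<Sum>j\<in>UNIV. stdiff h j (V j) z)) \<longlongrightarrow> 0) (at_right 0)"
  obtains K' where "0 \<le> K'"
    "\<And>h. 0 < h \<Longrightarrow> h \<le> 1 \<Longrightarrow> (\<integral>\<^sup>+z. ennreal \<bar>\<Sum>j\<in>UNIV. stdiff h j (V j) z\<bar> \<partial>lborel) \<le> ennreal K'"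
    "((\<lambda>h. \<integral>\<^sup>+z. ennreal \<bar>\<Sum>j\<in>UNIV. stdiff h j (V j) z\<bar> \<partial>lborel) \<longlongrightarrow> 0) (at_right 0)"
proof -
  let ?D = "\<lambda>h z. \<Sum>j\<in>UNIV. stdiff h j (V j) z"
  obtain r where r: "\<And>x. x \<in> \<Omega> \<Longrightarrow> norm x \<le> r" using b unfolding bounded_iff by blast
  \<comment> \<open>Enlarging the radius by 1 accommodates shifts by h <= 1, so one set of finite
    measure serves all such h.\<close>
  let ?B = "{0..T} \<times> cball (0::R3) (r + 1)"
  have B: "bounded ?B" "?B \<in> sets borel" by (auto intro: bounded_Times simp: borel_prod[symmetric])
  define m where "m = measure lborel ?B"
  have "emeasure lborel ?B < \<infinity>" using B by (intro emeasure_bounded_finite)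
  then have m: "emeasure lborel ?B = ennreal m" "0 \<le> m"
    unfolding m_def by (auto intro: emeasure_eq_ennreal_measure)
  have zero: "?D h z = 0" if h: "0 < h" "h \<le> 1" and z: "z \<notin> ?B" for h z
  proof -
    obtain t x where tx: "z = (t, x)" by fastforce
    have "V j (t, x + h *\<^sub>R axis j 1) = 0" "V j (t, x - h *\<^sub>R axis j 1) = 0" for j
    proof -
      let ?e = "h *\<^sub>R axis j 1 :: R3"
      have n: "norm ?e \<le> 1" using h by simp
      have "norm x \<le> r + 1" if "x + ?e \<in> \<Omega> \<or> x - ?e \<in> \<Omega>"
        using that r[of "x + ?e"] r[of "x - ?e"] n norm_triangle_ineq4[of "x + ?e" ?e] norm_triangle_ineq[of "x - ?e" ?e] by auto
      then show "V j (t, x + ?e) = 0" "V j (t, x - ?e) = 0"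
        using z tx by (auto intro!: V0)
    qed
    then show ?thesis by (simp add: tx stdiff_Pair cdiff_def)
  qed
  have est: "(\<integral>\<^sup>+z. ennreal \<bar>?D h z\<bar> \<partial>lborel) \<le> ennreal (\<epsilon> * m) + ennreal (1 / \<epsilon>) * L2sq lborel (?D h)"
    if "0 < h" "h \<le> 1" "0 < \<epsilon>" for h \<epsilon>
    by (rule L1_le_L2sq[where B="?B"]) (use that m B zero in auto)
  show thesis
  proof
    show "0 \<le> m + K" using m K by simp
    show "(\<integral>\<^sup>+z. ennreal \<bar>?D h z\<bar> \<partial>lborel) \<le> ennreal (m + K)" if h: "0 < h" "h \<le> 1" for h
    proof -
      have "(\<integral>\<^sup>+z. ennreal \<bar>?D h z\<bar> \<partial>lborel) \<le> ennreal m + L2sq lborel (?D h)"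
        using est[OF h, of 1] by simp
      also have "\<dots> \<le> ennreal m + ennreal K" by (intro add_left_mono K h)
      finally show ?thesis using m K by simp
    qed
    show "((\<lambda>h. \<integral>\<^sup>+z. ennreal \<bar>?D h z\<bar> \<partial>lborel) \<longlongrightarrow> 0) (at_right 0)"
    proof (rule ennreal_tendsto_0I)
      fix e :: real assume e: "0 < e"
      \<comment> \<open>This makes the volume term at most e/2. The L^2 term is eventually at most
        (1/\<epsilon>) * \<epsilon> * e/2, the other half.\<close>
      define \<epsilon> where "\<epsilon> = e / (2 * (m + 1))"
      have \<epsilon>: "0 < \<epsilon>" "\<epsilon> * m \<le> e / 2" using e m by (auto simp: \<epsilon>_def field_simps)
      have "\<forall>\<^sub>F h in at_right 0. L2sq lborel (?D h) \<le> ennreal (\<epsilon> * (e / 2))"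
        using e \<epsilon> by (intro ennreal_tendsto_0D[OF lim]) auto
      moreover have "\<forall>\<^sub>F h in at_right (0::real). 0 < h \<and> h \<le> 1"
        unfolding eventually_at_right_field by (intro exI[of _ 1]) auto
      ultimately show "\<forall>\<^sub>F h in at_right 0. (\<integral>\<^sup>+z. ennreal \<bar>?D h z\<bar> \<partial>lborel) \<le> ennreal e"
      proof eventually_elim
        case (elim h)
        have "(\<integral>\<^sup>+z. ennreal \<bar>?D h z\<bar> \<partial>lborel) \<le> ennreal (\<epsilon> * m) + ennreal (1 / \<epsilon>) * L2sq lborel (?D h)"
          using elim \<epsilon> by (intro est) auto
        also have "\<dots> \<le> ennreal (e / 2) + ennreal (1 / \<epsilon>) * ennreal (\<epsilon> * (e / 2))"
          using elim \<epsilon> by (intro add_mono mult_left_mono ennreal_leI) auto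
        also have "\<dots> = ennreal e"
          using e \<epsilon> by (simp add: ennreal_mult[symmetric] ennreal_plus[symmetric] del: ennreal_plus)
        finally show ?case .
      qed
    qed
  qed
qed

section \<open>Cell averages\<close>

lemma nearest_grid: "0 < h \<Longrightarrow> nearest h y \<in> grid h"
  using nearest_iff by blast

lemma mem_cell_nearest: "0 < h \<Longrightarrow> z \<in> cell h (nearest h y) \<longleftrightarrow> nearest h z = nearest h y"
  using nearest_iff[of h "nearest h y" z] nearest_grid[of h y] by auto

text \<open>Shifts by grid vectors permute the cells. Through this a shift of a grid function
  becomes a translation of its step function, to which translation invariance of
  \<open>lborel\<close> applies.\<close>

lemma nearest_add:
  assumes "0 < h" "\<And>i. e $ i \<in> \<int>"
  shows "nearest h (y + h *\<^sub>R e) = nearest h y + h *\<^sub>R e"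
proof (subst vec_eq_iff, rule allI)
  fix i
  obtain k :: int where k: "e $ i = of_int k" using assms(2)[of i] Ints_cases by blast
  have "\<lfloor>(y $ i + h * of_int k) / h + 1 / 2\<rfloor> = \<lfloor>(y $ i / h + 1 / 2) + of_int k\<rfloor>"
    using assms(1) by (intro arg_cong[where f=floor]) (simp add: field_simps)
  then show "nearest h (y + h *\<^sub>R e) $ i = (nearest h y + h *\<^sub>R e) $ i"
    using k by (simp add: nearest_def algebra_simps)
qed

lemma cell_measurable [measurable]: "cell h x \<in> sets borel"
proof -
  have "cell h x = {y \<in> space borel. \<forall>i. x $ i - h / 2 \<le> y $ i \<and> y $ i < x $ i + h / 2}"
    by (simp add: cell_def)
  also have "\<dots> \<in> sets borel" by measurable
  finally show ?thesis .
qed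

text \<open>The half-open cell lies between an open and a closed box of the same volume.\<close>

lemma emeasure_cell:
  assumes "0 < h"
  shows "emeasure lborel (cell h x) = ennreal (h ^ 3)"
proof -
  let ?l = "(\<chi> i. x $ i - h / 2) :: R3" and ?u = "(\<chi> i. x $ i + h / 2) :: R3"
  have le: "\<And>b. b \<in> Basis \<Longrightarrow> ?l \<bullet> b \<le> ?u \<bullet> b"
    using assms by (auto simp: Basis_vec_def inner_axis)
  have prod: "(\<Prod>b\<in>Basis. (?u - ?l) \<bullet> b) = h ^ 3"
  proof -
    have "(\<Prod>b\<in>Basis. (?u - ?l) \<bullet> b) = (\<Prod>b\<in>(Basis :: R3 set). h)"
      by (rule prod.cong) (auto simp: Basis_vec_def inner_axis)
    then show ?thesis by simp
  qed
  have "emeasure lborel (box ?l ?u) \<le> emeasure lborel (cell h x)"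
    by (rule emeasure_mono) (auto simp: cell_def mem_box_cart less_imp_le)
  moreover have "emeasure lborel (cell h x) \<le> emeasure lborel (cbox ?l ?u)"
    by (rule emeasure_mono) (auto simp: cell_def mem_box_cart less_imp_le)
  ultimately show ?thesis
    using emeasure_lborel_box[OF le] emeasure_lborel_cbox[OF le] prod by simp
qed

lemma countable_grid: "countable (grid h)"
proof -
  have "grid h \<subseteq> range (\<lambda>k :: int ^ 3. \<chi> i. h * of_int (k $ i))"
  proof
    fix x assume "x \<in> grid h"
    then have "\<forall>i. \<exists>k::int. x $ i = h * of_int k" by (simp add: grid_def)
    from choice[OF this] obtain k :: "3 \<Rightarrow> int" where "\<And>i. x $ i = h * of_int (k i)" by blast
    then have "x = (\<chi> i. h * of_int ((\<chi> i. k i) $ i))" by (simp add: vec_eq_iff)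
    then show "x \<in> range (\<lambda>k :: int ^ 3. \<chi> i. h * of_int (k $ i))" by blast
  qed
  then show ?thesis by (rule countable_subset) auto
qed

lemma measurable_nearest:
  assumes "0 < h"
  shows "nearest h \<in> borel \<rightarrow>\<^sub>M count_space (grid h)"
proof (subst measurable_count_space_eq_countable[OF countable_grid], intro conjI ballI)
  show "nearest h \<in> space borel \<rightarrow> grid h" using nearest_grid[OF assms] by auto
  fix a assume "a \<in> grid h"
  then have "nearest h -` {a} \<inter> space borel = cell h a"
    using nearest_iff[OF assms, of a] by auto
  then show "nearest h -` {a} \<inter> space borel \<in> sets borel" by simp
qed

text \<open>No regularity of f enters: \<open>nearest h\<close> takes values in a countable set and
  its fibres are Borel cells.\<close>

lemma measurable_comp_nearest:
  "0 < h \<Longrightarrow> (\<lambda>y. f (nearest h y)) \<in> borel_measurable borel"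
  by (rule measurable_compose[OF measurable_nearest]) auto

lemma measurable_nearest_eq:
  "(\<lambda>z. nearest h (fst z) = nearest h (snd z)) \<in> measurable (borel \<Otimes>\<^sub>M borel) (count_space UNIV)"
  if "0 < h"
proof -
  have eq: "(nearest h y = nearest h z) \<longleftrightarrow> (\<exists>a\<in>grid h. y \<in> cell h a \<and> z \<in> cell h a)" for y z
    using nearest_iff[OF that] by metis
  then have "{z \<in> space (borel \<Otimes>\<^sub>M borel). nearest h (fst z) = nearest h (snd z)} = (\<Union>a\<in>grid h. cell h a \<times> cell h a)"
    by (auto simp: space_pair_measure)
  also have "\<dots> \<in> sets (borel \<Otimes>\<^sub>M borel)"
    by (intro sets.countable_UN'' countable_grid) measurable
  finally show ?thesis by (simp add: pred_def)
qed

text \<open>Jensen on each set \<open>A y\<close>, then an exchange of integrals: a point z is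
  counted with the measure of those y whose averaging set contains it, at most c on B and 0
  elsewhere. The points y and z may live in different spaces, which covers space-time averages
  indexed by a point of space.\<close>

lemma averaging_contraction:
  fixes A :: "'a::euclidean_space \<Rightarrow> 'b::euclidean_space set"
  assumes p: "1 \<le> p"
    and A: "(\<lambda>z. snd z \<in> A (fst z)) \<in> measurable (borel \<Otimes>\<^sub>M borel) (count_space UNIV)"
    and m: "\<And>y. emeasure lborel (A y) = ennreal m" "0 < m"
    and dual: "\<And>z. emeasure lborel {y. z \<in> A y} \<le> ennreal c * indicator B z"
    and B[measurable]: "B \<in> sets borel" and c: "0 \<le> c"
    and F: "integrable lborel F"
  shows "(\<integral>\<^sup>+y. ennreal (\<bar>1 / m * (LINT z:A y|lborel. F z)\<bar> powr p) \<partial>lborel)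
    \<le> ennreal (c / m) * (\<integral>\<^sup>+z. indicator B z * ennreal (\<bar>F z\<bar> powr p) \<partial>lborel)"
proof -
  have [measurable]: "F \<in> borel_measurable borel" using F by auto
  have Ay[measurable]: "A y \<in> sets borel" for y
    using measurable_compose[OF measurable_Pair1', OF _ A, of y] by (simp add: pred_def)
  have si: "set_integrable lborel (A y) F" for y
    unfolding set_integrable_def by (intro integrable_mult_indicator F) simp
  have I: "(\<lambda>z. indicator (A (fst z)) (snd z) :: ennreal) \<in> borel_measurable (borel \<Otimes>\<^sub>M borel)"
  proof -
    have "(\<lambda>z. indicator (A (fst z)) (snd z) :: ennreal) = (\<lambda>z. if snd z \<in> A (fst z) then 1 else 0)"
      by (auto simp: indicator_def)
    also have "\<dots> \<in> borel_measurable (borel \<Otimes>\<^sub>M borel)" using A by measurable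
    finally show ?thesis .
  qed
  have I': "(\<lambda>(y, z). indicator (A y) z * ennreal (\<bar>F z\<bar> powr p)) \<in> borel_measurable (lborel \<Otimes>\<^sub>M lborel)"
  proof -
    have "(\<lambda>z. indicator (A (fst z)) (snd z) * ennreal (\<bar>F (snd z)\<bar> powr p)) \<in> borel_measurable (borel \<Otimes>\<^sub>M borel)"
      using I by measurable
    then show ?thesis by (simp add: case_prod_beta' lborel_prod borel_prod)
  qed
  have "(\<integral>\<^sup>+y. ennreal (\<bar>1 / m * (LINT z:A y|lborel. F z)\<bar> powr p) \<partial>lborel)
    \<le> (\<integral>\<^sup>+y. ennreal (1 / m) * (\<integral>\<^sup>+z. indicator (A y) z * ennreal (\<bar>F z\<bar> powr p) \<partial>lborel) \<partial>lborel)"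
    by (intro nn_integral_mono Jensen_powr p m si) auto
  also have "\<dots> = ennreal (1 / m) * (\<integral>\<^sup>+y. (\<integral>\<^sup>+z. indicator (A y) z * ennreal (\<bar>F z\<bar> powr p) \<partial>lborel) \<partial>lborel)"
    using lborel.borel_measurable_nn_integral_fst[OF I'] by (intro nn_integral_cmult) simp
  also have "(\<integral>\<^sup>+y. (\<integral>\<^sup>+z. indicator (A y) z * ennreal (\<bar>F z\<bar> powr p) \<partial>lborel) \<partial>lborel)
      = (\<integral>\<^sup>+z. (\<integral>\<^sup>+y. indicator (A y) z * ennreal (\<bar>F z\<bar> powr p) \<partial>lborel) \<partial>lborel)"
    using lborel_pair.Fubini'[OF I'] by simp
  also have "\<dots> \<le> (\<integral>\<^sup>+z. ennreal c * (indicator B z * ennreal (\<bar>F z\<bar> powr p)) \<partial>lborel)"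
  proof (rule nn_integral_mono)
    fix z
    have S: "{y. z \<in> A y} \<in> sets borel"
      using measurable_compose[OF measurable_Pair2', OF _ A, of z] by (simp add: pred_def)
    have "(\<integral>\<^sup>+y. indicator (A y) z * ennreal (\<bar>F z\<bar> powr p) \<partial>lborel)
        = (\<integral>\<^sup>+y. ennreal (\<bar>F z\<bar> powr p) * indicator {y. z \<in> A y} y \<partial>lborel)"
      by (intro nn_integral_cong) (auto simp: indicator_def)
    also have "\<dots> = ennreal (\<bar>F z\<bar> powr p) * emeasure lborel {y. z \<in> A y}"
      using S by (simp add: nn_integral_cmult_indicator)
    also have "\<dots> \<le> ennreal (\<bar>F z\<bar> powr p) * (ennreal c * indicator B z)"
      by (intro mult_left_mono dual) simp
    finally show "(\<integral>\<^sup>+y. indicator (A y) z * ennreal (\<bar>F z\<bar> powr p) \<partial>lborel)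
        \<le> ennreal c * (indicator B z * ennreal (\<bar>F z\<bar> powr p))"
      by (simp add: mult_ac)
  qed
  also have "\<dots> = ennreal c * (\<integral>\<^sup>+z. indicator B z * ennreal (\<bar>F z\<bar> powr p) \<partial>lborel)"
    by (intro nn_integral_cmult) measurable
  also have "ennreal (1 / m) * (ennreal c * (\<integral>\<^sup>+z. indicator B z * ennreal (\<bar>F z\<bar> powr p) \<partial>lborel))
      = ennreal (c / m) * (\<integral>\<^sup>+z. indicator B z * ennreal (\<bar>F z\<bar> powr p) \<partial>lborel)"
    using m c by (simp add: mult.assoc[symmetric] ennreal_mult[symmetric])
  finally show ?thesis by (simp add: mult_left_mono)
qed

lemma cell_average_contraction:
  assumes "1 \<le> p" "0 < h" "integrable lborel F"
  shows "(\<integral>\<^sup>+y. ennreal (\<bar>1 / h ^ 3 * (LINT z:cell h (nearest h y)|lborel. F z)\<bar> powr p) \<partial>lborel)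
    \<le> (\<integral>\<^sup>+z. ennreal (\<bar>F z\<bar> powr p) \<partial>lborel)"
proof -
  have "(\<integral>\<^sup>+y. ennreal (\<bar>1 / h ^ 3 * (LINT z:cell h (nearest h y)|lborel. F z)\<bar> powr p) \<partial>lborel)
    \<le> ennreal (h ^ 3 / h ^ 3) * (\<integral>\<^sup>+z. indicator UNIV z * ennreal (\<bar>F z\<bar> powr p) \<partial>lborel)"
  proof (rule averaging_contraction)
    show "(\<lambda>z. snd z \<in> cell h (nearest h (fst z))) \<in> measurable (borel \<Otimes>\<^sub>M borel) (count_space UNIV)"
      using measurable_nearest_eq[OF assms(2)] by (simp add: mem_cell_nearest[OF assms(2)] eq_commute)
    have "{y. z \<in> cell h (nearest h y)} = cell h (nearest h z)" for z
      using assms by (auto simp: mem_cell_nearest)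
    then show "emeasure lborel {y. z \<in> cell h (nearest h y)} \<le> ennreal (h ^ 3) * indicator UNIV z" for z
      using assms by (simp add: emeasure_cell)
  qed (use assms in \<open>auto simp: emeasure_cell\<close>)
  then show ?thesis using assms by simp
qed

text \<open>Half-open in time, whereas \<open>u_disc\<close> integrates over the closed interval:
  consecutive slabs become disjoint, at the cost of a null set in the comparison.\<close>

definition time_cell :: "real \<Rightarrow> real \<Rightarrow> nat \<Rightarrow> R3 \<Rightarrow> (real \<times> R3) set" where
  "time_cell h \<tau> n x = {\<tau> * real n..<\<tau> * real (n + 1)} \<times> cell h x"

definition box_avg :: "real \<Rightarrow> real \<Rightarrow> nat \<Rightarrow> (real \<times> R3 \<Rightarrow> real) \<Rightarrow> R3 \<Rightarrow> real" where
  "box_avg h \<tau> n F x = 1 / (\<tau> * h ^ 3) * (LINT z:time_cell h \<tau> n x|lborel. F z)"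

lemma time_cell_measurable [measurable]: "time_cell h \<tau> n x \<in> sets borel"
  unfolding time_cell_def by (simp add: borel_prod[symmetric])

text \<open>Here y ranges over space only. A space-time point is seen from one spatial cell, of
  volume h^3, while the average is over volume \<tau> h^3; the factor \<tau> on the left compensates
  the ratio 1/\<tau>.\<close>

lemma box_avg_contraction:
  assumes p: "1 \<le> p" and h: "0 < h" and \<tau>: "0 < \<tau>" and F: "integrable lborel F"
  shows "ennreal \<tau> * (\<integral>\<^sup>+y. ennreal (\<bar>box_avg h \<tau> n F (nearest h y)\<bar> powr p) \<partial>lborel)
    \<le> (\<integral>\<^sup>+z. indicator ({\<tau> * real n..<\<tau> * real (n + 1)} \<times> UNIV) z * ennreal (\<bar>F z\<bar> powr p) \<partial>lborel)"
    (is "_ \<le> (\<integral>\<^sup>+z. indicator (?J \<times> UNIV) z * _ \<partial>lborel)")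
proof -
  have "(\<integral>\<^sup>+y. ennreal (\<bar>1 / (\<tau> * h ^ 3) * (LINT z:time_cell h \<tau> n (nearest h y)|lborel. F z)\<bar> powr p) \<partial>lborel)
    \<le> ennreal (h ^ 3 / (\<tau> * h ^ 3)) * (\<integral>\<^sup>+z. indicator (?J \<times> UNIV) z * ennreal (\<bar>F z\<bar> powr p) \<partial>lborel)"
  proof (rule averaging_contraction)
    have "(\<lambda>z. fst (snd z) \<in> ?J \<and> nearest h (fst z) = nearest h (snd (snd z)))
        \<in> measurable ((borel :: R3 measure) \<Otimes>\<^sub>M (borel \<Otimes>\<^sub>M borel)) (count_space UNIV)"
    proof (rule pred_intros_logic)
      have "(\<lambda>z. (fst z, snd (snd z))) \<in> (borel :: R3 measure) \<Otimes>\<^sub>M ((borel :: real measure) \<Otimes>\<^sub>M borel) \<rightarrow>\<^sub>M borel \<Otimes>\<^sub>M (borel :: R3 measure)"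
        by measurable
      from measurable_compose[OF this measurable_nearest_eq[OF h]]
      show "(\<lambda>z. nearest h (fst z) = nearest h (snd (snd z)))
          \<in> measurable (borel \<Otimes>\<^sub>M ((borel :: real measure) \<Otimes>\<^sub>M borel)) (count_space UNIV)"
        by simp
      show "(\<lambda>z. fst (snd z) \<in> ?J) \<in> measurable ((borel :: R3 measure) \<Otimes>\<^sub>M (borel \<Otimes>\<^sub>M (borel :: R3 measure))) (count_space UNIV)"
        by measurable
    qed
    moreover have "(snd z \<in> time_cell h \<tau> n (nearest h (fst z)))
        \<longleftrightarrow> fst (snd z) \<in> ?J \<and> nearest h (fst z) = nearest h (snd (snd z))" for z
      using mem_cell_nearest[OF h] by (cases z) (auto simp: time_cell_def)
    ultimately show "(\<lambda>z. snd z \<in> time_cell h \<tau> n (nearest h (fst z))) \<in> measurable (borel \<Otimes>\<^sub>M borel) (count_space UNIV)"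
      by (simp only: borel_prod)
    show "emeasure lborel (time_cell h \<tau> n (nearest h y)) = ennreal (\<tau> * h ^ 3)" for y
    proof -
      have "emeasure lborel (time_cell h \<tau> n (nearest h y)) = emeasure lborel ?J * emeasure lborel (cell h (nearest h y))"
        unfolding time_cell_def lborel_prod[symmetric] by (rule lborel.emeasure_pair_measure_Times) auto
      then show ?thesis using \<tau> h by (simp add: emeasure_cell ennreal_mult[symmetric] algebra_simps)
    qed
    show "emeasure lborel {y. z \<in> time_cell h \<tau> n (nearest h y)} \<le> ennreal (h ^ 3) * indicator (?J \<times> UNIV) z" for z
    proof (cases "fst z \<in> ?J")
      case True
      then have "{y. z \<in> time_cell h \<tau> n (nearest h y)} = cell h (nearest h (snd z))"
        using h by (cases z) (auto simp: time_cell_def mem_cell_nearest)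
      then show ?thesis using True h by (cases z) (simp add: emeasure_cell)
    next
      case False
      then have "{y. z \<in> time_cell h \<tau> n (nearest h y)} = {}"
        by (cases z) (auto simp: time_cell_def)
      then show ?thesis by simp
    qed
    show "?J \<times> (UNIV :: R3 set) \<in> sets borel" by (simp add: borel_prod[symmetric])
  qed (use p h \<tau> F in auto)
  then have "ennreal \<tau> * (\<integral>\<^sup>+y. ennreal (\<bar>box_avg h \<tau> n F (nearest h y)\<bar> powr p) \<partial>lborel)
    \<le> ennreal \<tau> * (ennreal (h ^ 3 / (\<tau> * h ^ 3)) * (\<integral>\<^sup>+z. indicator (?J \<times> UNIV) z * ennreal (\<bar>F z\<bar> powr p) \<partial>lborel))"
    unfolding box_avg_def by (rule mult_left_mono) simp
  then show ?thesis using h \<tau> by (simp add: mult.assoc[symmetric] ennreal_mult[symmetric])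
qed

text \<open>The slabs of the time steps are disjoint, so their contributions add up to at most the
  integral over all of space-time.\<close>

lemma sum_box_avg_contraction:
  assumes p: "1 \<le> p" and h: "0 < h" and \<tau>: "0 < \<tau>" and F: "integrable lborel F"
  shows "(\<Sum>n<N. ennreal \<tau> * (\<integral>\<^sup>+y. ennreal (\<bar>box_avg h \<tau> n F (nearest h y)\<bar> powr p) \<partial>lborel))
    \<le> (\<integral>\<^sup>+z. ennreal (\<bar>F z\<bar> powr p) \<partial>lborel)"
proof -
  let ?J = "\<lambda>n. {\<tau> * real n..<\<tau> * real (n + 1)}"
  have [measurable]: "F \<in> borel_measurable borel" using F by auto
  have Jm[measurable]: "?J n \<times> (UNIV :: R3 set) \<in> sets borel" for n by (simp add: borel_prod[symmetric])
  have "(\<Sum>n<N. ennreal \<tau> * (\<integral>\<^sup>+y. ennreal (\<bar>box_avg h \<tau> n F (nearest h y)\<bar> powr p) \<partial>lborel))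
    \<le> (\<Sum>n<N. (\<integral>\<^sup>+z. indicator (?J n \<times> UNIV) z * ennreal (\<bar>F z\<bar> powr p) \<partial>lborel))"
    by (intro sum_mono box_avg_contraction assms)
  also have "\<dots> = (\<integral>\<^sup>+z. (\<Sum>n<N. indicator (?J n \<times> UNIV) z * ennreal (\<bar>F z\<bar> powr p)) \<partial>lborel)"
    by (rule nn_integral_sum[symmetric]) measurable
  also have "\<dots> \<le> (\<integral>\<^sup>+z. ennreal (\<bar>F z\<bar> powr p) \<partial>lborel)"
  proof (rule nn_integral_mono)
    fix z :: "real \<times> R3"
    have J: "fst z \<in> ?J n \<Longrightarrow> n = nat \<lfloor>fst z / \<tau>\<rfloor>" for n
    proof -
      assume "fst z \<in> ?J n"
      then have "\<lfloor>fst z / \<tau>\<rfloor> = int n" using \<tau> unfolding floor_eq_iff by (auto simp: field_simps)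
      then show ?thesis by simp
    qed
    have "(\<Sum>n<N. indicator (?J n \<times> UNIV) z * ennreal (\<bar>F z\<bar> powr p))
        \<le> (\<Sum>n<N. if n = nat \<lfloor>fst z / \<tau>\<rfloor> then ennreal (\<bar>F z\<bar> powr p) else 0)"
    proof (rule sum_mono)
      fix n
      show "indicator (?J n \<times> UNIV) z * ennreal (\<bar>F z\<bar> powr p)
          \<le> (if n = nat \<lfloor>fst z / \<tau>\<rfloor> then ennreal (\<bar>F z\<bar> powr p) else 0)"
      proof (cases "fst z \<in> ?J n")
        case True
        from J[OF this] show ?thesis by (simp add: indicator_def)
      qed (simp add: indicator_def mem_Times_iff)
    qed
    also have "\<dots> \<le> ennreal (\<bar>F z\<bar> powr p)" by (simp add: sum.delta)
    finally show "(\<Sum>n<N. indicator (?J n \<times> UNIV) z * ennreal (\<bar>F z\<bar> powr p)) \<le> ennreal (\<bar>F z\<bar> powr p)" .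
  qed
  finally show ?thesis .
qed


section \<open>Averages commute with spatial differences\<close>

lemma integral_lborel_shift:
  fixes c :: "'a::euclidean_space" and f :: "'a \<Rightarrow> real"
  assumes [measurable]: "f \<in> borel_measurable borel"
  shows "(\<integral>x. f (x + c) \<partial>lborel) = (\<integral>x. f x \<partial>lborel)"
    and "integrable lborel f \<Longrightarrow> integrable lborel (\<lambda>x. f (x + c))"
proof -
  have "(\<integral>x. f x \<partial>lborel) = (\<integral>x. f x \<partial>distr lborel borel ((+) c))"
    by (simp add: lborel_distr_plus)
  also have "\<dots> = (\<integral>x. f (x + c) \<partial>lborel)"
    by (subst integral_distr) (auto simp: add.commute)
  finally show "(\<integral>x. f (x + c) \<partial>lborel) = (\<integral>x. f x \<partial>lborel)" by simp
  assume "integrable lborel f"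
  then have "integrable (distr lborel borel ((+) c)) f" by (simp add: lborel_distr_plus)
  then show "integrable lborel (\<lambda>x. f (x + c))"
    by (subst (asm) integrable_distr_eq) (auto simp: add.commute)
qed

lemma integrable_stdiff:
  assumes "integrable lborel F"
  shows "integrable lborel (stdiff h j F)"
proof -
  have [measurable]: "F \<in> borel_measurable borel" using assms by auto
  show ?thesis
    unfolding stdiff_def[abs_def]
    by (intro integrable_divide Bochner_Integration.integrable_diff integral_lborel_shift(2) assms) auto
qed

lemma mem_cell_add: "y + a \<in> cell h (x + a) \<longleftrightarrow> y \<in> cell h x"
  by (auto simp: cell_def algebra_simps)

lemma box_avg_add:
  assumes F: "integrable lborel F"
  shows "box_avg h \<tau> n F (x + a) = box_avg h \<tau> n (\<lambda>z. F (z + (0, a))) x"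
proof -
  have [measurable]: "F \<in> borel_measurable borel" using F by auto
  have "(LINT z:time_cell h \<tau> n (x + a)|lborel. F z)
      = (\<integral>z. indicator (time_cell h \<tau> n (x + a)) (z + (0, a)) *\<^sub>R F (z + (0, a)) \<partial>lborel)"
    unfolding set_lebesgue_integral_def by (rule integral_lborel_shift(1)[symmetric]) measurable
  also have "\<dots> = (LINT z:time_cell h \<tau> n x|lborel. F (z + (0, a)))"
    unfolding set_lebesgue_integral_def
  proof (rule Bochner_Integration.integral_cong)
    fix z :: "real \<times> R3"
    have "z + (0, a) \<in> time_cell h \<tau> n (x + a) \<longleftrightarrow> z \<in> time_cell h \<tau> n x"
      by (cases z) (simp add: time_cell_def mem_cell_add)
    then show "indicator (time_cell h \<tau> n (x + a)) (z + (0, a)) *\<^sub>R F (z + (0, a)) = indicator (time_cell h \<tau> n x) z *\<^sub>R F (z + (0, a))"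
      by (simp add: indicator_def)
  qed simp
  finally show ?thesis by (simp add: box_avg_def)
qed

lemma set_integrable_time_cell:
  fixes F :: "real \<times> R3 \<Rightarrow> real"
  assumes "integrable lborel F"
  shows "set_integrable lborel (time_cell h \<tau> n x) F"
  unfolding set_integrable_def by (rule integrable_mult_indicator[OF _ assms]) simp

text \<open>Averaging commutes with translations in space, hence with difference quotients. The
  discrete divergence of the averaged velocity is thus itself an average, and the contraction lemmas
  reduce it to quotients of \<open>V\<close>.\<close>

lemma cdiff_box_avg:
  assumes F: "integrable lborel F"
  shows "cdiff h j (box_avg h \<tau> n F) x = box_avg h \<tau> n (stdiff h j F) x"
proof -
  have [measurable]: "F \<in> borel_measurable borel" using F by auto
  let ?a = "h *\<^sub>R axis j 1 :: R3"
  have i: "integrable lborel (\<lambda>z. F (z + (0, b)))" for b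
    by (rule integral_lborel_shift(2)[OF _ F]) simp
  let ?P = "\<lambda>z. F (z + (0, ?a))" and ?M = "\<lambda>z. F (z + (0, - ?a))"
  have "(LINT z:time_cell h \<tau> n x|lborel. stdiff h j F z)
      = (LINT z:time_cell h \<tau> n x|lborel. (?P z - ?M z) / (2 * h))"
    by (simp add: stdiff_def)
  also have "\<dots> = (LINT z:time_cell h \<tau> n x|lborel. ?P z - ?M z) / (2 * h)"
    by (rule set_integral_divide_zero)
  also have "(LINT z:time_cell h \<tau> n x|lborel. ?P z - ?M z)
      = (LINT z:time_cell h \<tau> n x|lborel. ?P z) - (LINT z:time_cell h \<tau> n x|lborel. ?M z)"
    by (intro set_integral_diff set_integrable_time_cell i)
  finally have "box_avg h \<tau> n (stdiff h j F) x = (box_avg h \<tau> n ?P x - box_avg h \<tau> n ?M x) / (2 * h)"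
    by (simp add: box_avg_def diff_divide_distrib mult.commute mult.left_commute)
  also have "\<dots> = cdiff h j (box_avg h \<tau> n F) x"
    unfolding box_avg_add[OF F, symmetric] cdiff_def by simp
  finally show ?thesis by simp
qed

lemma sum_box_avg:
  assumes "\<And>j. j \<in> J \<Longrightarrow> integrable lborel (F j)"
  shows "(\<Sum>j\<in>J. box_avg h \<tau> n (F j) x) = box_avg h \<tau> n (\<lambda>z. \<Sum>j\<in>J. F j z) x"
proof -
  have "(LINT z:time_cell h \<tau> n x|lborel. (\<Sum>j\<in>J. F j z)) = (\<Sum>j\<in>J. (LINT z:time_cell h \<tau> n x|lborel. F j z))"
    unfolding set_lebesgue_integral_def scaleR_sum_right
    by (rule Bochner_Integration.integral_sum) (rule set_integrable_time_cell[OF assms, unfolded set_integrable_def])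
  then show ?thesis by (simp add: box_avg_def sum_distrib_left)
qed

lemma num_steps_time_le:
  assumes "0 < \<tau>" "0 \<le> T" "n \<le> num_steps T \<tau>"
  shows "\<tau> * real n \<le> T"
proof -
  have "\<tau> * real n \<le> \<tau> * real (num_steps T \<tau>)" using assms by simp
  also have "\<dots> \<le> T" using num_steps_iff[of \<tau> T "num_steps T \<tau>"] assms by simp
  finally show ?thesis .
qed

lemma u_disc_eq_box_avg:
  assumes \<tau>: "0 < \<tau>" and T: "0 \<le> T" and n: "n < num_steps T \<tau>"
    and V: "integrable lborel (V j)"
    and Veq: "AE t in lborel. t \<in> {0..T} \<longrightarrow> (\<forall>j. AE x in lborel. ext0 \<Omega> (\<lambda>x. v t x $ j) x = V j (t, x))"
  shows "u_disc h \<tau> \<Omega> v n j x = box_avg h \<tau> n (V j) x"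
proof -
  let ?C = "{\<tau> * real n..\<tau> * real (n + 1)}" and ?J = "{\<tau> * real n..<\<tau> * real (n + 1)}"
  have [measurable]: "V j \<in> borel_measurable borel" using V by auto
  let ?H = "\<lambda>z. indicator (time_cell h \<tau> n x) z * V j z"
  have Hi: "integrable (lborel \<Otimes>\<^sub>M lborel) ?H"
    unfolding lborel_prod using integrable_mult_indicator[of "time_cell h \<tau> n x" lborel "V j"] V by simp
  \<comment> \<open>Since n + 1 is at most the number of steps, the closed time interval stays
    inside [0,T], where V represents v.\<close>
  have sub: "?C \<subseteq> {0..T}"
    using num_steps_time_le[of \<tau> T "n + 1"] \<tau> T n by (auto intro: order_trans[of _ "\<tau> * real n"])
  have "(LINT s:?C|lebesgue. (LINT y:cell h x|lebesgue. ext0 \<Omega> (v s) y $ j))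
      = (\<integral>s. (\<integral>y. ?H (s, y) \<partial>lborel) \<partial>lborel)"
  proof (rule set_lebesgue_integral_borel_version)
    show "(\<lambda>s. \<integral>y. ?H (s, y) \<partial>lborel) \<in> borel_measurable borel"
      using lborel.borel_measurable_lebesgue_integral[of "\<lambda>s y. ?H (s, y)" lborel] Hi
      by (simp add: case_prod_beta' borel_measurable_integrable)
    show "AE s in lborel. indicator ?C s * (LINT y:cell h x|lebesgue. ext0 \<Omega> (v s) y $ j) = (\<integral>y. ?H (s, y) \<partial>lborel)"
      \<comment> \<open>The right endpoint, present in \<open>u_disc\<close> but not in
        \<open>time_cell\<close>, is discarded as a null set.\<close>
      using Veq AE_lborel_singleton[of "\<tau> * real (n + 1)"]
    proof eventually_elim
      case (elim s)
      show ?case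
      proof (cases "s \<in> ?C")
        case False
        then have "(s, y) \<notin> time_cell h \<tau> n x" for y
          by (auto simp: time_cell_def)
        then show ?thesis using False by simp
      next
        case True
        then have "s \<in> ?J" using elim by auto
        have eq: "AE y in lborel. ext0 \<Omega> (\<lambda>x. v s x $ j) y = V j (s, y)"
          using elim sub True by blast
        from eq have "AE y in lborel. indicator (cell h x) y * (ext0 \<Omega> (v s) y $ j) = ?H (s, y)"
          by eventually_elim (use \<open>s \<in> ?J\<close> in \<open>auto simp: ext0_def time_cell_def indicator_def split: if_splits\<close>)
        then have "(LINT y:cell h x|lebesgue. ext0 \<Omega> (v s) y $ j) = (\<integral>y. ?H (s, y) \<partial>lborel)"
          by (rule set_lebesgue_integral_borel_version[rotated]) (rule measurable_section, measurable)
        then show ?thesis using True by simp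
      qed
    qed
  qed
  also have "\<dots> = (\<integral>z. ?H z \<partial>lborel)"
    using lborel_pair.integral_fst[of "\<lambda>s y. ?H (s, y)"] Hi by (simp add: case_prod_beta' lborel_prod)
  finally show ?thesis
    by (simp add: u_disc_def box_avg_def set_lebesgue_integral_def)
qed

definition truncate :: "real \<Rightarrow> real \<Rightarrow> real" where
  "truncate M a = (if \<bar>a\<bar> \<le> M then a else sgn a * M)"

lemma abs_truncate_le: "0 < M \<Longrightarrow> \<bar>truncate M a\<bar> \<le> M"
  by (auto simp: truncate_def abs_mult sgn_if)

text \<open>The error of the truncation is itself 1-Lipschitz and vanishes on [-M, M]. Unless both
  arguments lie there, one of them exceeds M in modulus, so (|a| + |b|) / M is at least 1.\<close>

lemma truncate_minus_id_diff_le: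
  assumes M: "0 < M"
  shows "\<bar>(truncate M a - a) - (truncate M b - b)\<bar> \<le> \<bar>a - b\<bar> * (\<bar>a\<bar> + \<bar>b\<bar>) / M"
proof (cases "\<bar>a\<bar> \<le> M \<and> \<bar>b\<bar> \<le> M")
  case True
  then show ?thesis using M by (simp add: truncate_def)
next
  case False
  have "\<bar>(truncate M a - a) - (truncate M b - b)\<bar> \<le> \<bar>a - b\<bar>"
    using M by (auto simp: truncate_def sgn_if abs_if split: if_splits)
  also have "\<dots> * 1 \<le> \<bar>a - b\<bar> * ((\<bar>a\<bar> + \<bar>b\<bar>) / M)"
    using False M by (intro mult_left_mono) (auto simp: field_simps)
  finally show ?thesis by simp
qed

section \<open>The truncated scheme\<close>

text \<open>Since \<open>stencil\<close> is a set, its seven vectors must be shown to be distinct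
  before the sum splits by direction.\<close>

lemma sum_stencil:
  fixes F :: "R3 \<Rightarrow> 'a::comm_monoid_add"
  shows "(\<Sum>\<omega>\<in>stencil. F \<omega>) = F 0 + (\<Sum>j\<in>UNIV. F (axis j 1) + F (- axis j 1))"
proof -
  let ?P = "range (\<lambda>i. axis i 1 :: R3)" and ?N = "range (\<lambda>i. - axis i 1 :: R3)"
  have ax: "axis i (1::real) \<noteq> - axis j 1" for i j :: 3
  proof
    assume "axis i (1::real) = - axis j 1"
    from arg_cong[OF this, of "\<lambda>z. z $ i"] show False by (auto simp: axis_def split: if_splits)
  qed
  have inj: "inj (\<lambda>i::3. axis i (1::real))" by (auto simp: inj_def axis_eq_axis)
  have inj': "inj (\<lambda>i::3. - axis i (1::real))" by (auto simp: inj_def axis_eq_axis)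
  have eq: "stencil = insert 0 (?P \<union> ?N)" by (auto simp: stencil_def)
  have fin: "finite (?P \<union> ?N)" by simp
  have nz: "0 \<notin> ?P \<union> ?N"
  proof
    have ne: "axis i (1::real) \<noteq> 0" for i :: 3 by (simp add: axis_eq_0_iff)
    assume "0 \<in> ?P \<union> ?N"
    then show False using ne by (metis (no_types, lifting) Un_iff imageE neg_0_equal_iff_equal)
  qed
  have "(\<Sum>\<omega>\<in>stencil. F \<omega>) = F 0 + (\<Sum>\<omega>\<in>?P \<union> ?N. F \<omega>)"
    unfolding eq by (rule sum.insert[OF fin nz])
  also have "(\<Sum>\<omega>\<in>?P \<union> ?N. F \<omega>) = (\<Sum>\<omega>\<in>?P. F \<omega>) + (\<Sum>\<omega>\<in>?N. F \<omega>)"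
    using ax by (intro sum.union_disjoint) auto
  also have "\<dots> = (\<Sum>j\<in>UNIV. F (axis j 1) + F (- axis j 1))"
    by (simp add: sum.reindex[OF inj] sum.reindex[OF inj'] sum.distrib)
  finally show ?thesis .
qed

lemma finite_stencil: "finite stencil"
  by (simp add: stencil_def)

lemma stencil_Ints: "\<omega> \<in> stencil \<Longrightarrow> \<omega> $ i \<in> \<int>"
  by (auto simp: stencil_def axis_def)

lemma grid_add_stencil:
  assumes "x \<in> grid h" "\<omega> \<in> stencil" shows "x + h *\<^sub>R \<omega> \<in> grid h"
  unfolding grid_def
proof (intro CollectI allI)
  fix i
  obtain k l :: int where "x $ i = h * of_int k" "\<omega> $ i = of_int l"
    using assms(1) stencil_Ints[OF assms(2), of i] unfolding grid_def Ints_def by blast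
  then have "(x + h *\<^sub>R \<omega>) $ i = h * of_int (k + l)" by (simp add: algebra_simps)
  then show "\<exists>k::int. (x + h *\<^sub>R \<omega>) $ i = h * of_int k" by blast
qed

text \<open>The coefficient of g(x + h \<omega>) once the scheme is solved for the new value.
  Pairing b with \<omega> selects component and sign, which treats the centre and the six neighbours
  uniformly.\<close>

definition weight :: "real \<Rightarrow> real \<Rightarrow> (3 \<Rightarrow> R3 \<Rightarrow> real) \<Rightarrow> R3 \<Rightarrow> R3 \<Rightarrow> real" where
  "weight h \<tau> b x \<omega> = 1 / 7 - \<tau> / (2 * h) * (\<Sum>j\<in>UNIV. b j x * \<omega> $ j)"

lemma weight_simps [simp]:
  "weight h \<tau> b x 0 = 1 / 7"
  "weight h \<tau> b x (axis j 1) = 1 / 7 - \<tau> / (2 * h) * b j x"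
  "weight h \<tau> b x (- axis j 1) = 1 / 7 + \<tau> / (2 * h) * b j x"
proof -
  have "(\<Sum>i\<in>UNIV. b i x * axis j 1 $ i) = (\<Sum>i\<in>UNIV. if i = j then b i x else 0)"
    by (rule sum.cong) (auto simp: axis_def)
  then have s: "(\<Sum>i\<in>UNIV. b i x * axis j 1 $ i) = b j x" by simp
  show "weight h \<tau> b x (axis j 1) = 1 / 7 - \<tau> / (2 * h) * b j x"
    "weight h \<tau> b x (- axis j 1) = 1 / 7 + \<tau> / (2 * h) * b j x"
    by (simp_all add: weight_def s sum_negf)
qed (simp add: weight_def)

lemma sum_weight: "(\<Sum>\<omega>\<in>stencil. weight h \<tau> b x \<omega>) = 1"
  by (simp add: sum_stencil)

text \<open>These are the weights with which the old value at x enters the new values around it. The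
  two contributions in direction j use b_j at x - h e^j and at x + h e^j with opposite signs, which
  leaves \<tau> times a difference quotient of b_j.\<close>

lemma sum_weight_adjoint:
  assumes "0 < h"
  shows "(\<Sum>\<omega>\<in>stencil. weight h \<tau> b (x - h *\<^sub>R \<omega>) \<omega>) = 1 + \<tau> * (\<Sum>j\<in>UNIV. cdiff h j (b j) x)"
proof -
  have "weight h \<tau> b (x - h *\<^sub>R axis j 1) (axis j 1) + weight h \<tau> b (x - h *\<^sub>R - axis j 1) (- axis j 1)
      = 2 / 7 + \<tau> * cdiff h j (b j) x" for j
    using assms by (simp add: cdiff_def field_simps)
  then have "(\<Sum>\<omega>\<in>stencil. weight h \<tau> b (x - h *\<^sub>R \<omega>) \<omega>)
      = 1 / 7 + (\<Sum>j\<in>(UNIV :: 3 set). 2 / 7 + \<tau> * cdiff h j (b j) x)"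
    unfolding sum_stencil by (simp only: weight_simps)
  also have "\<dots> = 1 + \<tau> * (\<Sum>j\<in>UNIV. cdiff h j (b j) x)"
    by (simp add: sum.distrib sum_distrib_left)
  finally show ?thesis .
qed

text \<open>One time step with a generic coefficient field; \<open>M\<close> will be the truncation
  level. The condition \<open>CFL\<close> keeps the weights 1/7 +- \<tau> b_j / (2h)
  nonnegative.\<close>

locale explicit_step =
  fixes h \<tau> M :: real and b :: "3 \<Rightarrow> R3 \<Rightarrow> real" and g g' :: "R3 \<Rightarrow> real"
  assumes h: "0 < h" and \<tau>: "0 < \<tau>" and CFL: "\<tau> * M / (2 * h) \<le> 1 / 7"
    and b_le: "\<And>j x. \<bar>b j x\<bar> \<le> M"
    and step: "\<And>x. x \<in> grid h \<Longrightarrow>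
      (g' x - 1 / 7 * (\<Sum>\<omega>\<in>stencil. g (x + h *\<^sub>R \<omega>))) * (1 / \<tau>) + (\<Sum>j\<in>UNIV. b j x * cdiff h j g x) = 0"
begin

lemma weight_nonneg:
  assumes "\<omega> \<in> stencil" shows "0 \<le> weight h \<tau> b x \<omega>"
proof -
  have "\<bar>\<tau> / (2 * h) * b j x\<bar> \<le> 1 / 7" for j
  proof -
    have "\<bar>\<tau> / (2 * h) * b j x\<bar> = \<tau> / (2 * h) * \<bar>b j x\<bar>"
      using h \<tau> by (simp add: abs_mult)
    also have "\<dots> \<le> \<tau> / (2 * h) * M"
      using h \<tau> by (intro mult_left_mono b_le) simp
    also have "\<dots> \<le> 1 / 7" using CFL by simp
    finally show ?thesis .
  qed
  then have "- (1 / 7) \<le> \<tau> / (2 * h) * b j x \<and> \<tau> / (2 * h) * b j x \<le> 1 / 7" for j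
    using abs_le_iff minus_le_iff by blast
  then have "0 \<le> 1 / 7 + \<tau> / (2 * h) * b j x" "0 \<le> 1 / 7 - \<tau> / (2 * h) * b j x" for j
    using add_mono[of "1 / 7" "1 / 7" "- (1 / 7)" "\<tau> / (2 * h) * b j x"] diff_ge_0_iff_ge by auto
  then show ?thesis
    using assms unfolding stencil_def by (auto simp del: times_divide_eq_left)
qed

lemma step_eq:
  assumes "x \<in> grid h"
  shows "g' x = (\<Sum>\<omega>\<in>stencil. weight h \<tau> b x \<omega> * g (x + h *\<^sub>R \<omega>))"
proof -
  have "g' x = 1 / 7 * (\<Sum>\<omega>\<in>stencil. g (x + h *\<^sub>R \<omega>)) - \<tau> * (\<Sum>j\<in>UNIV. b j x * cdiff h j g x)"
    using step[OF assms] \<tau> by (simp add: field_simps)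
  also have "\<dots> = (\<Sum>\<omega>\<in>stencil. weight h \<tau> b x \<omega> * g (x + h *\<^sub>R \<omega>))"
  proof -
    have "weight h \<tau> b x (axis j 1) * g (x + h *\<^sub>R axis j 1) + weight h \<tau> b x (- axis j 1) * g (x + h *\<^sub>R - axis j 1)
        = 1 / 7 * (g (x + h *\<^sub>R axis j 1) + g (x + h *\<^sub>R - axis j 1)) - \<tau> * (b j x * cdiff h j g x)" for j
      using h by (simp add: cdiff_def field_simps)
    then show ?thesis
      unfolding sum_stencil by (simp only: weight_simps sum_subtractf sum_distrib_left[symmetric]) (simp add: distrib_left)
  qed
  finally show ?thesis .
qed

lemma step_bound:
  assumes "\<And>x. x \<in> grid h \<Longrightarrow> \<bar>g x\<bar> \<le> B" and x: "x \<in> grid h"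
  shows "\<bar>g' x\<bar> \<le> B"
proof -
  have "\<bar>g' x\<bar> \<le> (\<Sum>\<omega>\<in>stencil. \<bar>weight h \<tau> b x \<omega> * g (x + h *\<^sub>R \<omega>)\<bar>)"
    unfolding step_eq[OF x] by (rule sum_abs)
  also have "\<dots> \<le> (\<Sum>\<omega>\<in>stencil. weight h \<tau> b x \<omega> * B)"
    using assms weight_nonneg grid_add_stencil[OF x] by (intro sum_mono) (auto simp: abs_mult mult_left_mono)
  also have "\<dots> = B" by (simp add: sum_weight flip: sum_distrib_right)
  finally show ?thesis .
qed

lemma step_powr_le:
  assumes p: "1 \<le> p" and x: "x \<in> grid h"
  shows "\<bar>g' x\<bar> powr p \<le> (\<Sum>\<omega>\<in>stencil. weight h \<tau> b x \<omega> * \<bar>g (x + h *\<^sub>R \<omega>)\<bar> powr p)"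
  unfolding step_eq[OF x]
  using convex_on_sum[OF finite_stencil _ convex_on_abs_powr[OF p], of "weight h \<tau> b x" "\<lambda>\<omega>. g (x + h *\<^sub>R \<omega>)"]
    weight_nonneg sum_weight by (force simp: stencil_def)

text \<open>Testing the scheme with the adjoint weights moves the difference operator onto the
  truncated velocity, so only its discrete divergence contributes to the growth.\<close>

lemma step_Lp:
  assumes p: "1 \<le> p" and B: "\<And>x. x \<in> grid h \<Longrightarrow> \<bar>g x\<bar> \<le> B"
  shows "(\<integral>\<^sup>+y. ennreal (\<bar>g' (nearest h y)\<bar> powr p) \<partial>lborel)
    \<le> (\<integral>\<^sup>+y. ennreal (\<bar>g (nearest h y)\<bar> powr p) \<partial>lborel)
      + ennreal (B powr p) * (ennreal \<tau> * (\<integral>\<^sup>+y. ennreal \<bar>\<Sum>j\<in>UNIV. cdiff h j (b j) (nearest h y)\<bar> \<partial>lborel))"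
proof -
  let ?N = "nearest h" and ?d = "\<lambda>x. \<Sum>j\<in>UNIV. cdiff h j (b j) x"
  have [measurable]: "(\<lambda>y. F (?N y)) \<in> borel_measurable borel" for F :: "R3 \<Rightarrow> real"
    by (rule measurable_comp_nearest[OF h])
  have Nm: "(\<lambda>y. F (?N y)) \<in> borel_measurable borel" for F :: "R3 \<Rightarrow> ennreal"
    by (rule measurable_comp_nearest[OF h])
  have gN: "?N y \<in> grid h" for y by (rule nearest_grid[OF h])
  have "(\<integral>\<^sup>+y. ennreal (\<bar>g' (?N y)\<bar> powr p) \<partial>lborel)
      \<le> (\<integral>\<^sup>+y. (\<Sum>\<omega>\<in>stencil. ennreal (weight h \<tau> b (?N y) \<omega> * \<bar>g (?N y + h *\<^sub>R \<omega>)\<bar> powr p)) \<partial>lborel)"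
    using weight_nonneg by (intro nn_integral_mono, subst sum_ennreal) (auto intro!: ennreal_leI step_powr_le p gN)
  also have "\<dots> = (\<Sum>\<omega>\<in>stencil. \<integral>\<^sup>+y. ennreal (weight h \<tau> b (?N y) \<omega> * \<bar>g (?N y + h *\<^sub>R \<omega>)\<bar> powr p) \<partial>lborel)"
    by (rule nn_integral_sum) (use Nm in simp)
  \<comment> \<open>Translation by h \<omega> brings every term back to the value of g at one and
    the same grid point; the shift now sits in the weight.\<close>
  also have "\<dots> = (\<Sum>\<omega>\<in>stencil. \<integral>\<^sup>+y. ennreal (weight h \<tau> b (?N y - h *\<^sub>R \<omega>) \<omega> * \<bar>g (?N y)\<bar> powr p) \<partial>lborel)"
  proof (rule sum.cong[OF refl])
    fix \<omega> assume \<omega>: "\<omega> \<in> stencil"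
    have N: "?N (y + h *\<^sub>R \<omega>) = ?N y + h *\<^sub>R \<omega>" for y
      by (rule nearest_add[OF h stencil_Ints[OF \<omega>]])
    show "(\<integral>\<^sup>+y. ennreal (weight h \<tau> b (?N y) \<omega> * \<bar>g (?N y + h *\<^sub>R \<omega>)\<bar> powr p) \<partial>lborel)
        = (\<integral>\<^sup>+y. ennreal (weight h \<tau> b (?N y - h *\<^sub>R \<omega>) \<omega> * \<bar>g (?N y)\<bar> powr p) \<partial>lborel)"
      using nn_integral_lborel_shift[OF Nm[of "\<lambda>x. ennreal (weight h \<tau> b (x - h *\<^sub>R \<omega>) \<omega> * \<bar>g x\<bar> powr p)"], of "h *\<^sub>R \<omega>"]
      by (simp add: N)
  qed
  also have "\<dots> = (\<integral>\<^sup>+y. (\<Sum>\<omega>\<in>stencil. ennreal (weight h \<tau> b (?N y - h *\<^sub>R \<omega>) \<omega> * \<bar>g (?N y)\<bar> powr p)) \<partial>lborel)"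
    by (rule nn_integral_sum[symmetric]) (use Nm in simp)
  also have "\<dots> \<le> (\<integral>\<^sup>+y. ennreal (\<bar>g (?N y)\<bar> powr p) + ennreal (B powr p) * (ennreal \<tau> * ennreal \<bar>?d (?N y)\<bar>) \<partial>lborel)"
  proof (rule nn_integral_mono)
    fix y
    let ?x = "?N y"
    have "(\<Sum>\<omega>\<in>stencil. ennreal (weight h \<tau> b (?x - h *\<^sub>R \<omega>) \<omega> * \<bar>g ?x\<bar> powr p))
        = ennreal ((1 + \<tau> * ?d ?x) * \<bar>g ?x\<bar> powr p)"
      using weight_nonneg by (subst sum_ennreal) (auto simp: sum_weight_adjoint[OF h] simp flip: sum_distrib_right)
    also have "\<dots> \<le> ennreal (\<bar>g ?x\<bar> powr p + B powr p * (\<tau> * \<bar>?d ?x\<bar>))"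
    proof (rule ennreal_leI)
      \<comment> \<open>Bounding |g|^p by its maximum decouples it from the divergence, of which
        only the L^1 norm then enters.\<close>
      have "\<tau> * ?d ?x * \<bar>g ?x\<bar> powr p \<le> \<tau> * \<bar>?d ?x\<bar> * B powr p"
      proof (rule mult_mono)
        show "\<tau> * ?d ?x \<le> \<tau> * \<bar>?d ?x\<bar>" using \<tau> by (intro mult_left_mono) auto
        show "\<bar>g ?x\<bar> powr p \<le> B powr p" using B[OF gN, of y] p by (intro powr_mono2) auto
      qed (use \<tau> in auto)
      then show "(1 + \<tau> * ?d ?x) * \<bar>g ?x\<bar> powr p \<le> \<bar>g ?x\<bar> powr p + B powr p * (\<tau> * \<bar>?d ?x\<bar>)"
        by (simp add: algebra_simps)
    qed
    also have "\<dots> = ennreal (\<bar>g ?x\<bar> powr p) + ennreal (B powr p) * (ennreal \<tau> * ennreal \<bar>?d ?x\<bar>)"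
      using \<tau> by (simp add: ennreal_plus ennreal_mult)
    finally show "(\<Sum>\<omega>\<in>stencil. ennreal (weight h \<tau> b (?x - h *\<^sub>R \<omega>) \<omega> * \<bar>g ?x\<bar> powr p))
        \<le> ennreal (\<bar>g ?x\<bar> powr p) + ennreal (B powr p) * (ennreal \<tau> * ennreal \<bar>?d ?x\<bar>)" .
  qed
  also have "\<dots> = (\<integral>\<^sup>+y. ennreal (\<bar>g (?N y)\<bar> powr p) \<partial>lborel)
      + (\<integral>\<^sup>+y. ennreal (B powr p) * (ennreal \<tau> * ennreal \<bar>?d (?N y)\<bar>) \<partial>lborel)"
    using Nm[of "\<lambda>x. ennreal (B powr p) * (ennreal \<tau> * ennreal \<bar>?d x\<bar>)"] Nm[of "\<lambda>x. ennreal (\<bar>g x\<bar> powr p)"]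
    by (intro nn_integral_add) simp_all
  also have "(\<integral>\<^sup>+y. ennreal (B powr p) * (ennreal \<tau> * ennreal \<bar>?d (?N y)\<bar>) \<partial>lborel)
      = ennreal (B powr p) * (ennreal \<tau> * (\<integral>\<^sup>+y. ennreal \<bar>?d (?N y)\<bar> \<partial>lborel))"
    using Nm[of "\<lambda>x. ennreal \<tau> * ennreal \<bar>?d x\<bar>"] Nm[of "\<lambda>x. ennreal \<bar>?d x\<bar>"]
    by (subst nn_integral_cmult, simp, subst nn_integral_cmult) simp_all
  finally show ?thesis .
qed

end

section \<open>Growth over all time steps and the truncation error\<close>

lemma u_trunc_eq_truncate: "u_trunc \<beta> h \<tau> \<Omega> v n j x = truncate (h powr (- \<beta>)) (u_disc h \<tau> \<Omega> v n j x)"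
  by (simp add: u_trunc_def truncate_def)

text \<open>The maximum principle is carried through the same induction, because every application
  of \<open>step_Lp\<close> needs a pointwise bound at the current step, with a constant that does
  not grow.\<close>

lemma scheme_Lp_bound:
  assumes sch: "truncated_scheme \<beta> T \<Omega> v f0 h \<tau> g"
    and h: "0 < h" and \<tau>: "0 < \<tau>" and CFL: "\<tau> * h powr (- \<beta>) / (2 * h) \<le> 1 / 7"
    and p: "1 \<le> p" and B: "\<And>x. x \<in> grid h \<Longrightarrow> \<bar>g 0 x\<bar> \<le> B"
    and n: "n \<le> num_steps T \<tau>"
  shows "(\<forall>x\<in>grid h. \<bar>g n x\<bar> \<le> B) \<and>
    (\<integral>\<^sup>+y. ennreal (\<bar>g n (nearest h y)\<bar> powr p) \<partial>lborel)
      \<le> (\<integral>\<^sup>+y. ennreal (\<bar>g 0 (nearest h y)\<bar> powr p) \<partial>lborel)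
      + ennreal (B powr p) * (\<Sum>k<n. ennreal \<tau> *
          (\<integral>\<^sup>+y. ennreal \<bar>\<Sum>j\<in>UNIV. cdiff h j (u_trunc \<beta> h \<tau> \<Omega> v k j) (nearest h y)\<bar> \<partial>lborel))"
  using n
proof (induction n)
  case 0
  then show ?case using B by simp
next
  case (Suc n)
  interpret explicit_step h \<tau> "h powr (- \<beta>)" "u_trunc \<beta> h \<tau> \<Omega> v n" "g n" "g (Suc n)"
    using sch h \<tau> CFL Suc.prems abs_truncate_le[of "h powr (- \<beta>)"]
    by unfold_locales (auto simp: truncated_scheme_def u_trunc_eq_truncate)
  have IH: "\<And>x. x \<in> grid h \<Longrightarrow> \<bar>g n x\<bar> \<le> B" using Suc by simp
  show ?case
  proof (intro conjI ballI)
    show "\<bar>g (Suc n) x\<bar> \<le> B" if "x \<in> grid h" for x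
      by (rule step_bound[OF IH that])
    let ?R = "\<lambda>k. ennreal \<tau> * (\<integral>\<^sup>+y. ennreal \<bar>\<Sum>j\<in>UNIV. cdiff h j (u_trunc \<beta> h \<tau> \<Omega> v k j) (nearest h y)\<bar> \<partial>lborel)"
    let ?I = "\<lambda>k. \<integral>\<^sup>+y. ennreal (\<bar>g k (nearest h y)\<bar> powr p) \<partial>lborel"
    have "?I (Suc n) \<le> ?I n + ennreal (B powr p) * ?R n" by (rule step_Lp[OF p IH])
    also have "\<dots> \<le> (?I 0 + ennreal (B powr p) * (\<Sum>k<n. ?R k)) + ennreal (B powr p) * ?R n"
      using Suc by (intro add_right_mono) simp
    also have "\<dots> = ?I 0 + ennreal (B powr p) * (\<Sum>k<Suc n. ?R k)"
      by (simp add: distrib_left add.assoc)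
    finally show "?I (Suc n) \<le> ?I 0 + ennreal (B powr p) * (\<Sum>k<Suc n. ?R k)" .
  qed
qed

lemma sum_rearrange:
  fixes c :: "'c::comm_semiring_1"
  shows "(\<Sum>k\<in>A. a k + c * (\<Sum>j\<in>B. p k j + (q k j + r k j)))
    = (\<Sum>k\<in>A. a k) + c * (\<Sum>j\<in>B. (\<Sum>k\<in>A. p k j) + ((\<Sum>k\<in>A. q k j) + (\<Sum>k\<in>A. r k j)))"
  by (simp add: sum.distrib sum_distrib_left[symmetric] sum.swap[of _ A B])

text \<open>The truncated velocity is the average plus its truncation error. The divergence of the
  average is an average of divergence quotients and is contracted with p = 1; the error is bounded
  by squares of averages, which are contracted with p = 2.\<close>

lemma truncated_divergence_bound:
  assumes h: "0 < h" and \<tau>: "0 < \<tau>" and V: "\<And>j. integrable lborel (V j)"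
    and u: "\<And>k j x. k < N \<Longrightarrow> u_disc h \<tau> \<Omega> v k j x = box_avg h \<tau> k (V j) x"
  shows "(\<Sum>k<N. ennreal \<tau> * (\<integral>\<^sup>+y. ennreal \<bar>\<Sum>j\<in>UNIV. cdiff h j (u_trunc \<beta> h \<tau> \<Omega> v k j) (nearest h y)\<bar> \<partial>lborel))
    \<le> (\<integral>\<^sup>+z. ennreal \<bar>\<Sum>j\<in>UNIV. stdiff h j (V j) z\<bar> \<partial>lborel)
      + ennreal (h powr \<beta>) * (\<Sum>j\<in>UNIV. L2sq lborel (stdiff h j (V j)) + 2 * L2sq lborel (V j))"
proof -
  let ?N = "nearest h" and ?D = "\<lambda>z. \<Sum>j\<in>UNIV. stdiff h j (V j) z"
  have Nm: "(\<lambda>y. F (?N y)) \<in> borel_measurable borel" for F :: "R3 \<Rightarrow> ennreal"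
    by (rule measurable_comp_nearest[OF h])
  have Vm[measurable]: "V j \<in> borel_measurable borel" for j using V[of j] by auto
  \<comment> \<open>The values at the two neighbours of a grid point are rewritten as averages of
    shifted fields over its own cell, which makes the same contraction lemma applicable to
    them.\<close>
  let ?P = "\<lambda>j z. V j (z + (0, h *\<^sub>R axis j 1))" and ?M = "\<lambda>j z. V j (z + (0, - (h *\<^sub>R axis j 1)))"
  have sh: "integrable lborel (\<lambda>z. V j (z + c))" "L2sq lborel (\<lambda>z. V j (z + c)) = L2sq lborel (V j)" for j c
    by (auto intro!: integral_lborel_shift(2) V L2sq_shift)
  have Di: "integrable lborel ?D" by (intro Bochner_Integration.integrable_sum integrable_stdiff V)
  let ?s = "\<lambda>k F y. ennreal ((box_avg h \<tau> k F (?N y))\<^sup>2)"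
  have pw: "ennreal \<bar>\<Sum>j\<in>UNIV. cdiff h j (u_trunc \<beta> h \<tau> \<Omega> v k j) (?N y)\<bar>
      \<le> ennreal \<bar>box_avg h \<tau> k ?D (?N y)\<bar>
        + ennreal (h powr \<beta>) * (\<Sum>j\<in>UNIV. ?s k (stdiff h j (V j)) y + (?s k (?P j) y + ?s k (?M j) y))"
    if k: "k < N" for k y
  proof -
    let ?x = "?N y"
    define U where "U = (\<lambda>j. box_avg h \<tau> k (V j))"
    let ?Tr = "truncate (h powr (- \<beta>))"
    have ut: "u_trunc \<beta> h \<tau> \<Omega> v k j = (\<lambda>x. U j x + (?Tr (U j x) - U j x))" for j
      using u[OF k] by (auto simp: u_trunc_eq_truncate U_def)
    have sumD: "(\<Sum>j\<in>UNIV. cdiff h j (U j) ?x) = box_avg h \<tau> k ?D ?x"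
      unfolding U_def by (simp add: cdiff_box_avg[OF V] sum_box_avg integrable_stdiff V)
    have err: "\<bar>cdiff h j (\<lambda>x. ?Tr (U j x) - U j x) ?x\<bar>
        \<le> h powr \<beta> * ((box_avg h \<tau> k (stdiff h j (V j)) ?x)\<^sup>2 + ((box_avg h \<tau> k (?P j) ?x)\<^sup>2 + (box_avg h \<tau> k (?M j) ?x)\<^sup>2))" for j
    proof -
      let ?a = "U j (?x + h *\<^sub>R axis j 1)" and ?b = "U j (?x - h *\<^sub>R axis j 1)"
      let ?c = "cdiff h j (U j) ?x"
      have P: "?a = box_avg h \<tau> k (?P j) ?x" and M: "?b = box_avg h \<tau> k (?M j) ?x"
        using box_avg_add[OF V, of h \<tau> k j ?x "h *\<^sub>R axis j 1"] box_avg_add[OF V, of h \<tau> k j ?x "- (h *\<^sub>R axis j 1)"]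
        by (simp_all add: U_def)
      have c: "?c = box_avg h \<tau> k (stdiff h j (V j)) ?x"
        unfolding U_def by (rule cdiff_box_avg[OF V])
      have "\<bar>cdiff h j (\<lambda>x. ?Tr (U j x) - U j x) ?x\<bar> = \<bar>(?Tr ?a - ?a) - (?Tr ?b - ?b)\<bar> / (2 * h)"
        using h by (simp add: cdiff_def)
      also have "\<dots> \<le> (\<bar>?a - ?b\<bar> * (\<bar>?a\<bar> + \<bar>?b\<bar>) / h powr (- \<beta>)) / (2 * h)"
        using h by (intro divide_right_mono truncate_minus_id_diff_le) auto
      \<comment> \<open>The factor |a - b| / (2h) is the modulus of the difference quotient, and
        dividing by the truncation level gives h^\<beta>, the gain that makes the error vanish in
        the limit.\<close>
      also have "\<dots> = h powr \<beta> * (\<bar>?c\<bar> * (\<bar>?a\<bar> + \<bar>?b\<bar>))"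
        using h by (simp add: cdiff_def powr_minus field_simps)
      also have "\<bar>?c\<bar> * (\<bar>?a\<bar> + \<bar>?b\<bar>) \<le> ?c\<^sup>2 + (?a\<^sup>2 + ?b\<^sup>2)"
        using sum_squares_bound[of "\<bar>?c\<bar>" "\<bar>?a\<bar>"] sum_squares_bound[of "\<bar>?c\<bar>" "\<bar>?b\<bar>"]
          zero_le_power2[of ?a] zero_le_power2[of ?b] unfolding power2_abs distrib_left by linarith
      finally show ?thesis using h unfolding P M c by (simp add: mult_left_mono)
    qed
    have "\<bar>\<Sum>j\<in>UNIV. cdiff h j (u_trunc \<beta> h \<tau> \<Omega> v k j) ?x\<bar>
        = \<bar>box_avg h \<tau> k ?D ?x + (\<Sum>j\<in>UNIV. cdiff h j (\<lambda>x. ?Tr (U j x) - U j x) ?x)\<bar>"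
      unfolding ut cdiff_add sum.distrib sumD ..
    also have "\<dots> \<le> \<bar>box_avg h \<tau> k ?D ?x\<bar> + (\<Sum>j\<in>UNIV. \<bar>cdiff h j (\<lambda>x. ?Tr (U j x) - U j x) ?x\<bar>)"
      by (rule order_trans[OF abs_triangle_ineq]) (intro add_left_mono sum_abs)
    also have "\<dots> \<le> \<bar>box_avg h \<tau> k ?D ?x\<bar> + (\<Sum>j\<in>UNIV. h powr \<beta> * ((box_avg h \<tau> k (stdiff h j (V j)) ?x)\<^sup>2
        + ((box_avg h \<tau> k (?P j) ?x)\<^sup>2 + (box_avg h \<tau> k (?M j) ?x)\<^sup>2)))"
      by (intro add_left_mono sum_mono err)
    finally have "ennreal \<bar>\<Sum>j\<in>UNIV. cdiff h j (u_trunc \<beta> h \<tau> \<Omega> v k j) ?x\<bar>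
        \<le> ennreal (\<bar>box_avg h \<tau> k ?D ?x\<bar> + h powr \<beta> * (\<Sum>j\<in>UNIV. (box_avg h \<tau> k (stdiff h j (V j)) ?x)\<^sup>2
        + ((box_avg h \<tau> k (?P j) ?x)\<^sup>2 + (box_avg h \<tau> k (?M j) ?x)\<^sup>2)))"
      unfolding sum_distrib_left[symmetric] by (rule ennreal_leI)
    also have "\<dots> = ennreal \<bar>box_avg h \<tau> k ?D ?x\<bar>
        + ennreal (h powr \<beta>) * (\<Sum>j\<in>UNIV. ?s k (stdiff h j (V j)) y + (?s k (?P j) y + ?s k (?M j) y))"
      by (subst ennreal_plus) (auto simp: ennreal_mult sum_nonneg simp flip: ennreal_plus)
    finally show ?thesis .
  qed
  let ?c = "\<lambda>p k F. ennreal \<tau> * (\<integral>\<^sup>+y. ennreal (\<bar>box_avg h \<tau> k F (?N y)\<bar> powr p) \<partial>lborel)"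
  have c2: "ennreal \<tau> * (\<integral>\<^sup>+y. ?s k F y \<partial>lborel) = ?c 2 k F" for k F
    by (simp only: abs_powr_2)
  have le: "ennreal \<tau> * (\<integral>\<^sup>+y. ennreal \<bar>\<Sum>j\<in>UNIV. cdiff h j (u_trunc \<beta> h \<tau> \<Omega> v k j) (?N y)\<bar> \<partial>lborel)
      \<le> ?c 1 k ?D + ennreal (h powr \<beta>) * (\<Sum>j\<in>UNIV. ?c 2 k (stdiff h j (V j)) + (?c 2 k (?P j) + ?c 2 k (?M j)))"
    if k: "k < N" for k
  proof -
    have sm: "(\<lambda>y. ?s k F y) \<in> borel_measurable borel" for F by (rule Nm)
    have "(\<integral>\<^sup>+y. ennreal \<bar>\<Sum>j\<in>UNIV. cdiff h j (u_trunc \<beta> h \<tau> \<Omega> v k j) (?N y)\<bar> \<partial>lborel)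
      \<le> (\<integral>\<^sup>+y. ennreal \<bar>box_avg h \<tau> k ?D (?N y)\<bar>
        + ennreal (h powr \<beta>) * (\<Sum>j\<in>UNIV. ?s k (stdiff h j (V j)) y + (?s k (?P j) y + ?s k (?M j) y)) \<partial>lborel)"
      by (rule nn_integral_mono) (rule pw[OF k])
    also have "\<dots> = (\<integral>\<^sup>+y. ennreal \<bar>box_avg h \<tau> k ?D (?N y)\<bar> \<partial>lborel)
        + (\<integral>\<^sup>+y. ennreal (h powr \<beta>) * (\<Sum>j\<in>UNIV. ?s k (stdiff h j (V j)) y + (?s k (?P j) y + ?s k (?M j) y)) \<partial>lborel)"
    proof (rule nn_integral_add)
      show "(\<lambda>y. ennreal \<bar>box_avg h \<tau> k ?D (?N y)\<bar>) \<in> borel_measurable lborel"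
        unfolding measurable_lborel2 by (rule Nm)
    qed (use sm in simp)
    also have "(\<integral>\<^sup>+y. ennreal (h powr \<beta>) * (\<Sum>j\<in>UNIV. ?s k (stdiff h j (V j)) y + (?s k (?P j) y + ?s k (?M j) y)) \<partial>lborel)
        = ennreal (h powr \<beta>) * (\<integral>\<^sup>+y. (\<Sum>j\<in>UNIV. ?s k (stdiff h j (V j)) y + (?s k (?P j) y + ?s k (?M j) y)) \<partial>lborel)"
      by (rule nn_integral_cmult) (use sm in simp)
    also have "(\<integral>\<^sup>+y. (\<Sum>j\<in>UNIV. ?s k (stdiff h j (V j)) y + (?s k (?P j) y + ?s k (?M j) y)) \<partial>lborel)
        = (\<Sum>j\<in>UNIV. (\<integral>\<^sup>+y. ?s k (stdiff h j (V j)) y \<partial>lborel)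
            + ((\<integral>\<^sup>+y. ?s k (?P j) y \<partial>lborel) + (\<integral>\<^sup>+y. ?s k (?M j) y \<partial>lborel)))"
    proof (subst nn_integral_sum)
      show "(\<lambda>y. ?s k (stdiff h j (V j)) y + (?s k (?P j) y + ?s k (?M j) y)) \<in> borel_measurable lborel" for j
        using sm by (intro borel_measurable_add) simp_all
      show "(\<Sum>j\<in>UNIV. \<integral>\<^sup>+y. ?s k (stdiff h j (V j)) y + (?s k (?P j) y + ?s k (?M j) y) \<partial>lborel)
        = (\<Sum>j\<in>UNIV. (\<integral>\<^sup>+y. ?s k (stdiff h j (V j)) y \<partial>lborel)
            + ((\<integral>\<^sup>+y. ?s k (?P j) y \<partial>lborel) + (\<integral>\<^sup>+y. ?s k (?M j) y \<partial>lborel)))"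
        using sm by (intro sum.cong refl) (subst nn_integral_add, simp, simp, subst nn_integral_add, simp_all)
    qed
    finally have "ennreal \<tau> * (\<integral>\<^sup>+y. ennreal \<bar>\<Sum>j\<in>UNIV. cdiff h j (u_trunc \<beta> h \<tau> \<Omega> v k j) (?N y)\<bar> \<partial>lborel)
      \<le> ennreal \<tau> * ((\<integral>\<^sup>+y. ennreal \<bar>box_avg h \<tau> k ?D (?N y)\<bar> \<partial>lborel) + ennreal (h powr \<beta>) *
        (\<Sum>j\<in>UNIV. (\<integral>\<^sup>+y. ?s k (stdiff h j (V j)) y \<partial>lborel)
            + ((\<integral>\<^sup>+y. ?s k (?P j) y \<partial>lborel) + (\<integral>\<^sup>+y. ?s k (?M j) y \<partial>lborel))))"
      by (rule mult_left_mono) simp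
    also have "\<dots> = ?c 1 k ?D + ennreal (h powr \<beta>) * (\<Sum>j\<in>UNIV. ?c 2 k (stdiff h j (V j)) + (?c 2 k (?P j) + ?c 2 k (?M j)))"
      unfolding c2[symmetric] by (simp add: distrib_left mult.left_commute sum_distrib_left)
    finally show ?thesis .
  qed
  have "(\<Sum>k<N. ennreal \<tau> * (\<integral>\<^sup>+y. ennreal \<bar>\<Sum>j\<in>UNIV. cdiff h j (u_trunc \<beta> h \<tau> \<Omega> v k j) (?N y)\<bar> \<partial>lborel))
      \<le> (\<Sum>k<N. ?c 1 k ?D + ennreal (h powr \<beta>) * (\<Sum>j\<in>UNIV. ?c 2 k (stdiff h j (V j)) + (?c 2 k (?P j) + ?c 2 k (?M j))))"
    by (intro sum_mono le) simp
  also have "\<dots> = (\<Sum>k<N. ?c 1 k ?D) + ennreal (h powr \<beta>) *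
      (\<Sum>j\<in>UNIV. (\<Sum>k<N. ?c 2 k (stdiff h j (V j))) + ((\<Sum>k<N. ?c 2 k (?P j)) + (\<Sum>k<N. ?c 2 k (?M j))))"
    by (rule sum_rearrange)
  also have "\<dots> \<le> (\<integral>\<^sup>+z. ennreal (\<bar>?D z\<bar> powr 1) \<partial>lborel) + ennreal (h powr \<beta>) *
      (\<Sum>j\<in>UNIV. (\<integral>\<^sup>+z. ennreal (\<bar>stdiff h j (V j) z\<bar> powr 2) \<partial>lborel)
        + ((\<integral>\<^sup>+z. ennreal (\<bar>?P j z\<bar> powr 2) \<partial>lborel) + (\<integral>\<^sup>+z. ennreal (\<bar>?M j z\<bar> powr 2) \<partial>lborel)))"
    by (intro add_mono mult_left_mono sum_mono sum_box_avg_contraction h \<tau> Di integrable_stdiff V sh) auto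
  \<comment> \<open>Both shifted fields have the norm of \<open>V j\<close>, whence the factor
    2.\<close>
  also have "\<dots> = (\<integral>\<^sup>+z. ennreal \<bar>?D z\<bar> \<partial>lborel)
      + ennreal (h powr \<beta>) * (\<Sum>j\<in>UNIV. L2sq lborel (stdiff h j (V j)) + 2 * L2sq lborel (V j))"
    using sh(2) unfolding abs_powr_2 L2sq_def by (simp add: mult_2)
  finally show ?thesis .
qed

section \<open>Initial data and the scaling condition\<close>

lemma initial_data_borel_version:
  assumes \<Omega>: "open \<Omega>" "bounded \<Omega>" and f0: "Linf_space \<Omega> f0"
  obtains f B where "f \<in> borel_measurable borel" "AE x in lborel. ext0 \<Omega> f0 x = f x" "0 \<le> B"
    "AE x in lborel. \<bar>f x\<bar> \<le> B" "\<And>p. 1 \<le> p \<Longrightarrow> integrable lborel (\<lambda>x. \<bar>f x\<bar> powr p)"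
proof -
  have S: "\<Omega> \<in> sets lebesgue" using \<Omega>(1) by (simp add: borel_open)
  have "f0 \<in> borel_measurable (lebesgue_on \<Omega>)" using f0 by (simp add: Linf_space_def)
  then obtain f where fm[measurable]: "f \<in> borel_measurable borel" and f: "AE x in lborel. ext0 \<Omega> f0 x = f x"
    using lebesgue_borel_version S by blast
  obtain B0 where "AE x in lebesgue_on \<Omega>. \<bar>f0 x\<bar> \<le> B0" using f0 by (auto simp: Linf_space_def)
  then have B0: "AE x in lborel. x \<in> \<Omega> \<longrightarrow> \<bar>f0 x\<bar> \<le> B0"
    using S by (simp add: AE_restrict_space_iff AE_completion_iff)
  \<comment> \<open>The essential bound may be negative if \<Omega> is empty, and B must also bound
    the extension by 0.\<close>
  define B where "B = max B0 0"
  have le: "AE x in lborel. \<bar>f x\<bar> \<le> B * indicator \<Omega> x"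
    using f B0 by eventually_elim (auto simp: ext0_def B_def split: split_indicator)
  have fin: "emeasure lborel \<Omega> < \<infinity>" by (rule emeasure_bounded_finite[OF \<Omega>(2)])
  show thesis
  proof
    show "AE x in lborel. \<bar>f x\<bar> \<le> B"
      using le by eventually_elim (auto simp: B_def split: split_indicator_asm)
    show "integrable lborel (\<lambda>x. \<bar>f x\<bar> powr p)" if p: "1 \<le> p" for p
    proof (rule integrableI_bounded)
      have "(\<integral>\<^sup>+x. ennreal (norm (\<bar>f x\<bar> powr p)) \<partial>lborel) \<le> (\<integral>\<^sup>+x. ennreal (B powr p) * indicator \<Omega> x \<partial>lborel)"
      proof (rule nn_integral_mono_AE)
        show "AE x in lborel. ennreal (norm (\<bar>f x\<bar> powr p)) \<le> ennreal (B powr p) * indicator \<Omega> x"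
          using le
        proof eventually_elim
          case (elim x)
          show ?case
          proof (cases "x \<in> \<Omega>")
            case True
            with elim p show ?thesis by (auto intro!: ennreal_leI powr_mono2)
          qed (use elim in simp)
        qed
      qed
      also have "\<dots> = ennreal (B powr p) * emeasure lborel \<Omega>"
        using \<Omega> by (intro nn_integral_cmult_indicator) (simp add: borel_open)
      also have "\<dots> < \<infinity>" using fin by (simp add: ennreal_mult_less_top)
      finally show "(\<integral>\<^sup>+x. ennreal (norm (\<bar>f x\<bar> powr p)) \<partial>lborel) < \<infinity>" .
    qed measurable
  qed (use f fm in \<open>auto simp: B_def\<close>)
qed

lemma g_init_borel_version:
  assumes [measurable]: "f \<in> borel_measurable borel" and f: "AE x in lborel. ext0 \<Omega> f0 x = f x"
  shows "g_init h \<Omega> f0 x = 1 / h ^ 3 * (LINT y:cell h x|lborel. f y)"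
proof -
  have "(LINT y:cell h x|lebesgue. ext0 \<Omega> f0 y) = (\<integral>y. indicator (cell h x) y * f y \<partial>lborel)"
  proof (rule set_lebesgue_integral_borel_version)
    show "AE y in lborel. indicator (cell h x) y * ext0 \<Omega> f0 y = indicator (cell h x) y * f y"
      using f by eventually_elim simp
  qed measurable
  then show ?thesis by (simp add: g_init_def set_lebesgue_integral_def)
qed

lemma abs_cell_average_le:
  assumes fi: "integrable lborel f" and B: "AE x in lborel. \<bar>f x\<bar> \<le> B" and h: "0 < h"
  shows "\<bar>1 / h ^ 3 * (LINT y:cell h x|lborel. f y)\<bar> \<le> B"
proof -
  have m: "measure lborel (cell h x) = h ^ 3"
    using emeasure_cell[OF h, of x] h by (simp add: measure_def)
  have i: "integrable lborel (\<lambda>y. indicator (cell h x) y * f y)"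
    using integrable_mult_indicator[of "cell h x" lborel f] fi by simp
  have ii: "integrable lborel (\<lambda>y. indicator (cell h x) y * B)"
    using emeasure_cell[OF h, of x] by (intro integrable_mult_left) (simp add: integrable_indicator_iff)
  have "\<bar>LINT y:cell h x|lborel. f y\<bar> \<le> (\<integral>y. \<bar>indicator (cell h x) y * f y\<bar> \<partial>lborel)"
    unfolding set_lebesgue_integral_def using integral_abs_bound[of lborel "\<lambda>y. indicator (cell h x) y * f y"] by simp
  also have "\<dots> \<le> (\<integral>y. indicator (cell h x) y * B \<partial>lborel)"
  proof (rule integral_mono_AE)
    show "AE y in lborel. \<bar>indicator (cell h x) y * f y\<bar> \<le> indicator (cell h x) y * B"
      using B by eventually_elim (simp add: indicator_def)
  qed (use i ii in auto)
  also have "\<dots> = h ^ 3 * B" using m by simp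
  finally show ?thesis using h by (simp add: abs_mult field_simps)
qed

text \<open>The exponent 1 - (\<alpha> + \<beta>) is positive, so h > 1 would make the power at
  least 1, against 2/7. Inserting \<tau> = h^(2 - \<alpha>) turns the last claim into half the
  scaling inequality.\<close>

lemma scalingD:
  assumes "(h, \<tau>) \<in> scaling \<alpha> \<beta>" "\<alpha> + \<beta> < 1"
  shows "0 < h" "h \<le> 1" "0 < \<tau>" "\<tau> * h powr (- \<beta>) / (2 * h) \<le> 1 / 7"
proof -
  have s: "0 < h" "0 < \<tau>" "\<tau> = h powr (2 - \<alpha>)" "h powr (1 - (\<alpha> + \<beta>)) \<le> 2 / 7"
    using assms by (auto simp: scaling_def)
  then show "0 < h" "0 < \<tau>" by auto
  show "h \<le> 1"
  proof (rule ccontr)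
    assume "\<not> h \<le> 1"
    then have "1 \<le> h powr (1 - (\<alpha> + \<beta>))" using assms(2) by (intro ge_one_powr_ge_zero) auto
    with s(4) show False by simp
  qed
  have e: "1 - (\<alpha> + \<beta>) = (2 - \<alpha>) + (- \<beta>) + (- 1)" by simp
  have "h powr (1 - (\<alpha> + \<beta>)) = \<tau> * h powr (- \<beta>) * h powr (- 1)"
    unfolding e powr_add s(3) ..
  also have "h powr (- 1) = 1 / h" using s(1) powr_minus_divide[of h 1] by simp
  finally have "\<tau> * h powr (- \<beta>) / (2 * h) = h powr (1 - (\<alpha> + \<beta>)) / 2" by simp
  then show "\<tau> * h powr (- \<beta>) / (2 * h) \<le> 1 / 7" using s(4) by linarith
qed

text \<open>The bounds for the scheme depend on h alone; this transfers their one-sided limits in h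
  to the filter on pairs.\<close>

lemma filterlim_fst_scaling: "filterlim fst (at_right 0) (at (0, 0) within scaling \<alpha> \<beta>)"
  unfolding filterlim_at
proof
  have "isCont fst (0 :: real, 0 :: real)" by simp
  then show "(fst \<longlongrightarrow> 0) (at (0, 0) within scaling \<alpha> \<beta>)"
    using continuous_within_subset[of "(0, 0)" UNIV fst "scaling \<alpha> \<beta>"] by (simp add: continuous_within)
  show "\<forall>\<^sub>F x in at (0, 0) within scaling \<alpha> \<beta>. fst x \<in> {0<..} \<and> fst x \<noteq> 0"
    unfolding eventually_at_filter by (rule always_eventually) (auto simp: scaling_def)
qed

lemma step_fun_LpLp:
  fixes g :: "nat \<Rightarrow> R3 \<Rightarrow> real"
  assumes h: "0 < h" and \<tau>: "0 < \<tau>" and T: "0 < T" and p: "1 \<le> p" and X: "0 \<le> X"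
    and bnd: "\<And>n. n \<le> num_steps T \<tau> \<Longrightarrow> (\<integral>\<^sup>+y. ennreal (\<bar>g n (nearest h y)\<bar> powr p) \<partial>lborel) \<le> ennreal X"
  shows "LpLp_space p T (step_fun h \<tau> g)"
    and "LpLp_norm p T (step_fun h \<tau> g) \<le> (T * X) powr (1 / p)"
proof -
  let ?N = "nearest h" and ?n = "\<lambda>s. nat \<lfloor>s / \<tau>\<rfloor>"
  have Nm[measurable]: "(\<lambda>y. F (?N y)) \<in> borel_measurable borel" for F :: "R3 \<Rightarrow> real"
    by (rule measurable_comp_nearest[OF h])
  \<comment> \<open>Times up to and including T reach the step with index
    \<open>num_steps T \<tau>\<close>, which extends beyond T; hence \<open>bnd\<close> is assumed
    for that index as well.\<close>
  have n_le: "?n s \<le> num_steps T \<tau>" if "s \<in> {0..T}" for s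
    unfolding num_steps_def using that \<tau> by (intro nat_mono floor_mono divide_right_mono) auto
  define q where "q n = Lp_norm p UNIV (g n \<circ> ?N) powr p" for n
  have q: "Lp_space p UNIV (g n \<circ> ?N)" "0 \<le> q n" "q n \<le> X" if n: "n \<le> num_steps T \<tau>" for n
  proof -
    have i: "integrable lborel (\<lambda>y. \<bar>g n (?N y)\<bar> powr p)"
      by (rule integrableI_bounded) (use le_less_trans[OF bnd[OF n], of top] in \<open>auto simp: Nm\<close>)
    have int: "integrable lebesgue (\<lambda>y. \<bar>g n (?N y)\<bar> powr p)"
      using i by (simp add: integrable_completion)
    then show "Lp_space p UNIV (g n \<circ> ?N)"
      unfolding Lp_space_def set_integrable_def
      by (auto simp: o_def measurable_completion Nm lebesgue_on_UNIV_eq)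
    have I: "(LINT y:UNIV|lebesgue. \<bar>(g n \<circ> ?N) y\<bar> powr p) = (\<integral>y. \<bar>g n (?N y)\<bar> powr p \<partial>lborel)"
      unfolding set_lebesgue_integral_def by (simp add: integral_completion Nm)
    have "ennreal (\<integral>y. \<bar>g n (?N y)\<bar> powr p \<partial>lborel) \<le> ennreal X"
      using bnd[OF n] by (subst nn_integral_eq_integral[symmetric]) (use i in auto)
    moreover have "q n = (\<integral>y. \<bar>g n (?N y)\<bar> powr p \<partial>lborel)"
      unfolding q_def Lp_norm_def I using p by (simp add: powr_powr integral_nonneg_AE)
    ultimately show "q n \<le> X" "0 \<le> q n" using X by (auto simp: integral_nonneg_AE)
  qed
  have sf: "step_fun h \<tau> g s = g (?n s) \<circ> ?N" for s by (auto simp: step_fun_def)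
  have nm[measurable]: "?n \<in> borel \<rightarrow>\<^sub>M count_space UNIV" by measurable
  have qm: "(\<lambda>s. q (?n s)) \<in> borel_measurable borel"
    by (rule measurable_compose[OF nm]) simp
  have qi: "set_integrable lebesgue {0..T} (\<lambda>s. q (?n s))"
    unfolding set_integrable_def
    by (rule integrableI_bounded_set_indicator[where B=X])
      (use q n_le qm T in \<open>auto simp: measurable_completion\<close>)
  show "LpLp_space p T (step_fun h \<tau> g)"
    unfolding LpLp_space_def
  proof (intro conjI)
    have "(\<lambda>z. g (?n (fst z)) (?N (snd z))) \<in> borel_measurable (borel \<Otimes>\<^sub>M borel)"
    proof (rule measurable_compose_countable[where f="\<lambda>n z. g n (?N (snd z))"])
      show "(\<lambda>z. ?n (fst z)) \<in> borel \<Otimes>\<^sub>M borel \<rightarrow>\<^sub>M count_space UNIV" by measurable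
      show "(\<lambda>z. g n (?N (snd z))) \<in> borel_measurable (borel \<Otimes>\<^sub>M borel)" for n
        by (rule measurable_compose[OF measurable_snd Nm])
    qed
    then have "(\<lambda>(t, x). step_fun h \<tau> g t x) \<in> borel_measurable (borel :: (real \<times> R3) measure)"
      by (simp add: borel_prod case_prod_beta' sf)
    then show "(\<lambda>(t, x). step_fun h \<tau> g t x) \<in> borel_measurable (lebesgue_on ({0..T} \<times> UNIV))"
      by (intro measurable_restrict_space1 measurable_completion) simp
    show "AE t in lebesgue_on {0..T}. Lp_space p UNIV (step_fun h \<tau> g t)"
      by (rule AE_I2) (use q n_le in \<open>auto simp: sf\<close>)
    show "set_integrable lebesgue {0..T} (\<lambda>t. Lp_norm p UNIV (step_fun h \<tau> g t) powr p)"
      using qi by (simp add: sf q_def)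
  qed
  have "(LINT t:{0..T}|lebesgue. q (?n t)) \<le> (LINT t:{0..T}|lebesgue. X)"
    by (rule set_integral_mono[OF qi]) (use q n_le T in \<open>auto simp: set_integrable_def integrable_indicator_iff\<close>)
  also have "\<dots> = T * X"
    using T by (simp add: set_lebesgue_integral_def)
  finally have "(LINT t:{0..T}|lebesgue. q (?n t)) powr (1 / p) \<le> (T * X) powr (1 / p)"
    using p q n_le by (intro powr_mono2) (auto simp: set_lebesgue_integral_def intro!: integral_nonneg_AE split: split_indicator)
  then show "LpLp_norm p T (step_fun h \<tau> g) \<le> (T * X) powr (1 / p)"
    by (simp add: LpLp_norm_def sf q_def)
qed

theorem proposition3p3:
  fixes T \<alpha> \<beta> :: real
    and \<Omega> :: "R3 set"
    and v :: "real \<Rightarrow> R3 \<Rightarrow> R3"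
    and f0 :: "R3 \<Rightarrow> real"
    and g :: "real \<Rightarrow> real \<Rightarrow> nat \<Rightarrow> R3 \<Rightarrow> real"
  assumes "0 < T"
    and "open \<Omega>" "connected \<Omega>" "bounded \<Omega>"
    and "L2_H10 T \<Omega> v" "Linf_L2 T \<Omega> v"
    and "AE t in lebesgue_on {0..T}. weak_div_free \<Omega> (v t)"
    and "ess_support (ext0 ({0..T} \<times> \<Omega>) (\<lambda>(t, x). v t x)) \<subseteq> {0..T} \<times> \<Omega>"
    and "Linf_space \<Omega> f0"
    and "\<exists>U. open U \<and> frontier \<Omega> \<subseteq> U \<and> (AE x in lebesgue_on (\<Omega> \<inter> U). f0 x = 0)"
    and "0 < \<alpha>" "1 / 2 < \<beta>" "\<alpha> + \<beta> < 1"
    and "\<And>h \<tau>. (h, \<tau>) \<in> scaling \<alpha> \<beta> \<Longrightarrow> truncated_scheme \<beta> T \<Omega> v f0 h \<tau> (g h \<tau>)"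
  shows "\<forall>p\<ge>1.
    (\<exists>C. \<forall>(h, \<tau>)\<in>scaling \<alpha> \<beta>.
       LpLp_space p T (step_fun h \<tau> (g h \<tau>)) \<and> LpLp_norm p T (step_fun h \<tau> (g h \<tau>)) \<le> C) \<and>
    Limsup (at (0, 0) within scaling \<alpha> \<beta>)
        (\<lambda>(h, \<tau>). ereal (LpLp_norm p T (step_fun h \<tau> (g h \<tau>))))
      \<le> ereal (T powr (1 / p) * Lp_norm p UNIV (ext0 \<Omega> f0)) \<and>
    T powr (1 / p) * Lp_norm p UNIV (ext0 \<Omega> f0) = T powr (1 / p) * Lp_norm p \<Omega> f0"
proof (intro allI impI)
  fix p :: real assume p: "1 \<le> p"
  note T = assms(1) and \<Omega> = assms(2) and b = assms(4) and L2 = assms(5) and div = assms(7)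
  obtain V where Vm: "\<And>j. V j \<in> borel_measurable borel"
    and V0: "\<And>j t x. (t, x) \<notin> {0..T} \<times> \<Omega> \<Longrightarrow> V j (t, x) = 0"
    and Veq: "AE t in lborel. t \<in> {0..T} \<longrightarrow> (\<forall>j. AE x in lborel. ext0 \<Omega> (\<lambda>x. v t x $ j) x = V j (t, x))"
    by (rule velocity_borel_version[OF \<Omega> L2]) blast+
  obtain K where K: "0 \<le> K" "\<And>j. L2sq lborel (V j) \<le> ennreal K"
    "\<And>h j. 0 < h \<Longrightarrow> L2sq lborel (stdiff h j (V j)) \<le> ennreal K"
    "\<And>h. 0 < h \<Longrightarrow> L2sq lborel (\<lambda>z. \<Sum>j\<in>UNIV. stdiff h j (V j) z) \<le> ennreal K"
    "((\<lambda>h. L2sq lborel (\<lambda>z. \<Sum>j\<in>UNIV. stdiff h j (V j) z)) \<longlongrightarrow> 0) (at_right 0)"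
    by (rule velocity_estimates[OF \<Omega> L2 div Vm V0 Veq]) blast+
  define D where "D h = (\<integral>\<^sup>+z. ennreal \<bar>\<Sum>j\<in>UNIV. stdiff h j (V j) z\<bar> \<partial>lborel)" for h
  obtain K' where K': "0 \<le> K'" "\<And>h. 0 < h \<Longrightarrow> h \<le> 1 \<Longrightarrow> D h \<le> ennreal K'" "(D \<longlongrightarrow> 0) (at_right 0)"
    unfolding D_def by (rule velocity_divergence_L1[OF b Vm V0 K(1,4,5)]) blast+
  \<comment> \<open>A square-integrable function supported in a set of finite measure is integrable:
    V is its own product with the indicator of that set, and both factors are in L^2.\<close>
  have Vi: "integrable lborel (V j)" for j
  proof -
    let ?B = "{0..T} \<times> \<Omega>"
    have B: "?B \<in> sets borel" using \<Omega> by (simp add: borel_prod[symmetric] borel_open)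
    have "L2sq lborel (indicator ?B :: _ \<Rightarrow> real) = emeasure lborel ?B"
    proof -
      have "L2sq lborel (indicator ?B :: _ \<Rightarrow> real) = (\<integral>\<^sup>+z. indicator ?B z \<partial>lborel)"
        unfolding L2sq_def by (intro nn_integral_cong) (simp add: indicator_def)
      then show ?thesis using B by simp
    qed
    also have "\<dots> < \<infinity>" by (intro emeasure_bounded_finite bounded_Times b) simp
    finally have "integrable lborel (\<lambda>z. V j z * indicator ?B z)"
      using Vm B K(2)[of j] by (intro integrable_mult_L2) (auto simp: order_le_less_trans)
    also have "(\<lambda>z. V j z * indicator ?B z) = V j"
    proof
      show "V j z * indicator ?B z = V j z" for z
        using V0[of "fst z" "snd z" j] by (cases "z \<in> ?B") simp_all
    qed
    finally show ?thesis .
  qed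
  obtain f B where fm: "f \<in> borel_measurable borel" and f: "AE x in lborel. ext0 \<Omega> f0 x = f x" and B: "0 \<le> B"
    and fB: "AE x in lborel. \<bar>f x\<bar> \<le> B" and fp: "\<And>p. 1 \<le> p \<Longrightarrow> integrable lborel (\<lambda>x. \<bar>f x\<bar> powr p)"
    by (rule initial_data_borel_version[OF \<Omega> b assms(9)]) blast+
  have fi: "integrable lborel f" using fp[of 1] fm by (simp add: integrable_abs_iff)
  define \<Phi> where "\<Phi> = (\<integral>x. \<bar>f x\<bar> powr p \<partial>lborel)"
  have \<Phi>: "0 \<le> \<Phi>" "(\<integral>\<^sup>+x. ennreal (\<bar>f x\<bar> powr p) \<partial>lborel) = ennreal \<Phi>"
    unfolding \<Phi>_def by (auto intro!: nn_integral_eq_integral fp p)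
  \<comment> \<open>9 K is the sum over three directions of K + 2 K, the bounds for a quotient and
    for twice the squared norm of V. Thus \<open>R\<close> bounds the L^1 norm of the discrete
    divergence accumulated over all time steps.\<close>
  define R where "R h = D h + ennreal (h powr \<beta> * (9 * K))" for h
  \<comment> \<open>The norms are real numbers, so \<open>R\<close> is converted to one; by
    \<open>R_le\<close> it is finite for h <= 1 and nothing is lost.\<close>
  define X where "X h = \<Phi> + B powr p * enn2real (R h)" for h
  have R_le: "R h \<le> ennreal (K' + 9 * K)" if "0 < h" "h \<le> 1" for h
  proof -
    have "h powr \<beta> \<le> 1" using that assms(12) by (intro powr_le1) auto
    then have "h powr \<beta> * (9 * K) \<le> 9 * K" using K(1) by (simp add: mult_left_le_one_le)
    then have "R h \<le> ennreal K' + ennreal (9 * K)"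
      unfolding R_def using K'(2) that by (intro add_mono ennreal_leI) auto
    then show ?thesis using K'(1) K(1) by simp
  qed
  have step: "(\<integral>\<^sup>+y. ennreal (\<bar>g h \<tau> n (nearest h y)\<bar> powr p) \<partial>lborel) \<le> ennreal (X h)"
    if s: "(h, \<tau>) \<in> scaling \<alpha> \<beta>" and n: "n \<le> num_steps T \<tau>" for h \<tau> n
  proof -
    note hs = scalingD[OF s assms(13)] and sch = assms(14)[OF s]
    have g0: "g h \<tau> 0 x = 1 / h ^ 3 * (LINT y:cell h x|lborel. f y)" if "x \<in> grid h" for x
      using sch that by (simp add: truncated_scheme_def g_init_borel_version[OF fm f])
    have "(\<integral>\<^sup>+y. ennreal (\<bar>g h \<tau> n (nearest h y)\<bar> powr p) \<partial>lborel)
        \<le> (\<integral>\<^sup>+y. ennreal (\<bar>g h \<tau> 0 (nearest h y)\<bar> powr p) \<partial>lborel)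
      + ennreal (B powr p) * (\<Sum>k<n. ennreal \<tau> *
          (\<integral>\<^sup>+y. ennreal \<bar>\<Sum>j\<in>UNIV. cdiff h j (u_trunc \<beta> h \<tau> \<Omega> v k j) (nearest h y)\<bar> \<partial>lborel))"
      using scheme_Lp_bound[OF sch hs(1,3,4) p _ n, of B] g0 abs_cell_average_le[OF fi fB hs(1)] by auto
    also have "(\<integral>\<^sup>+y. ennreal (\<bar>g h \<tau> 0 (nearest h y)\<bar> powr p) \<partial>lborel) \<le> ennreal \<Phi>"
      unfolding g0[OF nearest_grid[OF hs(1)]] \<Phi>(2)[symmetric] by (rule cell_average_contraction[OF p hs(1) fi])
    also have "(\<Sum>k<n. ennreal \<tau> *
          (\<integral>\<^sup>+y. ennreal \<bar>\<Sum>j\<in>UNIV. cdiff h j (u_trunc \<beta> h \<tau> \<Omega> v k j) (nearest h y)\<bar> \<partial>lborel)) \<le> R h"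
    proof -
      have "(\<Sum>k<n. ennreal \<tau> *
          (\<integral>\<^sup>+y. ennreal \<bar>\<Sum>j\<in>UNIV. cdiff h j (u_trunc \<beta> h \<tau> \<Omega> v k j) (nearest h y)\<bar> \<partial>lborel))
        \<le> D h + ennreal (h powr \<beta>) * (\<Sum>j\<in>UNIV. L2sq lborel (stdiff h j (V j)) + 2 * L2sq lborel (V j))"
        unfolding D_def
        by (rule truncated_divergence_bound[OF hs(1,3) Vi])
          (use n T in \<open>auto intro!: u_disc_eq_box_avg[OF hs(3) _ _ Vi Veq]\<close>)
      also have "\<dots> \<le> D h + ennreal (h powr \<beta>) * (\<Sum>j\<in>(UNIV :: 3 set). ennreal K + 2 * ennreal K)"
        by (intro add_left_mono mult_left_mono sum_mono add_mono K hs) auto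
      also have "(\<Sum>j\<in>(UNIV :: 3 set). ennreal K + 2 * ennreal K) = ennreal (9 * K)"
      proof -
        have "ennreal K + 2 * ennreal K = 3 * ennreal K"
          using distrib_right[of 1 2 "ennreal K"] by simp
        moreover have "ennreal (9 * K) = 9 * ennreal K" using K(1) by (subst ennreal_mult) auto
        ultimately show ?thesis by (simp add: mult.assoc[symmetric])
      qed
      also have "D h + ennreal (h powr \<beta>) * ennreal (9 * K) = R h"
        using K(1) by (simp add: R_def ennreal_mult)
      finally show ?thesis .
    qed
    also have "ennreal \<Phi> + ennreal (B powr p) * R h = ennreal (X h)"
    proof -
      have "R h = ennreal (enn2real (R h))"
        using le_less_trans[OF R_le[OF hs(1,2)] ennreal_less_top] by simp
      then have "ennreal \<Phi> + ennreal (B powr p) * R h = ennreal \<Phi> + ennreal (B powr p * enn2real (R h))"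
        by (simp add: ennreal_mult)
      then show ?thesis using \<Phi>(1) by (simp add: X_def)
    qed
    finally show ?thesis by (simp add: add_mono mult_left_mono)
  qed
  have Xn: "0 \<le> X h" for h using \<Phi>(1) by (simp add: X_def)
  have bnd: "LpLp_space p T (step_fun h \<tau> (g h \<tau>)) \<and>
      LpLp_norm p T (step_fun h \<tau> (g h \<tau>)) \<le> (T * X h) powr (1 / p)"
    if "(h, \<tau>) \<in> scaling \<alpha> \<beta>" for h \<tau>
    using step_fun_LpLp[where g = "g h \<tau>", OF scalingD(1,3)[OF that assms(13)] T p Xn step[OF that]] by blast
  have "\<exists>C. \<forall>(h, \<tau>)\<in>scaling \<alpha> \<beta>. LpLp_space p T (step_fun h \<tau> (g h \<tau>)) \<and> LpLp_norm p T (step_fun h \<tau> (g h \<tau>)) \<le> C"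
  proof (intro exI[of _ "(T * (\<Phi> + B powr p * (K' + 9 * K))) powr (1 / p)"] ballI, clarify, intro conjI)
    fix h \<tau> assume s: "(h, \<tau>) \<in> scaling \<alpha> \<beta>"
    note hs = scalingD[OF s assms(13)]
    show "LpLp_space p T (step_fun h \<tau> (g h \<tau>))" using bnd[OF s] by blast
    have "enn2real (R h) \<le> K' + 9 * K"
      using K(1) K'(1) by (intro enn2real_leI R_le hs(1,2)) simp
    then have "X h \<le> \<Phi> + B powr p * (K' + 9 * K)"
      unfolding X_def by (intro add_left_mono mult_left_mono) auto
    then have "(T * X h) powr (1 / p) \<le> (T * (\<Phi> + B powr p * (K' + 9 * K))) powr (1 / p)"
      using T p Xn by (intro powr_mono2 mult_left_mono) auto
    with bnd[OF s] show "LpLp_norm p T (step_fun h \<tau> (g h \<tau>)) \<le> (T * (\<Phi> + B powr p * (K' + 9 * K))) powr (1 / p)"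
      by simp
  qed
  moreover have norm: "Lp_norm p UNIV (ext0 \<Omega> f0) = \<Phi> powr (1 / p)"
  proof -
    have "(LINT x:UNIV|lebesgue. \<bar>ext0 \<Omega> f0 x\<bar> powr p) = \<Phi>"
      unfolding \<Phi>_def
    proof (rule set_lebesgue_integral_borel_version)
      show "AE x in lborel. indicator UNIV x * \<bar>ext0 \<Omega> f0 x\<bar> powr p = \<bar>f x\<bar> powr p"
        using f by eventually_elim simp
    qed (use fm in measurable)
    then show ?thesis by (simp add: Lp_norm_def)
  qed
  moreover have "Lp_norm p \<Omega> f0 = \<Phi> powr (1 / p)"
  proof -
    have "(LINT x:\<Omega>|lebesgue. \<bar>f0 x\<bar> powr p) = \<Phi>"
      unfolding \<Phi>_def
    proof (rule set_lebesgue_integral_borel_version)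
      show "AE x in lborel. indicator \<Omega> x * \<bar>f0 x\<bar> powr p = \<bar>f x\<bar> powr p"
        using f by eventually_elim (auto simp: ext0_def split: if_splits split_indicator)
    qed (use fm in measurable)
    then show ?thesis by (simp add: Lp_norm_def)
  qed
  moreover have "Limsup (at (0, 0) within scaling \<alpha> \<beta>)
        (\<lambda>(h, \<tau>). ereal (LpLp_norm p T (step_fun h \<tau> (g h \<tau>))))
      \<le> ereal (T powr (1 / p) * Lp_norm p UNIV (ext0 \<Omega> f0))"
  proof -
    let ?F = "at (0, 0) within scaling \<alpha> \<beta>" and ?Y = "\<lambda>h. (T * X h) powr (1 / p)"
    have "((\<lambda>h. ennreal (h powr \<beta> * (9 * K))) \<longlongrightarrow> ennreal 0) (at_right 0)"
    proof (rule tendsto_ennrealI)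
      have "((\<lambda>h. h powr \<beta>) \<longlongrightarrow> 0) (at_right (0::real))"
      proof (rule tendsto_zero_powrI[OF tendsto_ident_at tendsto_const])
        show "\<forall>\<^sub>F h in at_right (0::real). 0 \<le> h"
          using eventually_at_right_less[of "0::real"] by (rule eventually_mono) simp
      qed (use assms(12) in simp)
      then show "((\<lambda>h. h powr \<beta> * (9 * K)) \<longlongrightarrow> 0) (at_right 0)"
        by (rule tendsto_mult_left_zero)
    qed
    from tendsto_add[OF K'(3) this] have "(R \<longlongrightarrow> 0) (at_right 0)"
      by (simp add: R_def[abs_def])
    then have "(R \<longlongrightarrow> ennreal 0) (at_right 0)" by simp
    from tendsto_enn2real[OF this] have "((\<lambda>h. enn2real (R h)) \<longlongrightarrow> 0) (at_right 0)" by simp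
    then have "(X \<longlongrightarrow> \<Phi> + B powr p * 0) (at_right 0)"
      unfolding X_def by (intro tendsto_add tendsto_mult tendsto_const)
    \<comment> \<open>The limit of the base is 0 if f^0 vanishes; continuity of the power there uses
      that the exponent is positive and that the base stays nonnegative.\<close>
    then have "(?Y \<longlongrightarrow> (T * \<Phi>) powr (1 / p)) (at_right 0)"
      using p T Xn \<Phi>(1) by (intro tendsto_powr') (auto intro!: tendsto_intros always_eventually)
    then have lim: "((\<lambda>z. ?Y (fst z)) \<longlongrightarrow> (T * \<Phi>) powr (1 / p)) ?F"
      by (rule filterlim_compose[OF _ filterlim_fst_scaling])
    have ev: "\<forall>\<^sub>F z in ?F. (case z of (h, \<tau>) \<Rightarrow> ereal (LpLp_norm p T (step_fun h \<tau> (g h \<tau>)))) \<le> ereal (?Y (fst z))"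
      unfolding eventually_at_filter by (rule always_eventually) (use bnd in auto)
    have "Limsup ?F (\<lambda>(h, \<tau>). ereal (LpLp_norm p T (step_fun h \<tau> (g h \<tau>)))) \<le> Limsup ?F (\<lambda>z. ereal (?Y (fst z)))"
      by (rule Limsup_mono[OF ev])
    also have "\<dots> \<le> ereal ((T * \<Phi>) powr (1 / p))"
    \<comment> \<open>Identifying the Limsup with the limit asks for a nontrivial filter; on the
      trivial one every upper bound holds.\<close>
    proof (cases "?F = bot")
      case False
      then show ?thesis using lim_imp_Limsup[OF False tendsto_ereal[OF lim]] by simp
    next
      case True
      show ?thesis by (rule Limsup_bounded) (simp add: True)
    qed
    also have "(T * \<Phi>) powr (1 / p) = T powr (1 / p) * Lp_norm p UNIV (ext0 \<Omega> f0)"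
      using T \<Phi>(1) by (simp add: norm powr_mult)
    finally show ?thesis .
  qed
  ultimately show "(\<exists>C. \<forall>(h, \<tau>)\<in>scaling \<alpha> \<beta>.
       LpLp_space p T (step_fun h \<tau> (g h \<tau>)) \<and> LpLp_norm p T (step_fun h \<tau> (g h \<tau>)) \<le> C) \<and>
    Limsup (at (0, 0) within scaling \<alpha> \<beta>)
        (\<lambda>(h, \<tau>). ereal (LpLp_norm p T (step_fun h \<tau> (g h \<tau>))))
      \<le> ereal (T powr (1 / p) * Lp_norm p UNIV (ext0 \<Omega> f0)) \<and>
    T powr (1 / p) * Lp_norm p UNIV (ext0 \<Omega> f0) = T powr (1 / p) * Lp_norm p \<Omega> f0"
    by (intro conjI) (simp_all only:)
qed

end
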